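(* Let $X$ be a Hausdorff compact space with Borel measure $\mu$, let $\alpha:X\to X$ be a continuous mapping preserving $\mu$ (i.e. $\mu\circ\alpha^{-1}=\mu$), and let $1\le p<\infty$. Let $\lambda:C(X)\to\mathbb{R}$, $\lambda(\varphi)=\ln r(e^\varphi T_\alpha)$, be the spectral exponent of the weighted composition operators $e^\varphi T_\alpha$ ($\varphi\in C(X)$) acting in the space $L^p(X,\mu)$. Define $\widehat{\lambda}:l_\infty\times C(X)\to\mathbb{R}\cup\{+\infty\}$ by $$\widehat{\lambda}(\mathbf{c},\varphi)=\begin{cases}\ln\sum_{n=0}^\infty e^{c_n+n\lambda(\varphi)} & \text{if } \mathbf{c}\in l_\infty \text{ and } \lambda(\varphi)<0,\\ +\infty & \text{otherwise.}\end{cases}$$ Then the Legendre-Fenchel transform $\widehat{\lambda}^*$ of $\widehat{\lambda}$, as a functional on $l_1\times C(X)^*$, is the lower semicontinuous regularization of the functional $F:l_1\times C(X)^*\to\mathbb{R}\cup\{+\infty\}$ given by $$F(\mathbf{t},\bar{\mu})=\frac{1}{p}\Big(\sum_{n=0}^\infty nt_n\Big)\tau_\alpha\Big(\frac{\bar{\mu}}{\sum_{n=0}^\infty nt_n}\Big)+\sum_{n=0}^\infty t_n\ln t_n$$ on the set $$\Big\{(\mathbf{t},\bar{\mu})\in l_1\times C(X)^*:\ \mathbf{t}\in\widetilde{S}\setminus\{e_0\},\ \bar{\mu}\in M_\alpha\ \text{ and }\ \bar{\mu}(X)=\sum_{n=0}^\infty nt_n\Big\}$$ and $F=+\infty$ otherwise,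 where $\tau_\alpha$ is the $T$-entropy. Moreover, in the case $\bar{\mu}(X)=0$, that is at the point $(\mathbf{t},\bar{\mu})=(e_0,\mathbf{0})$, the functional $\widehat{\lambda}^*$ takes the value zero: $\widehat{\lambda}^*(e_0,\mathbf{0})=0$.
   Context: $C(X)$ is the space of real continuous functions on $X$ with the sup norm; its dual $C(X)^*$ is identified with the finite signed regular Borel measures on $X$, with $\langle\nu,\varphi\rangle=\int_X\varphi\,d\nu$. Sequences $\mathbf{c}=(c_n)_{n=0}^\infty$, $\mathbf{t}=(t_n)_{n=0}^\infty$ are real and indexed by $n\ge 0$. Convention: $0\ln 0=0$. The weighted composition operator with weight $a\in C(X)$ is $(aT_\alpha)u(x)=a(x)u(\alpha(x))$, acting in $L^p(X,\mu)$; $r(\cdot)$ denotes the spectral radius. $M_\alpha\subset C(X)^*$ is the set of all (nonnegative) $\alpha$-invariant measures on $X$ and $M_\alpha^1$ the subset of probability measures in $M_\alpha$. $T$-entropy: $\tau_\alpha$ is the nonnegative, convex, lower semicontinuous functional on $M_\alpha^1$ (with values in $[0,+\infty]$) constructed by Antonevich, Bakhtin and Lebedev. It satisfies the following known facts, which determine it: with $\lambda^*(\nu)=\sup_{\varphi\in C(X)}\{\int_X\varphi\,d\nu-\lambda(\varphi)\}$ for $\nu\in C(X)^*$, one has $\lambda^*(\nu)=\tau_\alpha(\nu)/p$ for $\nu\in M_\alpha^1$ and $\lambda^*(\nu)=+\infty$ for $\nu\notin M_\alpha^1$; moreover $\lambda$ is convex and continuous on $C(X)$ and $\lambda(\varphi)=\max_{\nu\in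 M_\alpha^1}\{\int_X\varphi\,d\nu-\tau_\alpha(\nu)/p\}$. $\widetilde{S}=\{\mathbf{t}=(t_n)_{n=0}^\infty:\ t_n\ge 0,\ \sum_{n=0}^\infty t_n=1,\ \sum_{n=0}^\infty n t_n<\infty\}\subset l_1$ and $e_0=(1,0,0,\dots)$. (For $\mathbf{t}\in\widetilde{S}$ the series $\sum_n t_n\ln t_n$ converges to a finite value.) The Legendre-Fenchel transform (convex conjugate) of $\widehat{\lambda}$ is $$\widehat{\lambda}^*(\mathbf{t},\bar{\mu})=\sup_{(\mathbf{c},\varphi)\in l_\infty\times C(X)}\Big\{\sum_{n=0}^\infty c_nt_n+\int_X\varphi\,d\bar{\mu}-\widehat{\lambda}(\mathbf{c},\varphi)\Big\},\qquad(\mathbf{t},\bar{\mu})\in l_1\times C(X)^*.$$ The lower semicontinuous regularization of a functional is the greatest lower semicontinuous functional pointwise less than or equal to it; here $l_1\times C(X)^*$ carries the product of the norm topology of $l_1$ and the weak-$*$ topology of $C(X)^*$. *)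

theory Defs
  imports "HOL-Analysis.Analysis"
begin

text \<open>
  Throughout, X is the universe of a type \<open>'a\<close> of class \<open>t2_space\<close>; that it is compact is assumed
  in the theorem. Then \<open>'a \<Rightarrow>\<^sub>C real\<close> (bounded continuous functions, sup norm) is C(X), and
  \<open>('a \<Rightarrow>\<^sub>C real) \<Rightarrow>\<^sub>L real\<close> is its dual. The dual is not replaced by a type of signed measures;
  a functional is a (nonnegative) measure when it is integration against a regular Borel measure.
\<close>

subsection \<open>Weighted composition operators and their spectral radius in complex $L^p$\<close>

text \<open>Elements of $L^p$ are represented by functions; equality of classes is equality a.e.\<close>

definition Lp :: "real \<Rightarrow> 'a measure \<Rightarrow> ('a \<Rightarrow> complex) set" where
  "Lp p M = {f \<in> borel_measurable M. integrable M (\<lambda>x. cmod (f x) powr p)}"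

definition Lp_norm :: "real \<Rightarrow> 'a measure \<Rightarrow> ('a \<Rightarrow> complex) \<Rightarrow> real" where
  "Lp_norm p M f = (\<integral>x. cmod (f x) powr p \<partial>M) powr (1 / p)"

text \<open>
  \<open>z\<close> is in the resolvent set iff \<open>z I - A\<close> is a bijection of $L^p$ with bounded inverse. The
  lower bound expresses both injectivity and boundedness of the inverse.
\<close>

definition Lp_resolvent_set ::
    "real \<Rightarrow> 'a measure \<Rightarrow> (('a \<Rightarrow> complex) \<Rightarrow> 'a \<Rightarrow> complex) \<Rightarrow> complex set" where
  "Lp_resolvent_set p M A =
    {z. (\<forall>g \<in> Lp p M. \<exists>f \<in> Lp p M. AE x in M. z * f x - A f x = g x) \<and>
        (\<exists>C. \<forall>f \<in> Lp p M. Lp_norm p M f \<le> C * Lp_norm p M (\<lambda>x. z * f x - A f x))}"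

definition Lp_spectrum ::
    "real \<Rightarrow> 'a measure \<Rightarrow> (('a \<Rightarrow> complex) \<Rightarrow> 'a \<Rightarrow> complex) \<Rightarrow> complex set" where
  "Lp_spectrum p M A = - Lp_resolvent_set p M A"

definition Lp_spectral_radius ::
    "real \<Rightarrow> 'a measure \<Rightarrow> (('a \<Rightarrow> complex) \<Rightarrow> 'a \<Rightarrow> complex) \<Rightarrow> real" where
  "Lp_spectral_radius p M A = Sup (cmod ` Lp_spectrum p M A)"

definition weighted_comp ::
    "('a \<Rightarrow> real) \<Rightarrow> ('a \<Rightarrow> 'a) \<Rightarrow> ('a \<Rightarrow> complex) \<Rightarrow> 'a \<Rightarrow> complex" where
  "weighted_comp a \<alpha> u = (\<lambda>x. complex_of_real (a x) * u (\<alpha> x))"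

definition spectral_exponent ::
    "real \<Rightarrow> 'a::t2_space measure \<Rightarrow> ('a \<Rightarrow> 'a) \<Rightarrow> ('a \<Rightarrow>\<^sub>C real) \<Rightarrow> real" where
  "spectral_exponent p M \<alpha> \<phi> =
    ln (Lp_spectral_radius p M (weighted_comp (\<lambda>x. exp (apply_bcontfun \<phi> x)) \<alpha>))"

subsection \<open>Invariant measures as elements of the dual of C(X)\<close>

definition regular_borel_measure :: "'a::t2_space measure \<Rightarrow> bool" where
  "regular_borel_measure m \<longleftrightarrow> sets m = sets borel \<and>
    (\<forall>B \<in> sets borel.
       emeasure m B = (SUP K \<in> {K. compact K \<and> K \<subseteq> B}. emeasure m K) \<and>
       emeasure m B = (INF U \<in> {U. open U \<and> B \<subseteq> U}. emeasure m U))"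

definition is_integration ::
    "'a::t2_space measure \<Rightarrow> (('a \<Rightarrow>\<^sub>C real) \<Rightarrow>\<^sub>L real) \<Rightarrow> bool" where
  "is_integration m \<nu> \<longleftrightarrow> (\<forall>\<phi>. blinfun_apply \<nu> \<phi> = (\<integral>x. apply_bcontfun \<phi> x \<partial>m))"

definition invariant_measures ::
    "('a::t2_space \<Rightarrow> 'a) \<Rightarrow> (('a \<Rightarrow>\<^sub>C real) \<Rightarrow>\<^sub>L real) set" where
  "invariant_measures \<alpha> =
    {\<nu>. \<exists>m. finite_measure m \<and> regular_borel_measure m \<and> distr m borel \<alpha> = m \<and>
            is_integration m \<nu>}"

text \<open>The mass \<open>\<nu>(X)\<close>, i.e. the integral of the constant function 1.\<close>

definition total_mass :: "(('a::t2_space \<Rightarrow>\<^sub>C real) \<Rightarrow>\<^sub>L real) \<Rightarrow> real" where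
  "total_mass \<nu> = blinfun_apply \<nu> (const_bcontfun 1)"

definition invariant_prob_measures ::
    "('a::t2_space \<Rightarrow> 'a) \<Rightarrow> (('a \<Rightarrow>\<^sub>C real) \<Rightarrow>\<^sub>L real) set" where
  "invariant_prob_measures \<alpha> = {\<nu> \<in> invariant_measures \<alpha>. total_mass \<nu> = 1}"

subsection \<open>T-entropy\<close>

definition conjugate ::
    "(('a::t2_space \<Rightarrow>\<^sub>C real) \<Rightarrow> real) \<Rightarrow> (('a \<Rightarrow>\<^sub>C real) \<Rightarrow>\<^sub>L real) \<Rightarrow> ereal" where
  "conjugate lam \<nu> = (SUP \<phi>. ereal (blinfun_apply \<nu> \<phi> - lam \<phi>))"

text \<open>
  T-entropy is introduced through the identity
  $\lambda^*(\nu) = \tau_\alpha(\nu)/p$ on invariant probability measures, which determines it. Off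
  that set it is not defined in the literature; it is given the value \<open>\<infinity>\<close> here and is never used.
\<close>

definition T_entropy ::
    "real \<Rightarrow> 'a::t2_space measure \<Rightarrow> ('a \<Rightarrow> 'a) \<Rightarrow> (('a \<Rightarrow>\<^sub>C real) \<Rightarrow>\<^sub>L real) \<Rightarrow> ereal" where
  "T_entropy p M \<alpha> \<nu> =
    (if \<nu> \<in> invariant_prob_measures \<alpha> then ereal p * conjugate (spectral_exponent p M \<alpha>) \<nu>
     else \<infinity>)"

subsection \<open>The sequence space and lower semicontinuous regularization\<close>

definition l1 :: "(nat \<Rightarrow> real) set" where
  "l1 = {t. summable (\<lambda>n. \<bar>t n\<bar>)}"

text \<open>\<open>infsum\<close> rather than \<open>suminf\<close>, so that the distance is nonnegative also outside \<open>l1\<close>.\<close>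

definition l1_dist :: "(nat \<Rightarrow> real) \<Rightarrow> (nat \<Rightarrow> real) \<Rightarrow> real" where
  "l1_dist s t = (\<Sum>\<^sub>\<infinity>n. \<bar>s n - t n\<bar>)"

lemma Metric_space_l1: "Metric_space l1 l1_dist"
proof -
  have summ: "(\<lambda>n. \<bar>s n - t n\<bar>) summable_on UNIV" if "s \<in> l1" "t \<in> l1" for s t
  proof -
    have "summable (\<lambda>n. \<bar>s n\<bar> + \<bar>t n\<bar>)"
      using that by (auto simp: l1_def intro: summable_add)
    then have "summable (\<lambda>n. \<bar>s n - t n\<bar>)"
      by (rule summable_comparison_test') (auto intro: abs_triangle_ineq4)
    then show ?thesis
      by (subst summable_on_UNIV_nonneg_real_iff) auto
  qed
  show ?thesis
  proof
    show "0 \<le> l1_dist s t" for s t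
      by (auto simp: l1_dist_def intro: infsum_nonneg)
    show "l1_dist s t = l1_dist t s" for s t
      by (simp add: l1_dist_def abs_minus_commute)
    show "l1_dist s t = 0 \<longleftrightarrow> s = t" if "s \<in> l1" "t \<in> l1" for s t
    proof
      assume "l1_dist s t = 0"
      then have "\<bar>s n - t n\<bar> = 0" for n
        using nonneg_infsum_le_0D[of "\<lambda>n. \<bar>s n - t n\<bar>" UNIV n] summ[OF that]
        by (simp add: l1_dist_def)
      then show "s = t" by auto
    qed (simp add: l1_dist_def)
    show "l1_dist s u \<le> l1_dist s t + l1_dist t u" if "s \<in> l1" "t \<in> l1" "u \<in> l1" for s t u
    proof -
      have "l1_dist s u \<le> (\<Sum>\<^sub>\<infinity>n. \<bar>s n - t n\<bar> + \<bar>t n - u n\<bar>)"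
        unfolding l1_dist_def
        by (rule infsum_mono) (use that summ in \<open>auto intro: summable_on_add\<close>)
      also have "\<dots> = l1_dist s t + l1_dist t u"
        unfolding l1_dist_def by (rule infsum_add) (use that summ in auto)
      finally show ?thesis .
    qed
  qed
qed

text \<open>
  For functionals the strong operator topology is the topology of pointwise convergence on C(X),
  i.e. the weak-* topology.
\<close>

definition l1_dual_topology ::
    "((nat \<Rightarrow> real) \<times> (('a::t2_space \<Rightarrow>\<^sub>C real) \<Rightarrow>\<^sub>L real)) topology" where
  "l1_dual_topology = prod_topology (Metric_space.mtopology l1 l1_dist) strong_operator_topology"

definition lsc_on :: "'b topology \<Rightarrow> ('b \<Rightarrow> ereal) \<Rightarrow> bool" where
  "lsc_on T f \<longleftrightarrow> (\<forall>a. openin T {x \<in> topspace T. a < f x})"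

definition is_lsc_regularization :: "'b topology \<Rightarrow> ('b \<Rightarrow> ereal) \<Rightarrow> ('b \<Rightarrow> ereal) \<Rightarrow> bool" where
  "is_lsc_regularization T F G \<longleftrightarrow>
    lsc_on T G \<and> (\<forall>x \<in> topspace T. G x \<le> F x) \<and>
    (\<forall>H. lsc_on T H \<and> (\<forall>x \<in> topspace T. H x \<le> F x) \<longrightarrow> (\<forall>x \<in> topspace T. H x \<le> G x))"

subsection \<open>The functionals of the theorem\<close>

definition l_infty :: "(nat \<Rightarrow> real) set" where
  "l_infty = {c. bounded (range c)}"

definition lambda_hat ::
    "real \<Rightarrow> 'a::t2_space measure \<Rightarrow> ('a \<Rightarrow> 'a) \<Rightarrow> (nat \<Rightarrow> real) \<Rightarrow> ('a \<Rightarrow>\<^sub>C real) \<Rightarrow> ereal" where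
  "lambda_hat p M \<alpha> c \<phi> =
    (if c \<in> l_infty \<and> spectral_exponent p M \<alpha> \<phi> < 0
     then ereal (ln (\<Sum>n. exp (c n + real n * spectral_exponent p M \<alpha> \<phi>)))
     else \<infinity>)"

definition lambda_hat_conjugate ::
    "real \<Rightarrow> 'a::t2_space measure \<Rightarrow> ('a \<Rightarrow> 'a) \<Rightarrow>
     (nat \<Rightarrow> real) \<times> (('a \<Rightarrow>\<^sub>C real) \<Rightarrow>\<^sub>L real) \<Rightarrow> ereal" where
  "lambda_hat_conjugate p M \<alpha> = (\<lambda>(t, \<nu>).
    SUP (c, \<phi>) \<in> l_infty \<times> UNIV.
      ereal ((\<Sum>n. c n * t n) + blinfun_apply \<nu> \<phi>) - lambda_hat p M \<alpha> c \<phi>)"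

definition S_tilde :: "(nat \<Rightarrow> real) set" where
  "S_tilde = {t. (\<forall>n. 0 \<le> t n) \<and> t sums 1 \<and> summable (\<lambda>n. real n * t n)}"

definition e0 :: "nat \<Rightarrow> real" where
  "e0 n = (if n = 0 then 1 else 0)"

definition mean :: "(nat \<Rightarrow> real) \<Rightarrow> real" where
  "mean t = (\<Sum>n. real n * t n)"

text \<open>The convention \<open>0 ln 0 = 0\<close> holds automatically.\<close>

definition F_functional ::
    "real \<Rightarrow> 'a::t2_space measure \<Rightarrow> ('a \<Rightarrow> 'a) \<Rightarrow>
     (nat \<Rightarrow> real) \<times> (('a \<Rightarrow>\<^sub>C real) \<Rightarrow>\<^sub>L real) \<Rightarrow> ereal" where
  "F_functional p M \<alpha> = (\<lambda>(t, \<nu>).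
    if t \<in> S_tilde - {e0} \<and> \<nu> \<in> invariant_measures \<alpha> \<and> total_mass \<nu> = mean t
    then ereal (1 / p) * ereal (mean t) * T_entropy p M \<alpha> ((1 / mean t) *\<^sub>R \<nu>)
         + ereal (\<Sum>n. t n * ln (t n))
    else \<infinity>)"

end

theory Submission
  imports Defs
begin

text \<open>
  Write \<open>\<lambda>\<close> for the spectral exponent, \<open>m\<close> for the mean of \<open>t\<close>, \<open>h(t) = \<Sum> t\<^sub>n ln t\<^sub>n\<close> and
  \<open>w = \<nu>(1)\<close>. The proof computes the conjugate and approximates it by values of \<open>F\<close> directly. It
  rests on four properties of \<open>\<lambda>\<close>: it is monotone, \<open>\<lambda>(\<phi> + c) = \<lambda>(\<phi>) + c\<close>, it is at most \<open>\<lambda>(0)\<close> on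
  coboundaries \<open>\<psi> \<circ> \<alpha> - \<psi>\<close>, and some functional \<open>\<nu>\<^sub>0\<close> lies below it.

  \<^bold>\<open>The spectral exponent.\<close> The powers of the operator are \<open>u \<mapsto> exp(S\<^sub>n\<phi>) \<sqdot> u \<circ> \<alpha>\<^sup>n\<close> with
  Birkhoff sums \<open>S\<^sub>n\<phi>\<close>. Its spectral radius is the infimum \<open>\<rho>\<close> of the \<open>s\<close> for which the norms
  of the powers are \<open>O(s\<^sup>n)\<close> (\<open>spectral_radius_eq_growth_rate\<close>). Outside this radius the
  Neumann series inverts; and \<open>\<rho>\<close> itself is a spectral value because the operator is positive,
  so a lower bound at \<open>\<rho>\<close> would bound the truncated Neumann series at \<open>\<rho>\<close> uniformly, whose
  square then forces strictly faster decay. Comparing Birkhoff sums gives the first three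
  properties (\<open>lam_transfer\<close>). Averaging \<open>S\<^sub>n\<phi> / n\<close> over preimages of a set of finite positive
  measure, Jensen's inequality and a cluster point give \<open>\<nu>\<^sub>0\<close> (\<open>functional_below_lam\<close>).

  \<^bold>\<open>Upper bound.\<close> That the conjugate is at most \<open>F\<close> is the Gibbs inequality
  (\<open>lambda_hat_conjugate_le_F\<close>); lower semicontinuity holds for any supremum of continuous
  affine functionals.

  \<^bold>\<open>Lower bound.\<close> Suppose the conjugate at \<open>(t, \<nu>)\<close> is at most a real number \<open>L\<close>. Optimizing over
  \<open>c\<close> shows that \<open>t\<close> is a probability sequence with finite mean and that
  \<open>h(t) + \<nu>(\<phi>) - m \<lambda>(\<phi>) \<le> L\<close> whenever \<open>\<lambda>(\<phi>) < 0\<close>. Adding constants to \<open>\<phi>\<close> turns this into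
  \<open>m \<le> w\<close> and \<open>\<nu>(\<phi>) - w \<lambda>(\<phi>) \<le> L - h(t)\<close> for \<^emph>\<open>all\<close> \<open>\<phi>\<close>
  (\<open>lambda_hat_conjugate_finite\<close>). Thus the conjugate can be finite although the total mass
  exceeds the mean, where \<open>F\<close> is infinite. The missing mean is supplied by moving a mass
  \<open>\<epsilon>\<close> of \<open>t\<close> to a far away site, which is small in \<open>l\<^sub>1\<close> and by convexity costs almost no entropy;
  adding \<open>\<delta> \<nu>\<^sub>0\<close> to \<open>\<nu>\<close> keeps the second inequality and makes the mass positive, so that the
  degenerate point \<open>(e\<^sub>0, 0)\<close> is covered by the same construction. At the approximants the value of
  \<open>F\<close> exceeds \<open>L\<close> by an arbitrarily small amount at most, so every lower semicontinuous minorant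
  of \<open>F\<close> is at most \<open>L\<close> at \<open>(t, \<nu>)\<close> (\<open>lsc_minorant_le_lambda_hat_conjugate\<close>).

  A functional satisfying the second inequality is positive and invariant, since \<open>\<lambda>\<close> is bounded above on
  negative functions and on coboundaries (\<open>invariant_measures_if_bounded\<close>). That it is integration
  against an invariant regular measure is the Riesz representation theorem on a compact Hausdorff
  space, proved below by Caratheodory's construction.
\<close>

section \<open>Minkowski's inequality and series in $L^p$\<close>

lemma powr_convex_combination:
  fixes a b \<theta> p :: real
  assumes "0 \<le> a" "0 \<le> b" "0 \<le> \<theta>" "\<theta> \<le> 1" "1 \<le> p"
  shows "(\<theta> * a + (1 - \<theta>) * b) powr p \<le> \<theta> * a powr p + (1 - \<theta>) * b powr p"
proof -
  have scale: "(c * x) powr p \<le> c * x powr p" if "0 \<le> c" "c \<le> 1" "0 \<le> x" for c x :: real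
  proof -
    have "c powr p \<le> c"
    proof (cases "c = 0")
      case False
      then have "c powr p \<le> c powr 1"
        using that assms by (intro powr_mono') auto
      then show ?thesis using that by simp
    qed auto
    then show ?thesis
      using that by (simp add: powr_mult mult_right_mono)
  qed
  consider "a = 0" | "b = 0" | "a > 0" "b > 0"
    using assms by fastforce
  then show ?thesis
  proof cases
    case 1
    then show ?thesis using scale[of "1 - \<theta>" b] assms by simp
  next
    case 2
    then show ?thesis using scale[of \<theta> a] assms by simp
  next
    case 3
    then show ?thesis
      using convex_onD[OF powr_convex[OF \<open>1 \<le> p\<close>], of "1 - \<theta>" a b] assms by simp
  qed
qed

lemma Lp_norm_nonneg [simp]: "0 \<le> Lp_norm p M f"
  by (simp add: Lp_norm_def)

lemma Lp_norm_powr: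
  assumes "p > 0"
  shows "Lp_norm p M f powr p = (\<integral>x. cmod (f x) powr p \<partial>M)"
  using assms by (simp add: Lp_norm_def powr_powr)

lemma Lp_norm_leI:
  assumes "p > 0" "0 \<le> c" "(\<integral>x. cmod (f x) powr p \<partial>M) \<le> c powr p"
  shows "Lp_norm p M f \<le> c"
proof -
  have "Lp_norm p M f \<le> (c powr p) powr (1 / p)"
    unfolding Lp_norm_def using assms by (intro powr_mono2) auto
  then show ?thesis using assms by (simp add: powr_powr)
qed

lemma Lp_dominated:
  assumes p: "p > 0" and c: "0 \<le> c" and f: "f \<in> borel_measurable M" and g: "g \<in> Lp p M"
    and le: "AE x in M. cmod (f x) \<le> c * cmod (g x)"
  shows "f \<in> Lp p M" and "Lp_norm p M f \<le> c * Lp_norm p M g"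
proof -
  note [measurable] = f
  have ig: "integrable M (\<lambda>x. c powr p * cmod (g x) powr p)"
    using g by (auto simp: Lp_def)
  have le': "AE x in M. cmod (f x) powr p \<le> c powr p * cmod (g x) powr p"
    using le
  proof eventually_elim
    case (elim x)
    then have "cmod (f x) powr p \<le> (c * cmod (g x)) powr p"
      using p by (intro powr_mono2) auto
    then show ?case using c by (simp add: powr_mult)
  qed
  have if': "integrable M (\<lambda>x. cmod (f x) powr p)"
    by (rule Bochner_Integration.integrable_bound[OF ig]) (use le' in auto)
  then show "f \<in> Lp p M"
    using f by (simp add: Lp_def)
  have "(\<integral>x. cmod (f x) powr p \<partial>M) \<le> (\<integral>x. c powr p * cmod (g x) powr p \<partial>M)"
    by (rule integral_mono_AE[OF if' ig le'])
  also have "\<dots> = (c * Lp_norm p M g) powr p"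
    using p c by (simp add: powr_mult Lp_norm_powr)
  finally show "Lp_norm p M f \<le> c * Lp_norm p M g"
    using p c by (intro Lp_norm_leI) auto
qed

lemma Lp_cmult:
  assumes p: "p > 0" and f: "f \<in> Lp p M"
  shows "(\<lambda>x. c * f x) \<in> Lp p M" and "Lp_norm p M (\<lambda>x. c * f x) \<le> cmod c * Lp_norm p M f"
proof -
  have [measurable]: "f \<in> borel_measurable M"
    using f by (simp add: Lp_def)
  have m: "(\<lambda>x. c * f x) \<in> borel_measurable M"
    by measurable
  show "(\<lambda>x. c * f x) \<in> Lp p M" and "Lp_norm p M (\<lambda>x. c * f x) \<le> cmod c * Lp_norm p M f"
    using Lp_dominated[OF p norm_ge_zero m f, of c] by (auto simp: norm_mult)
qed

text \<open>Convexity of \<open>x \<mapsto> x\<^sup>p\<close>, applied to \<open>|f|/a\<close> and \<open>|g|/b\<close> with weights proportional to \<open>a\<close> and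
  \<open>b\<close>. Taking \<open>a\<close> and \<open>b\<close> strictly above the two norms avoids dividing by a norm that vanishes.\<close>

lemma Lp_minkowski:
  assumes p: "1 \<le> p" and f: "f \<in> Lp p M" and g: "g \<in> Lp p M"
  shows "(\<lambda>x. f x + g x) \<in> Lp p M"
    and "Lp_norm p M (\<lambda>x. f x + g x) \<le> Lp_norm p M f + Lp_norm p M g"
proof -
  have meas [measurable]: "f \<in> borel_measurable M" "g \<in> borel_measurable M"
    using f g by (auto simp: Lp_def)
  have int: "integrable M (\<lambda>x. cmod (f x) powr p)" "integrable M (\<lambda>x. cmod (g x) powr p)"
    using f g by (auto simp: Lp_def)
  have *: "integrable M (\<lambda>x. cmod (f x + g x) powr p) \<and> Lp_norm p M (\<lambda>x. f x + g x) \<le> a + b"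
    if a: "a > Lp_norm p M f" and b: "b > Lp_norm p M g" for a b
  proof -
    have pos: "a > 0" "b > 0"
      using a b Lp_norm_nonneg[of p M f] Lp_norm_nonneg[of p M g] by linarith+
    define \<theta> where "\<theta> = a / (a + b)"
    have \<theta>: "0 \<le> \<theta>" "\<theta> \<le> 1"
      using pos by (auto simp: \<theta>_def)
    define G where "G x = (a + b) powr p *
        (\<theta> * (cmod (f x) powr p / a powr p) + (1 - \<theta>) * (cmod (g x) powr p / b powr p))" for x
    have le: "cmod (f x + g x) powr p \<le> G x" for x
    proof -
      have "cmod (f x) + cmod (g x) = (a + b) * (\<theta> * (cmod (f x) / a) + (1 - \<theta>) * (cmod (g x) / b))"
        using pos by (simp add: \<theta>_def divide_simps)
      then have "cmod (f x + g x) powr p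
          \<le> ((a + b) * (\<theta> * (cmod (f x) / a) + (1 - \<theta>) * (cmod (g x) / b))) powr p"
        using p norm_triangle_ineq[of "f x" "g x"] by (intro powr_mono2) auto
      also have "\<dots> = (a + b) powr p * (\<theta> * (cmod (f x) / a) + (1 - \<theta>) * (cmod (g x) / b)) powr p"
        by (rule powr_mult)
      also have "\<dots> \<le> (a + b) powr p *
          (\<theta> * (cmod (f x) / a) powr p + (1 - \<theta>) * (cmod (g x) / b) powr p)"
        using pos \<theta> p by (intro mult_left_mono powr_convex_combination) auto
      also have "\<dots> = G x"
        using pos by (simp add: G_def powr_divide)
      finally show ?thesis .
    qed
    have iG: "integrable M G"
      unfolding G_def using int by auto
    have i: "integrable M (\<lambda>x. cmod (f x + g x) powr p)"
      by (rule Bochner_Integration.integrable_bound[OF iG])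
         (use le in \<open>auto intro: order_trans[OF _ abs_ge_self]\<close>)
    have ratio: "(\<integral>x. cmod (h x) powr p \<partial>M) / c powr p \<le> 1" if "Lp_norm p M h < c" for h c
    proof -
      have "Lp_norm p M h powr p \<le> c powr p"
        using that p by (intro powr_mono2) auto
      then show ?thesis
        using that p Lp_norm_powr[of p M h] Lp_norm_nonneg[of p M h] by (simp add: divide_simps)
    qed
    have "(\<integral>x. cmod (f x + g x) powr p \<partial>M) \<le> (\<integral>x. G x \<partial>M)"
      by (rule integral_mono[OF i iG le])
    also have "\<dots> = (a + b) powr p * (\<theta> * ((\<integral>x. cmod (f x) powr p \<partial>M) / a powr p)
                   + (1 - \<theta>) * ((\<integral>x. cmod (g x) powr p \<partial>M) / b powr p))"
      unfolding G_def using int by simp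
    also have "\<dots> \<le> (a + b) powr p * (\<theta> * 1 + (1 - \<theta>) * 1)"
      using \<theta> ratio[OF a] ratio[OF b] by (intro mult_left_mono add_mono) auto
    finally show ?thesis
      using i pos p by (auto intro!: Lp_norm_leI)
  qed
  show "(\<lambda>x. f x + g x) \<in> Lp p M"
    using *[of "Lp_norm p M f + 1" "Lp_norm p M g + 1"] by (simp add: Lp_def)
  show "Lp_norm p M (\<lambda>x. f x + g x) \<le> Lp_norm p M f + Lp_norm p M g"
  proof (rule field_le_epsilon)
    fix e :: real assume "e > 0"
    then show "Lp_norm p M (\<lambda>x. f x + g x) \<le> Lp_norm p M f + Lp_norm p M g + e"
      using *[of "Lp_norm p M f + e/2" "Lp_norm p M g + e/2"] by simp
  qed
qed

lemma Lp_diff: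
  assumes p: "1 \<le> p" and f: "f \<in> Lp p M" and g: "g \<in> Lp p M"
  shows "(\<lambda>x. f x - g x) \<in> Lp p M"
    and "Lp_norm p M (\<lambda>x. f x - g x) \<le> Lp_norm p M f + Lp_norm p M g"
proof -
  have "p > 0" using p by simp
  note m = Lp_cmult[OF this g, of "-1"]
  show "(\<lambda>x. f x - g x) \<in> Lp p M"
    using Lp_minkowski(1)[OF p f m(1)] by simp
  show "Lp_norm p M (\<lambda>x. f x - g x) \<le> Lp_norm p M f + Lp_norm p M g"
    using Lp_minkowski(2)[OF p f m(1)] m(2) by simp
qed

lemma Lp_zero: "p > 0 \<Longrightarrow> (\<lambda>x. 0) \<in> Lp p M \<and> Lp_norm p M (\<lambda>x. 0) = 0"
  by (simp add: Lp_def Lp_norm_def)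

lemma Lp_sum:
  assumes p: "1 \<le> p" and "finite I" "\<And>i. i \<in> I \<Longrightarrow> f i \<in> Lp p M"
  shows "(\<lambda>x. \<Sum>i\<in>I. f i x) \<in> Lp p M \<and>
         Lp_norm p M (\<lambda>x. \<Sum>i\<in>I. f i x) \<le> (\<Sum>i\<in>I. Lp_norm p M (f i))"
  using assms(2,3)
proof (induction I rule: finite_induct)
  case empty
  then show ?case using p Lp_zero[of p M] by simp
next
  case (insert i I)
  then have IH: "(\<lambda>x. \<Sum>i\<in>I. f i x) \<in> Lp p M"
    "Lp_norm p M (\<lambda>x. \<Sum>i\<in>I. f i x) \<le> (\<Sum>i\<in>I. Lp_norm p M (f i))" by auto
  show ?case
    using Lp_minkowski[OF p insert.prems[of i] IH(1)] IH(2) insert.hyps by auto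
qed

text \<open>Monotone convergence turns a bound on the norms of the partial sums into almost everywhere
  absolute convergence.\<close>

lemma Lp_series:
  fixes u :: "nat \<Rightarrow> 'a \<Rightarrow> complex"
  assumes p: "1 \<le> p" and u: "\<And>k. u k \<in> Lp p M"
    and D: "\<And>n. (\<Sum>k<n. Lp_norm p M (u k)) \<le> D"
  shows "AE x in M. summable (\<lambda>k. cmod (u k x))" and "(\<lambda>x. \<Sum>k. u k x) \<in> Lp p M"
proof -
  have [measurable]: "u k \<in> borel_measurable M" for k
    using u[of k] by (simp add: Lp_def)
  define h where "h n x = (\<Sum>k<n. cmod (u k x))" for n x
  have [measurable]: "h n \<in> borel_measurable M" for n
    unfolding h_def by measurable
  have h0: "0 \<le> h n x" for n x
    unfolding h_def by (intro sum_nonneg) auto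
  have hmono: "h n x \<le> h m x" if "n \<le> m" for n m x
    unfolding h_def using that by (intro sum_mono2) auto
  have D0: "0 \<le> D" using D[of 0] by simp
  have hint: "integrable M (\<lambda>x. h n x powr p) \<and> (\<integral>x. h n x powr p \<partial>M) \<le> D powr p" for n
  proof -
    have ab: "(\<lambda>x. complex_of_real (cmod (u k x))) \<in> Lp p M \<and>
        Lp_norm p M (\<lambda>x. complex_of_real (cmod (u k x))) = Lp_norm p M (u k)" for k
      using u[of k] by (simp add: Lp_def Lp_norm_def)
    have "(\<lambda>x. complex_of_real (h n x)) \<in> Lp p M \<and> Lp_norm p M (\<lambda>x. complex_of_real (h n x)) \<le> D"
      using Lp_sum[OF p, of "{..<n}" "\<lambda>k x. complex_of_real (cmod (u k x))" M] ab D[of n]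
      by (auto simp: h_def)
    moreover have "cmod (complex_of_real (h n x)) = h n x" for x
      using h0 by simp
    ultimately have 1: "integrable M (\<lambda>x. h n x powr p)"
      and 2: "Lp_norm p M (\<lambda>x. complex_of_real (h n x)) \<le> D"
      by (auto simp: Lp_def)
    have "(\<integral>x. h n x powr p \<partial>M) = Lp_norm p M (\<lambda>x. complex_of_real (h n x)) powr p"
      using p h0 by (simp add: Lp_norm_powr)
    also have "\<dots> \<le> D powr p"
      using 2 p by (intro powr_mono2) auto
    finally show ?thesis using 1 by simp
  qed
  define H where "H x = (SUP n. ennreal (h n x powr p))" for x
  have [measurable]: "H \<in> borel_measurable M"
    unfolding H_def by measurable
  have "(\<integral>\<^sup>+x. H x \<partial>M) = (SUP n. \<integral>\<^sup>+x. ennreal (h n x powr p) \<partial>M)"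
    unfolding H_def
    by (rule nn_integral_monotone_convergence_SUP)
       (use p h0 hmono in \<open>auto simp: incseq_def le_fun_def intro!: ennreal_leI powr_mono2\<close>)
  also have "\<dots> \<le> ennreal (D powr p)"
    using hint by (intro SUP_least) (simp add: nn_integral_eq_integral ennreal_leI)
  finally have Hfin: "(\<integral>\<^sup>+x. H x \<partial>M) < \<infinity>"
    by (simp add: le_less_trans)
  have conv: "summable (\<lambda>k. cmod (u k x)) \<and> ennreal (cmod (\<Sum>k. u k x) powr p) \<le> H x"
    if "H x < \<infinity>" for x
  proof -
    have "H x \<noteq> top" using that by auto
    then obtain B where B: "0 \<le> B" "H x = ennreal B"
      by (cases "H x" rule: ennreal_cases) auto
    have hB: "h n x \<le> B powr (1/p)" for n
    proof -
      have "ennreal (h n x powr p) \<le> ennreal B"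
        unfolding B(2)[symmetric] H_def by (rule SUP_upper) simp
      then have "h n x powr p \<le> B" using B by simp
      then have "(h n x powr p) powr (1/p) \<le> B powr (1/p)"
        using p by (intro powr_mono2) auto
      then show ?thesis using p h0 by (simp add: powr_powr)
    qed
    have s: "summable (\<lambda>k. cmod (u k x))"
      using hB by (intro summableI_nonneg_bounded[where x="B powr (1/p)"]) (auto simp: h_def)
    have "cmod (\<Sum>k. u k x) \<le> (\<Sum>k. cmod (u k x))"
      by (rule summable_norm[OF s])
    also have "\<dots> \<le> B powr (1/p)"
      using hB s by (intro suminf_le_const) (auto simp: h_def)
    finally have "cmod (\<Sum>k. u k x) powr p \<le> (B powr (1/p)) powr p"
      using p by (intro powr_mono2) auto
    then have "cmod (\<Sum>k. u k x) powr p \<le> B"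
      using p B by (simp add: powr_powr)
    then show ?thesis using s B by (simp add: ennreal_leI)
  qed
  have fin: "AE x in M. H x < \<infinity>"
    using Hfin nn_integral_PInf_AE[of H M] by (auto simp: less_top)
  then show "AE x in M. summable (\<lambda>k. cmod (u k x))"
    by eventually_elim (use conv in auto)
  have [measurable]: "(\<lambda>x. \<Sum>k. u k x) \<in> borel_measurable M"
    by measurable
  have "AE x in M. ennreal (cmod (\<Sum>k. u k x) powr p) \<le> H x"
    using fin by eventually_elim (use conv in auto)
  then have "(\<integral>\<^sup>+x. ennreal (cmod (\<Sum>k. u k x) powr p) \<partial>M) \<le> (\<integral>\<^sup>+x. H x \<partial>M)"
    by (rule nn_integral_mono_AE)
  then have "integrable M (\<lambda>x. cmod (\<Sum>k. u k x) powr p)"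
    using Hfin by (intro integrableI_bounded) auto
  then show "(\<lambda>x. \<Sum>k. u k x) \<in> Lp p M"
    by (simp add: Lp_def)
qed

section \<open>Riesz representation on compact Hausdorff spaces\<close>

lemma bcontfun_of_continuous:
  fixes f :: "'a::topological_space \<Rightarrow> real"
  assumes "compact (UNIV :: 'a set)" and "continuous_on UNIV f"
  obtains \<phi> where "apply_bcontfun \<phi> = f"
proof -
  have "f \<in> bcontfun"
    using compact_imp_bounded[OF compact_continuous_image[OF assms(2,1)]] assms(2)
    by (simp add: bcontfun_def)
  then show ?thesis using that by (metis bcontfunE)
qed

text \<open>The only source of continuous functions on the abstract space: a compact Hausdorff space is
  normal.\<close>

lemma Urysohn_compact:
  fixes K U :: "'a::t2_space set"
  assumes "compact (UNIV :: 'a set)" and "closed K" "open U" "K \<subseteq> U"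
  obtains \<phi> :: "'a \<Rightarrow>\<^sub>C real" where "\<And>x. 0 \<le> \<phi> x" "\<And>x. \<phi> x \<le> 1"
    "\<And>x. x \<in> K \<Longrightarrow> \<phi> x = 1" "\<And>x. x \<notin> U \<Longrightarrow> \<phi> x = 0"
proof -
  have "Hausdorff_space (euclidean :: 'a topology)"
    unfolding Hausdorff_space_def using hausdorff by (fastforce simp: disjnt_def)
  moreover have "compact_space (euclidean :: 'a topology)"
    using assms(1) by (simp add: compact_space_def)
  ultimately have "normal_space (euclidean :: 'a topology)"
    by (intro compact_Hausdorff_or_regular_imp_normal_space) auto
  then obtain f :: "'a \<Rightarrow> real" where f: "continuous_map euclidean (top_of_set {0..1}) f"
      "f ` (- U) \<subseteq> {0}" "f ` K \<subseteq> {1}"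
    by (rule Urysohn_lemma[of _ "- U" K 0 1]) (use assms in \<open>auto simp: disjnt_def\<close>)
  then have c: "continuous_on UNIV f" and r: "\<And>x. f x \<in> {0..1}"
    by (auto simp: continuous_map_in_subtopology)
  obtain \<phi> where "apply_bcontfun \<phi> = f"
    by (rule bcontfun_of_continuous[OF assms(1) c])
  then show ?thesis
    using f r by (intro that[of \<phi>]) auto
qed

locale positive_functional =
  fixes \<Lambda> :: "('a::t2_space \<Rightarrow>\<^sub>C real) \<Rightarrow>\<^sub>L real"
  assumes compact_UNIV: "compact (UNIV :: 'a set)"
    and nonneg: "\<And>\<phi>. (\<And>x. 0 \<le> apply_bcontfun \<phi> x) \<Longrightarrow> 0 \<le> \<Lambda> \<phi>"
begin

abbreviation one :: "'a \<Rightarrow>\<^sub>C real" where "one \<equiv> const_bcontfun 1"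

text \<open>The usual content takes competitors with compact support inside \<open>U\<close>. Bounding them by the
  indicator of \<open>U\<close> gives the same supremum, since they can be cut off at a small level.\<close>

definition below :: "'a set \<Rightarrow> ('a \<Rightarrow>\<^sub>C real) set" where
  "below U = {\<phi>. \<forall>x. 0 \<le> apply_bcontfun \<phi> x \<and> apply_bcontfun \<phi> x \<le> indicator U x}"

definition content :: "'a set \<Rightarrow> ennreal" where
  "content U = (SUP \<phi> \<in> below U. ennreal (\<Lambda> \<phi>))"

definition outer :: "'a set \<Rightarrow> ennreal" where
  "outer E = (INF U \<in> {U. open U \<and> E \<subseteq> U}. content U)"

lemma mono: "(\<And>x. apply_bcontfun \<phi> x \<le> apply_bcontfun \<psi> x) \<Longrightarrow> \<Lambda> \<phi> \<le> \<Lambda> \<psi>"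
  using nonneg[of "\<psi> - \<phi>"] by (simp add: blinfun.diff_right)

lemma one_nonneg: "0 \<le> \<Lambda> one"
  by (rule nonneg) simp

lemma bcontfun_ex: "continuous_on UNIV f \<Longrightarrow> \<exists>\<phi>. apply_bcontfun \<phi> = (f :: 'a \<Rightarrow> real)"
  using bcontfun_of_continuous[OF compact_UNIV] by metis

lemma below_nonneg: "\<phi> \<in> below U \<Longrightarrow> 0 \<le> \<Lambda> \<phi>"
  by (rule nonneg) (simp add: below_def)

lemma below_bounds:
  assumes "\<phi> \<in> below U"
  shows "0 \<le> apply_bcontfun \<phi> x" "apply_bcontfun \<phi> x \<le> 1"
proof -
  have "0 \<le> apply_bcontfun \<phi> x" "apply_bcontfun \<phi> x \<le> indicator U x"
    using assms by (auto simp: below_def)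
  moreover have "indicator U x \<le> (1 :: real)"
    by (simp add: indicator_def)
  ultimately show "0 \<le> apply_bcontfun \<phi> x" "apply_bcontfun \<phi> x \<le> 1"
    by linarith+
qed

lemma below_le_content: "\<phi> \<in> below U \<Longrightarrow> ennreal (\<Lambda> \<phi>) \<le> content U"
  unfolding content_def by (rule SUP_upper)

lemma content_mono: "U \<subseteq> V \<Longrightarrow> content U \<le> content V"
  unfolding content_def
proof (rule SUP_subset_mono)
  assume "U \<subseteq> V"
  then have "indicator U x \<le> (indicator V x :: real)" for x
    by (auto simp: indicator_def)
  then show "below U \<subseteq> below V"
    unfolding below_def using order_trans by blast
qed simp

lemma content_UNIV: "content UNIV = ennreal (\<Lambda> one)"
proof (rule antisym)
  show "content UNIV \<le> ennreal (\<Lambda> one)"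
    unfolding content_def by (intro SUP_least ennreal_leI mono) (auto simp: below_def)
  show "ennreal (\<Lambda> one) \<le> content UNIV"
    by (rule below_le_content) (simp add: below_def)
qed

lemma content_empty: "content {} = 0"
proof -
  have "\<Lambda> \<phi> = 0" if "\<phi> \<in> below {}" for \<phi>
  proof -
    have "\<phi> = 0" using that by (intro bcontfun_eqI) (auto simp: below_def intro: antisym)
    then show ?thesis by (simp add: blinfun.zero_right)
  qed
  then have "content {} \<le> 0"
    unfolding content_def by (intro SUP_least) simp
  then show ?thesis by simp
qed

text \<open>Cutting off below a small level makes the support compact inside the open set, at a small
  cost in the value of the functional.\<close>

lemma cutoff:
  assumes "\<phi> \<in> below U" "\<delta> > 0"
  obtains \<psi> where "\<And>x. apply_bcontfun \<psi> x = max 0 (apply_bcontfun \<phi> x - \<delta>)" "\<psi> \<in> below U" "\<Lambda> \<phi> \<le> \<Lambda> \<psi> + \<delta> * \<Lambda> one"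
proof -
  obtain \<psi> where \<psi>: "apply_bcontfun \<psi> = (\<lambda>x. max 0 (apply_bcontfun \<phi> x - \<delta>))"
    using bcontfun_ex[of "\<lambda>x. max 0 (apply_bcontfun \<phi> x - \<delta>)"]
      continuous_on_max[OF continuous_on_const continuous_on_diff[OF continuous_on_apply_bcontfun continuous_on_const]]
    by blast
  have "\<Lambda> \<phi> \<le> \<Lambda> (\<psi> + \<delta> *\<^sub>R one)"
    by (rule mono) (auto simp: \<psi>)
  then have "\<Lambda> \<phi> \<le> \<Lambda> \<psi> + \<delta> * \<Lambda> one"
    by (simp add: blinfun.add_right blinfun.scaleR_right)
  moreover have "max 0 (\<phi> x - \<delta>) \<le> indicator U x" for x
  proof -
    have "0 \<le> \<phi> x" "\<phi> x \<le> indicator U x"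
      using assms(1) by (auto simp: below_def)
    then show ?thesis using assms(2) by linarith
  qed
  ultimately show ?thesis
    using that[of \<psi>] by (auto simp: \<psi> below_def)
qed

lemma le_content_epsilon:
  assumes "\<And>\<delta>. \<delta> > 0 \<Longrightarrow> ennreal a \<le> c + ennreal (\<delta> * \<Lambda> one)"
  shows "ennreal a \<le> c"
proof (rule ennreal_le_epsilon)
  fix e :: real assume e: "0 < e"
  define \<delta> where "\<delta> = e / (\<Lambda> one + 1)"
  have \<delta>: "\<delta> > 0" "\<delta> * \<Lambda> one \<le> e"
    using e one_nonneg by (auto simp: \<delta>_def field_simps)
  show "ennreal a \<le> c + ennreal e"
    by (rule order_trans[OF assms[OF \<delta>(1)] add_left_mono[OF ennreal_leI[OF \<delta>(2)]]])
qed

lemma closed_superlevel: "closed {x. (\<delta> :: real) \<le> apply_bcontfun \<phi> x}"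
  by (intro closed_Collect_le continuous_intros) auto

lemma open_superlevel: "open {x. (\<delta> :: real) < apply_bcontfun \<phi> x}"
  by (intro open_Collect_less continuous_intros) auto

lemma compact_closed: "closed (K :: 'a set) \<Longrightarrow> compact K"
  using compact_Int_closed[OF compact_UNIV, of K] by simp

text \<open>After the cutoff, the part of the superlevel set outside \<open>V\<close> is compact and contained in \<open>U\<close>. A
  Urysohn function \<open>h\<close> for it splits \<open>\<psi>\<close> into \<open>\<psi> h\<close>, which lives on \<open>U\<close>, and \<open>\<psi> (1 - h)\<close>, which
  lives on \<open>V\<close>.\<close>

lemma content_Un:
  assumes "open U" "open V"
  shows "content (U \<union> V) \<le> content U + content V"
  unfolding content_def[of "U \<union> V"]
proof (rule SUP_least, rule le_content_epsilon)
  fix \<phi> and \<delta> :: real assume \<phi>: "\<phi> \<in> below (U \<union> V)" and \<delta>: "\<delta> > 0"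
  obtain \<psi> where \<psi>: "\<And>x. apply_bcontfun \<psi> x = max 0 (apply_bcontfun \<phi> x - \<delta>)" "\<psi> \<in> below (U \<union> V)" "\<Lambda> \<phi> \<le> \<Lambda> \<psi> + \<delta> * \<Lambda> one"
    by (rule cutoff[OF \<phi> \<delta>]) (rule that)
  define K where "K = {x. \<delta> \<le> \<phi> x} - V"
  have K: "closed K" "K \<subseteq> U"
  proof -
    show "closed K" unfolding K_def by (intro closed_Diff closed_superlevel assms)
    show "K \<subseteq> U"
    proof
      fix x assume "x \<in> K"
      then have "\<delta> \<le> \<phi> x" "x \<notin> V" by (auto simp: K_def)
      moreover have "\<phi> x \<le> indicator (U \<union> V) x" using \<phi> by (simp add: below_def)
      ultimately show "x \<in> U" using \<delta> by (auto simp: indicator_def of_bool_def split: if_splits)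
    qed
  qed
  obtain h :: "'a \<Rightarrow>\<^sub>C real" where h: "\<And>x. 0 \<le> h x" "\<And>x. h x \<le> 1" "\<And>x. x \<in> K \<Longrightarrow> h x = 1" "\<And>x. x \<notin> U \<Longrightarrow> h x = 0"
    using Urysohn_compact[OF compact_UNIV K(1) assms(1) K(2)] by blast
  obtain \<psi>1 where \<psi>1: "apply_bcontfun \<psi>1 = (\<lambda>x. \<psi> x * h x)"
    using bcontfun_ex[of "\<lambda>x. \<psi> x * h x"] by (auto intro: continuous_intros)
  have ps: "0 \<le> \<psi> x" "\<psi> x \<le> 1" for x
    using below_bounds[OF \<psi>(2)] by auto
  have "\<psi>1 \<in> below U"
    using h ps by (auto simp: below_def \<psi>1 indicator_def intro: mult_le_one)
  moreover have "\<psi> - \<psi>1 \<in> below V"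
  proof -
    have "0 \<le> (\<psi> - \<psi>1) x \<and> (\<psi> - \<psi>1) x \<le> indicator V x" for x
    proof (cases "x \<in> V")
      case True
      moreover have "\<psi> x * h x \<le> \<psi> x" "0 \<le> \<psi> x * h x"
        using h(1,2)[of x] ps(1)[of x] by (auto simp: mult_left_le)
      ultimately show ?thesis
        using ps(2)[of x] by (simp add: \<psi>1)
    next
      case False
      then have eq: "\<psi> x * h x = \<psi> x"
        using h(3)[of x] \<psi>(1)[of x] by (auto simp: K_def max_def)
      show ?thesis
        unfolding minus_bcontfun.rep_eq \<psi>1 eq by simp
    qed
    then show ?thesis
      by (simp add: below_def)
  qed
  ultimately have le: "ennreal (\<Lambda> \<psi>1) + ennreal (\<Lambda> (\<psi> - \<psi>1)) \<le> content U + content V"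
    and nn: "0 \<le> \<Lambda> \<psi>1" "0 \<le> \<Lambda> (\<psi> - \<psi>1)"
    by (auto intro: add_mono below_le_content below_nonneg)
  have "ennreal (\<Lambda> \<phi>) \<le> ennreal (\<Lambda> \<psi>1 + \<Lambda> (\<psi> - \<psi>1) + \<delta> * \<Lambda> one)"
    using \<psi>(3) by (intro ennreal_leI) (simp add: blinfun.diff_right)
  also have "\<dots> = (ennreal (\<Lambda> \<psi>1) + ennreal (\<Lambda> (\<psi> - \<psi>1))) + ennreal (\<delta> * \<Lambda> one)"
    using nn \<delta> one_nonneg by (simp add: ennreal_plus)
  also have "\<dots> \<le> (content U + content V) + ennreal (\<delta> * \<Lambda> one)"
    by (rule add_right_mono[OF le])
  finally show "ennreal (\<Lambda> \<phi>) \<le> content U + content V + ennreal (\<delta> * \<Lambda> one)" .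
qed

lemma content_finite_UN:
  fixes U :: "nat \<Rightarrow> 'a set"
  assumes "\<And>i. open (U i)"
  shows "content (\<Union>i<n. U i) \<le> (\<Sum>i<n. content (U i))"
proof (induction n)
  case (Suc n)
  have "(\<Union>i<Suc n. U i) = (\<Union>i<n. U i) \<union> U n"
    by (auto simp: less_Suc_eq)
  then have "content (\<Union>i<Suc n. U i) \<le> content (\<Union>i<n. U i) + content (U n)"
    using assms by (simp only:) (intro content_Un open_UN, auto)
  also have "\<dots> \<le> (\<Sum>i<n. content (U i)) + content (U n)"
    by (rule add_right_mono[OF Suc])
  finally show ?case by simp
qed (simp add: content_empty)

text \<open>The superlevel set of the competitor is compact, so finitely many of the \<open>U\<^sub>i\<close> carry it.\<close>

lemma content_UN:
  fixes U :: "nat \<Rightarrow> 'a set"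
  assumes "\<And>i. open (U i)"
  shows "content (\<Union>i. U i) \<le> (\<Sum>i. content (U i))"
  unfolding content_def[of "\<Union>i. U i"]
proof (rule SUP_least, rule le_content_epsilon)
  fix \<phi> and \<delta> :: real assume \<phi>: "\<phi> \<in> below (\<Union>i. U i)" and \<delta>: "\<delta> > 0"
  obtain \<psi> where \<psi>: "\<And>x. apply_bcontfun \<psi> x = max 0 (apply_bcontfun \<phi> x - \<delta>)" "\<psi> \<in> below (\<Union>i. U i)" "\<Lambda> \<phi> \<le> \<Lambda> \<psi> + \<delta> * \<Lambda> one"
    by (rule cutoff[OF \<phi> \<delta>]) (rule that)
  define K where "K = {x. \<delta> \<le> \<phi> x}"
  have "compact K"
    unfolding K_def by (intro compact_closed closed_superlevel)
  moreover have "K \<subseteq> (\<Union>i. U i)"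
  proof
    fix x assume "x \<in> K"
    then have "\<delta> \<le> \<phi> x" by (auto simp: K_def)
    moreover have "\<phi> x \<le> indicator (\<Union>i. U i) x" using \<phi> by (simp add: below_def)
    ultimately show "x \<in> (\<Union>i. U i)" using \<delta> by (auto simp: indicator_def of_bool_def split: if_splits)
  qed
  ultimately have K: "compact K" "K \<subseteq> (\<Union>i\<in>UNIV. U i)"
    by auto
  obtain I where I: "I \<subseteq> UNIV" "finite I" "K \<subseteq> (\<Union>i\<in>I. U i)"
    by (rule compactE_image[OF K(1) _ K(2)]) (rule assms)
  obtain n where n: "I \<subseteq> {..<n}"
    using finite_nat_iff_bounded[THEN iffD1, OF I(2)] by (rule exE)
  have "\<psi> x = 0" if "x \<notin> (\<Union>i<n. U i)" for x
  proof -
    have "x \<notin> K" using that I n by blast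
    then show ?thesis by (simp add: \<psi> K_def)
  qed
  moreover have "0 \<le> \<psi> x" "\<psi> x \<le> 1" for x
    using below_bounds[OF \<psi>(2)] by auto
  ultimately have "\<psi> \<in> below (\<Union>i<n. U i)"
    by (auto simp: below_def indicator_def)
  then have "ennreal (\<Lambda> \<psi>) \<le> (\<Sum>i<n. content (U i))"
    by (rule order_trans[OF below_le_content content_finite_UN[OF assms]])
  also have "\<dots> \<le> (\<Sum>i. content (U i))"
    by (intro sum_le_suminf) auto
  finally have le: "ennreal (\<Lambda> \<psi>) \<le> (\<Sum>i. content (U i))" .
  have "ennreal (\<Lambda> \<phi>) \<le> ennreal (\<Lambda> \<psi> + \<delta> * \<Lambda> one)"
    by (rule ennreal_leI[OF \<psi>(3)])
  also have "\<dots> = ennreal (\<Lambda> \<psi>) + ennreal (\<delta> * \<Lambda> one)"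
    using below_nonneg[OF \<psi>(2)] \<delta> one_nonneg by (intro ennreal_plus) auto
  also have "\<dots> \<le> (\<Sum>i. content (U i)) + ennreal (\<delta> * \<Lambda> one)"
    by (rule add_right_mono[OF le])
  finally show "ennreal (\<Lambda> \<phi>) \<le> (\<Sum>i. content (U i)) + ennreal (\<delta> * \<Lambda> one)" .
qed

lemma outer_open: "open U \<Longrightarrow> outer U = content U"
  unfolding outer_def by (intro antisym INF_lower INF_greatest content_mono) auto

lemma outer_mono: "E \<subseteq> F \<Longrightarrow> outer E \<le> outer F"
  unfolding outer_def by (rule INF_superset_mono) auto

lemma outer_finite: "outer E < top"
proof -
  have "outer E \<le> outer UNIV" by (rule outer_mono) simp
  also have "\<dots> = ennreal (\<Lambda> one)" by (simp add: outer_open content_UNIV)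
  finally show ?thesis by (rule order_le_less_trans) simp
qed

lemma outer_close:
  assumes "e > 0"
  obtains U where "open U" "E \<subseteq> U" "content U \<le> outer E + ennreal e"
proof -
  have "outer E < outer E + ennreal e"
    using assms outer_finite[of E] by (simp add: less_top)
  then obtain U where "open U" "E \<subseteq> U" "content U < outer E + ennreal e"
    unfolding outer_def[of E] INF_less_iff by blast
  then show ?thesis using that by auto
qed

lemma outer_countably_subadditive: "outer (\<Union>i. E i) \<le> (\<Sum>i. outer (E i))" for E :: "nat \<Rightarrow> 'a set"
proof (rule ennreal_le_epsilon)
  fix e :: real assume e: "0 < e"
  have "\<exists>U. open U \<and> E i \<subseteq> U \<and> content U \<le> outer (E i) + ennreal (e * (1/2) ^ Suc i)" for i
  proof -
    have "0 < e * (1/2) ^ Suc i" using e by simp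
    then obtain U where "open U" "E i \<subseteq> U" "content U \<le> outer (E i) + ennreal (e * (1/2) ^ Suc i)"
      by (rule outer_close)
    then show ?thesis by blast
  qed
  then obtain U where U: "\<And>i. open (U i)" "\<And>i. E i \<subseteq> U i"
      "\<And>i. content (U i) \<le> outer (E i) + ennreal (e * (1/2) ^ Suc i)"
    by metis
  have "outer (\<Union>i. E i) \<le> outer (\<Union>i. U i)"
    using U(2) by (intro outer_mono) blast
  also have "\<dots> \<le> (\<Sum>i. content (U i))"
    using U(1) by (subst outer_open) (auto intro: content_UN)
  also have "\<dots> \<le> (\<Sum>i. outer (E i) + ennreal (e * (1/2) ^ Suc i))"
    by (intro suminf_le U) auto
  also have "\<dots> = (\<Sum>i. outer (E i)) + (\<Sum>i. ennreal (e * (1/2) ^ Suc i))"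
    by (rule suminf_add[symmetric]) auto
  also have "(\<Sum>i. ennreal (e * (1/2) ^ Suc i)) = ennreal e"
    using sums_mult[OF power_half_series, of e] e by (intro suminf_ennreal_eq) auto
  finally show "outer (\<Union>i. E i) \<le> (\<Sum>i. outer (E i)) + ennreal e" .
qed

lemma outer_measure_space_outer: "outer_measure_space (Pow UNIV) outer"
  unfolding outer_measure_space_def positive_def increasing_def countably_subadditive_def
  using outer_mono outer_countably_subadditive by (auto simp: outer_open content_empty)

lemma outer_Un: "outer (E \<union> F) \<le> outer E + outer F"
proof -
  define S where "S i = (if i = 0 then E else if i = Suc 0 then F else {})" for i :: nat
  have "outer (\<Union>i. S i) \<le> (\<Sum>i. outer (S i))"
    by (rule outer_countably_subadditive)
  also have "\<dots> = (\<Sum>i\<in>{0, Suc 0}. outer (S i))"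
    by (intro suminf_finite) (auto simp: S_def outer_open content_empty)
  also have "\<dots> = outer E + outer F" by (simp add: S_def)
  also have "(\<Union>i. S i) = E \<union> F" by (auto simp: S_def split: if_splits)
  finally show ?thesis .
qed

text \<open>Outer measure is determined by open sets, so the Caratheodory condition has to be checked against
  open test sets \<open>V\<close> only.\<close>

lemma open_in_lambda_system:
  assumes U: "open U"
  shows "U \<in> lambda_system UNIV (Pow UNIV) outer"
proof -
  have opens: "outer (V \<inter> U) + outer (V - U) \<le> content V" if V: "open V" for V
  proof -
    \<comment> \<open>A competitor for \<open>V \<inter> U\<close>, cut off at level \<open>\<delta>\<close>, and one for the complement of its
      superlevel set add up to a competitor for \<open>V\<close>.\<close>
    have step: "ennreal (\<Lambda> \<phi>) + outer (V - U) \<le> content V" if \<phi>: "\<phi> \<in> below (V \<inter> U)" for \<phi>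
    proof (rule ennreal_le_epsilon)
      fix e :: real assume e: "0 < e"
      define \<delta> where "\<delta> = e / (\<Lambda> one + 1)"
      have \<delta>: "\<delta> > 0" "\<delta> * \<Lambda> one \<le> e"
        using e one_nonneg by (auto simp: \<delta>_def field_simps)
      obtain \<psi> where \<psi>: "\<And>x. apply_bcontfun \<psi> x = max 0 (apply_bcontfun \<phi> x - \<delta>)" "\<psi> \<in> below (V \<inter> U)" "\<Lambda> \<phi> \<le> \<Lambda> \<psi> + \<delta> * \<Lambda> one"
        by (rule cutoff[OF \<phi> \<delta>(1)]) (rule that)
      define V' where "V' = V - {x. \<delta> \<le> \<phi> x}"
      have "V - U \<subseteq> V'"
      proof -
        have "\<phi> x \<le> indicator (V \<inter> U) x" for x using \<phi> by (simp add: below_def)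
        then have "\<not> \<delta> \<le> \<phi> x" if "x \<notin> U" for x
          using that \<delta>(1) by (smt (verit) Int_iff indicator_simps(2))
        then show ?thesis by (auto simp: V'_def)
      qed
      moreover have V': "open V'"
        unfolding V'_def by (intro open_Diff V closed_superlevel)
      ultimately have "outer (V - U) \<le> content V'"
        using outer_mono outer_open by metis
      moreover have "ennreal (\<Lambda> \<psi>) + content V' \<le> content V"
      proof -
        have "ennreal (\<Lambda> \<psi>) + ennreal (\<Lambda> \<eta>) \<le> content V" if \<eta>: "\<eta> \<in> below V'" for \<eta>
        proof -
          have "0 \<le> (\<psi> + \<eta>) x \<and> (\<psi> + \<eta>) x \<le> indicator V x" for x
          proof (cases "\<delta> \<le> \<phi> x")
            case True
            then have "\<eta> x = 0"
              using \<eta> by (auto simp: below_def V'_def intro!: antisym elim!: allE[of _ x])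
            moreover have "0 \<le> \<psi> x" "\<psi> x \<le> indicator (V \<inter> U) x"
              using \<psi>(2) by (auto simp: below_def)
            ultimately show ?thesis
              by (auto simp: indicator_def of_bool_def split: if_splits)
          next
            case False
            then have "\<psi> x = 0" by (simp add: \<psi>)
            moreover have "0 \<le> \<eta> x" "\<eta> x \<le> indicator V' x"
              using \<eta> by (auto simp: below_def)
            moreover have "\<eta> x \<le> 1"
              by (rule below_bounds[OF \<eta>])
            ultimately show ?thesis
              by (auto simp: indicator_def V'_def split: if_splits)
          qed
          then have "\<psi> + \<eta> \<in> below V" by (simp add: below_def)
          then have "ennreal (\<Lambda> (\<psi> + \<eta>)) \<le> content V" by (rule below_le_content)
          then show ?thesis
            using below_nonneg[OF \<psi>(2)] below_nonneg[OF \<eta>] by (simp add: blinfun.add_right ennreal_plus)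
        qed
        then have "(SUP \<eta>\<in>below V'. ennreal (\<Lambda> \<psi>) + ennreal (\<Lambda> \<eta>)) \<le> content V"
          by (rule SUP_least)
        moreover have "0 \<in> below V'" by (simp add: below_def)
        ultimately show ?thesis
          unfolding content_def[of V'] by (subst ennreal_SUP_add_right) auto
      qed
      moreover have "ennreal (\<Lambda> \<phi>) \<le> ennreal (\<Lambda> \<psi>) + ennreal e"
      proof -
        have "ennreal (\<Lambda> \<phi>) \<le> ennreal (\<Lambda> \<psi> + e)"
          using \<psi>(3) \<delta>(2) by (intro ennreal_leI) simp
        then show ?thesis
          using below_nonneg[OF \<psi>(2)] e by (simp add: ennreal_plus)
      qed
      ultimately have 1: "ennreal (\<Lambda> \<phi>) + outer (V - U) \<le> (ennreal (\<Lambda> \<psi>) + ennreal e) + content V'"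
        and 2: "(ennreal (\<Lambda> \<psi>) + content V') + ennreal e \<le> content V + ennreal e"
        by (blast intro: add_mono add_right_mono)+
      have "(ennreal (\<Lambda> \<psi>) + ennreal e) + content V' = (ennreal (\<Lambda> \<psi>) + content V') + ennreal e"
        by (simp add: add_ac)
      with 1 2 show "ennreal (\<Lambda> \<phi>) + outer (V - U) \<le> content V + ennreal e"
        by (metis order_trans)
    qed
    have ne: "0 \<in> below (V \<inter> U)" by (simp add: below_def)
    have "outer (V \<inter> U) = (SUP \<phi>\<in>below (V \<inter> U). ennreal (\<Lambda> \<phi>))"
      using U V by (subst outer_open) (auto simp: content_def)
    then have "outer (V \<inter> U) + outer (V - U) = (SUP \<phi>\<in>below (V \<inter> U). outer (V - U) + ennreal (\<Lambda> \<phi>))"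
      using ne ennreal_SUP_add_right[of "below (V \<inter> U)" "outer (V - U)" "\<lambda>\<phi>. ennreal (\<Lambda> \<phi>)"]
      by (auto simp: add.commute)
    also have "\<dots> \<le> content V"
      using step by (intro SUP_least) (simp add: add.commute)
    finally show ?thesis .
  qed
  have "outer (U \<inter> E) + outer ((UNIV - U) \<inter> E) = outer E" for E
  proof (rule antisym)
    show "outer (U \<inter> E) + outer ((UNIV - U) \<inter> E) \<le> outer E"
      unfolding outer_def[of E]
    proof (rule INF_greatest)
      fix V assume "V \<in> {V. open V \<and> E \<subseteq> V}"
      then have V: "open V" "E \<subseteq> V" by auto
      have "outer (U \<inter> E) + outer ((UNIV - U) \<inter> E) \<le> outer (V \<inter> U) + outer (V - U)"
        using V by (intro add_mono outer_mono) auto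
      also have "\<dots> \<le> content V" by (rule opens[OF V(1)])
      finally show "outer (U \<inter> E) + outer ((UNIV - U) \<inter> E) \<le> content V" .
    qed
    have "outer E = outer ((U \<inter> E) \<union> ((UNIV - U) \<inter> E))"
      by (rule arg_cong[of _ _ outer]) auto
    then show "outer E \<le> outer (U \<inter> E) + outer ((UNIV - U) \<inter> E)"
      using outer_Un by metis
  qed
  then show ?thesis
    by (auto simp: lambda_system_def)
qed

definition representing_measure :: "'a measure" where
  "representing_measure = measure_of UNIV (sets borel) outer"

lemma sets_representing_measure [simp]: "sets representing_measure = sets borel"
  unfolding representing_measure_def
  using sets.sigma_sets_eq[of borel] by (simp add: sets_measure_of_conv)

lemma space_representing_measure [simp]: "space representing_measure = UNIV"
  by (simp add: representing_measure_def space_measure_of_conv)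

lemma emeasure_representing_measure:
  assumes B: "B \<in> sets borel"
  shows "emeasure representing_measure B = outer B"
proof -
  interpret P: sigma_algebra "UNIV :: 'a set" "Pow UNIV"
    by (rule sigma_algebra_Pow)
  have ms: "measure_space UNIV (lambda_system UNIV (Pow UNIV) outer) outer"
    by (rule P.caratheodory_lemma[OF outer_measure_space_outer])
  then have sa: "sigma_algebra UNIV (lambda_system UNIV (Pow UNIV) outer)"
    by (simp add: measure_space_def)
  have "sets (borel :: 'a measure) \<subseteq> lambda_system UNIV (Pow UNIV) outer"
  proof -
    have "sigma_sets UNIV {S :: 'a set. open S} \<subseteq> lambda_system UNIV (Pow UNIV) outer"
      using open_in_lambda_system by (intro sigma_algebra.sigma_sets_subset[OF sa]) blast
    then show ?thesis by (simp add: borel_def)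
  qed
  then have "measure_space UNIV (sets (borel :: 'a measure)) outer"
    using measure_down[OF ms] sets.sigma_algebra_axioms[of "borel :: 'a measure"] by simp
  then have "positive (sets (borel :: 'a measure)) outer" "countably_additive (sets (borel :: 'a measure)) outer"
    by (auto simp: measure_space_def)
  then show ?thesis
    unfolding representing_measure_def
    using B sets.sigma_algebra_axioms[of "borel :: 'a measure"]
    by (intro emeasure_measure_of_sigma) auto
qed

lemma finite_representing_measure: "finite_measure representing_measure"
  using outer_finite[of UNIV] by (intro finite_measureI) (simp add: emeasure_representing_measure less_top)

lemma measure_UNIV: "measure representing_measure UNIV = \<Lambda> one"
  using one_nonneg
  by (simp add: measure_def emeasure_representing_measure outer_open content_UNIV)

text \<open>Outer regularity is the definition of the outer measure. Since the measure is finite and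
  complements of open sets are compact, inner regularity follows by taking complements.\<close>

lemma regular_representing_measure: "regular_borel_measure representing_measure"
proof -
  interpret finite_measure representing_measure by (rule finite_representing_measure)
  have outer_reg: "emeasure representing_measure B
      = (INF U\<in>{U. open U \<and> B \<subseteq> U}. emeasure representing_measure U)" if "B \<in> sets borel" for B
    unfolding emeasure_representing_measure[OF that] outer_def
    by (intro INF_cong) (auto simp: emeasure_representing_measure outer_open)
  have inner_reg: "emeasure representing_measure B
      = (SUP K\<in>{K. compact K \<and> K \<subseteq> B}. emeasure representing_measure K)" if B: "B \<in> sets borel" for B
  proof (rule antisym)
    show "emeasure representing_measure B \<le> (SUP K\<in>{K. compact K \<and> K \<subseteq> B}. emeasure representing_measure K)"
    proof (rule ennreal_le_epsilon)
      fix e :: real assume e: "e > 0"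
      obtain U where U: "open U" "- B \<subseteq> U" "content U \<le> outer (- B) + ennreal e"
        by (rule outer_close[OF e])
      have Ub: "U \<in> sets borel" "- B \<in> sets borel" "- U \<in> sets borel"
        using U B by auto
      have m: "measure representing_measure U \<le> measure representing_measure (- B) + e"
      proof -
        have "ennreal (measure representing_measure U) \<le> ennreal (measure representing_measure (- B)) + ennreal e"
          using U Ub by (simp add: emeasure_eq_measure[symmetric] emeasure_representing_measure outer_open)
        then show ?thesis
          using e by (simp add: ennreal_plus[symmetric] del: ennreal_plus)
      qed
      have "measure representing_measure B \<le> measure representing_measure (- U) + e"
        using m finite_measure_compl[of B] finite_measure_compl[of U] Ub B
        by (simp add: Compl_eq_Diff_UNIV)
      then have "emeasure representing_measure B \<le> emeasure representing_measure (- U) + ennreal e"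
        using e by (simp add: emeasure_eq_measure ennreal_plus[symmetric] del: ennreal_plus)
      also have "emeasure representing_measure (- U) \<le> (SUP K\<in>{K. compact K \<and> K \<subseteq> B}. emeasure representing_measure K)"
        using U by (intro SUP_upper) (auto intro!: compact_closed)
      finally show "emeasure representing_measure B
          \<le> (SUP K\<in>{K. compact K \<and> K \<subseteq> B}. emeasure representing_measure K) + ennreal e"
        by (simp add: add_right_mono)
    qed
    show "(SUP K\<in>{K. compact K \<and> K \<subseteq> B}. emeasure representing_measure K) \<le> emeasure representing_measure B"
      using B by (intro SUP_least emeasure_mono) auto
  qed
  show ?thesis
    unfolding regular_borel_measure_def
    by (intro conjI ballI sets_representing_measure outer_reg inner_reg)
qed

lemma integrable_representing_measure:
  "integrable representing_measure (apply_bcontfun \<phi> :: 'a \<Rightarrow> real)"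
proof -
  interpret finite_measure representing_measure by (rule finite_representing_measure)
  have "apply_bcontfun \<phi> \<in> borel_measurable borel"
    by (rule borel_measurable_continuous_onI) simp
  then have "apply_bcontfun \<phi> \<in> borel_measurable representing_measure"
    by (simp cong: measurable_cong_sets)
  then show ?thesis
    using norm_bounded[of \<phi>] by (intro integrable_const_bound[where B="norm \<phi>"]) auto
qed

text \<open>Slicing a function with values in the unit interval into \<open>n\<close> horizontal layers bounds the
  functional by a Riemann sum of the measures of its superlevel sets.\<close>

lemma functional_le_integral_unit:
  assumes \<phi>: "\<And>x. 0 \<le> apply_bcontfun \<phi> x" "\<And>x. apply_bcontfun \<phi> x \<le> 1"
  shows "\<Lambda> \<phi> \<le> (\<integral>x. \<phi> x \<partial>representing_measure)"
proof -
  interpret finite_measure representing_measure by (rule finite_representing_measure)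
  let ?m = "representing_measure"
  have bound: "\<Lambda> \<phi> \<le> (\<integral>x. \<phi> x \<partial>?m) + \<Lambda> one / real n" if n: "n > 0" for n :: nat
  proof -
    have "\<exists>T. \<forall>t. apply_bcontfun (T t) = (\<lambda>x. min (\<phi> x) t)"
      by (rule choice) (auto intro!: bcontfun_ex continuous_intros)
    then obtain T where "\<forall>t. apply_bcontfun (T t) = (\<lambda>x. min (\<phi> x) t)"
      by blast
    then have T: "\<And>t x. apply_bcontfun (T t) x = min (\<phi> x) t"
      by simp
    define U where "U k = {x. real k / real n < \<phi> x}" for k
    have U: "open (U k)" for k
      unfolding U_def by (rule open_superlevel)
    have layer: "\<Lambda> (T (real (Suc k) / real n) - T (real k / real n)) \<le> measure ?m (U k) / real n" for k
    proof -
      have "real n *\<^sub>R (T (real (Suc k) / real n) - T (real k / real n)) \<in> below (U k)"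
      proof -
        define d where "d = 1 / real n"
        have "real (Suc k) / real n = real k / real n + d"
          by (simp add: d_def add_divide_distrib)
        moreover have "0 < d" using n by (simp add: d_def)
        ultimately have D: "0 \<le> T (real (Suc k) / real n) x - T (real k / real n) x"
          "T (real (Suc k) / real n) x - T (real k / real n) x \<le> (if x \<in> U k then d else 0)" for x
          by (auto simp: T U_def min_def)
        have "real n * (T (real (Suc k) / real n) x - T (real k / real n) x) \<le> indicator (U k) x" for x
        proof -
          have "real n * (T (real (Suc k) / real n) x - T (real k / real n) x) \<le> real n * (if x \<in> U k then d else 0)"
            by (rule mult_left_mono[OF D(2)]) simp
          also have "\<dots> = indicator (U k) x"
            using n by (simp add: d_def)
          finally show ?thesis .
        qed
        moreover have "0 \<le> real n * (T (real (Suc k) / real n) x - T (real k / real n) x)" for x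
          by (rule mult_nonneg_nonneg[OF _ D(1)]) simp
        ultimately show ?thesis
          unfolding below_def scaleR_bcontfun.rep_eq minus_bcontfun.rep_eq by (simp del: of_nat_Suc)
      qed
      from below_le_content[OF this]
      have "ennreal (real n * \<Lambda> (T (real (Suc k) / real n) - T (real k / real n))) \<le> ennreal (measure ?m (U k))"
        using U[of k]
        by (simp add: blinfun.scaleR_right emeasure_eq_measure[symmetric] emeasure_representing_measure
            outer_open del: of_nat_Suc)
      then show ?thesis
        using n by (simp add: field_simps)
    qed
    have "T (real n / real n) = \<phi>" "T (real 0 / real n) = 0"
      using \<phi> n by (auto intro!: bcontfun_eqI simp: T)
    then have "\<Lambda> \<phi> = \<Lambda> (\<Sum>k<n. T (real (Suc k) / real n) - T (real k / real n))"
      by (subst sum_lessThan_telescope) simp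
    also have "\<dots> = (\<Sum>k<n. \<Lambda> (T (real (Suc k) / real n) - T (real k / real n)))"
      by (rule blinfun.sum_right)
    also have "\<dots> \<le> (\<Sum>k<n. measure ?m (U k) / real n)"
      by (intro sum_mono layer)
    also have "\<dots> = (\<integral>x. (\<Sum>k<n. indicator (U k) x / real n) \<partial>?m)"
      using U by (subst Bochner_Integration.integral_sum) (auto intro!: integrable_divide integrable_real_indicator simp: emeasure_eq_measure)
    also have "\<dots> \<le> (\<integral>x. \<phi> x + 1 / real n \<partial>?m)"
    proof (rule integral_mono)
      show "integrable ?m (\<lambda>x. \<Sum>k<n. indicator (U k) x / real n)"
        using U by (auto intro!: integrable_divide integrable_real_indicator simp: emeasure_eq_measure)
      show "integrable ?m (\<lambda>x. \<phi> x + 1 / real n)"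
        using integrable_representing_measure by auto
      fix x
      \<comment> \<open>If \<open>\<phi> x\<close> exceeds the level \<open>k / n\<close>, it traverses the whole layer below that level; the
        layer below 0 accounts for the error \<open>1 / n\<close>.\<close>
      define a where "a k = min (\<phi> x) ((real k - 1) / real n)" for k :: nat
      have "indicator (U k) x / real n \<le> a (Suc k) - a k" for k
      proof -
        have "(real k - 1) / real n = real k / real n - 1 / real n" "0 < 1 / real n"
          using n by (auto simp: diff_divide_distrib)
        then show ?thesis by (auto simp: a_def U_def indicator_def)
      qed
      then have "(\<Sum>k<n. indicator (U k) x / real n) \<le> (\<Sum>k<n. a (Suc k) - a k)"
        by (intro sum_mono)
      also have "\<dots> = a n - a 0"
        by (rule sum_lessThan_telescope)
      also have "\<dots> \<le> \<phi> x + 1 / real n"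
      proof -
        have "- (1 / real n) \<le> 0" by simp
        then have "- (1 / real n) \<le> \<phi> x"
          using \<phi>(1)[of x] by linarith
        then have "- (1 / real n) \<le> a 0"
          unfolding a_def by simp
        moreover have "a n \<le> \<phi> x" by (simp add: a_def)
        ultimately show ?thesis by linarith
      qed
      finally show "(\<Sum>k<n. indicator (U k) x / real n) \<le> \<phi> x + 1 / real n" .
    qed
    also have "\<dots> = (\<integral>x. \<phi> x \<partial>?m) + \<Lambda> one / real n"
      using integrable_representing_measure by (simp add: measure_UNIV)
    finally show ?thesis .
  qed
  have "(\<lambda>n. (\<integral>x. \<phi> x \<partial>?m) + \<Lambda> one * inverse (real n)) \<longlonglongrightarrow> (\<integral>x. \<phi> x \<partial>?m) + \<Lambda> one * 0"
    by (intro tendsto_intros lim_inverse_n)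
  then show ?thesis
    using bound by (intro LIMSEQ_le_const) (auto simp: divide_inverse intro!: exI[of _ 1])
qed

text \<open>The one-sided estimate applied to \<open>\<psi>\<close> and to \<open>1 - \<psi>\<close> gives equality, because both the functional
  and the measure assign the same value to the constant 1; a general function is an affine
  image of one with values in the unit interval.\<close>

lemma is_integration_representing_measure: "is_integration representing_measure \<Lambda>"
  unfolding is_integration_def
proof
  fix \<phi> :: "'a \<Rightarrow>\<^sub>C real"
  interpret finite_measure representing_measure by (rule finite_representing_measure)
  let ?m = "representing_measure"
  have unit: "\<Lambda> \<psi> = (\<integral>x. \<psi> x \<partial>?m)" if \<psi>: "\<And>x. 0 \<le> apply_bcontfun \<psi> x" "\<And>x. apply_bcontfun \<psi> x \<le> 1" for \<psi>
  proof (rule antisym)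
    show "\<Lambda> \<psi> \<le> (\<integral>x. \<psi> x \<partial>?m)" by (rule functional_le_integral_unit[OF \<psi>])
    have "\<Lambda> (one - \<psi>) \<le> (\<integral>x. (one - \<psi>) x \<partial>?m)"
      using \<psi> by (intro functional_le_integral_unit) auto
    also have "\<dots> = \<Lambda> one - (\<integral>x. \<psi> x \<partial>?m)"
      using integrable_representing_measure[of \<psi>] by (simp add: measure_UNIV)
    finally show "(\<integral>x. \<psi> x \<partial>?m) \<le> \<Lambda> \<psi>"
      by (simp add: blinfun.diff_right)
  qed
  define c where "c = norm \<phi> + 1"
  have c: "c > 0" using norm_ge_zero[of \<phi>] unfolding c_def by linarith
  define \<psi> where "\<psi> = (1 / (2 * c)) *\<^sub>R (\<phi> + c *\<^sub>R one)"
  have "\<bar>\<phi> x\<bar> \<le> c" for x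
    using norm_bounded[of \<phi> x] by (simp add: c_def)
  then have "0 \<le> \<psi> x" "\<psi> x \<le> 1" for x
    using c by (auto simp: \<psi>_def field_simps abs_le_iff) (smt (verit))+
  then have "\<Lambda> \<psi> = (\<integral>x. \<psi> x \<partial>?m)" by (rule unit)
  moreover have "\<phi> = (2 * c) *\<^sub>R \<psi> - c *\<^sub>R one"
    using c by (simp add: \<psi>_def)
  moreover have "\<Lambda> ((2 * c) *\<^sub>R \<psi> - c *\<^sub>R one) = (2 * c) * \<Lambda> \<psi> - c * \<Lambda> one"
    by (simp add: blinfun.diff_right blinfun.scaleR_right)
  moreover have "(\<integral>x. ((2 * c) *\<^sub>R \<psi> - c *\<^sub>R one) x \<partial>?m) = (2 * c) * (\<integral>x. \<psi> x \<partial>?m) - c * \<Lambda> one"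
    using integrable_representing_measure[of \<psi>] by (simp add: measure_UNIV)
  ultimately show "\<Lambda> \<phi> = (\<integral>x. \<phi> x \<partial>?m)"
    by metis
qed

end

text \<open>Invariance of the functional is invariance of the measure: by regularity it is enough to
  compare \<open>\<alpha>\<inverse>(U)\<close> with \<open>U\<close> for open \<open>U\<close>, through Urysohn functions.\<close>

lemma distr_eq_of_invariant_functional:
  fixes m :: "'a::t2_space measure"
  assumes comp: "compact (UNIV :: 'a set)" and fin: "finite_measure m" and reg: "regular_borel_measure m"
    and int: "is_integration m \<Lambda>" and \<alpha>: "continuous_on UNIV \<alpha>"
    and inv: "\<And>\<phi> \<psi>. (\<And>x. apply_bcontfun \<psi> x = apply_bcontfun \<phi> (\<alpha> x)) \<Longrightarrow> \<Lambda> \<psi> = \<Lambda> \<phi>"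
  shows "distr m borel \<alpha> = m"
proof -
  interpret finite_measure m by (rule fin)
  have sets_m [simp]: "sets m = sets borel"
    using reg by (simp add: regular_borel_measure_def)
  have space_m [simp]: "space m = UNIV"
    using sets_eq_imp_space_eq[OF sets_m] by simp
  note regD = reg[unfolded regular_borel_measure_def, THEN conjunct2, THEN bspec]
  have inner_reg: "emeasure m B = (SUP K \<in> {K. compact K \<and> K \<subseteq> B}. emeasure m K)"
    and outer_reg: "emeasure m B = (INF U \<in> {U. open U \<and> B \<subseteq> U}. emeasure m U)"
    if "B \<in> sets borel" for B
    using regD[OF that] by (rule conjunct1, rule conjunct2)
  have \<alpha>m [measurable]: "\<alpha> \<in> borel_measurable m"
    using borel_measurable_continuous_onI[OF \<alpha>] by (simp cong: measurable_cong_sets)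
  have vim: "\<alpha> -` B \<in> sets borel" if "B \<in> sets borel" for B
    using measurable_sets[OF \<alpha>m that] by simp
  have integ: "integrable m (apply_bcontfun \<phi>)" for \<phi> :: "'a \<Rightarrow>\<^sub>C real"
  proof -
    have "apply_bcontfun \<phi> \<in> borel_measurable borel"
      by (rule borel_measurable_continuous_onI) simp
    then have "apply_bcontfun \<phi> \<in> borel_measurable m"
      by (simp cong: measurable_cong_sets)
    then show ?thesis
      using norm_bounded[of \<phi>] by (intro integrable_const_bound[where B="norm \<phi>"]) auto
  qed
  have opens: "emeasure m (\<alpha> -` U) \<le> emeasure m U" if U: "open U" for U
  proof -
    have "emeasure m K \<le> emeasure m U" if K: "compact K" "K \<subseteq> \<alpha> -` U" for K
    proof -
      have "closed (\<alpha> ` K)"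
        using compact_imp_closed[OF compact_continuous_image[OF continuous_on_subset[OF \<alpha>] K(1)]] by simp
      then obtain \<phi> :: "'a \<Rightarrow>\<^sub>C real" where \<phi>: "\<And>x. 0 \<le> \<phi> x" "\<And>x. \<phi> x \<le> 1"
          "\<And>x. x \<in> \<alpha> ` K \<Longrightarrow> \<phi> x = 1" "\<And>x. x \<notin> U \<Longrightarrow> \<phi> x = 0"
        using Urysohn_compact[OF comp _ U, of "\<alpha> ` K"] K by blast
      obtain \<psi> where \<psi>: "apply_bcontfun \<psi> = (\<lambda>x. \<phi> (\<alpha> x))"
        by (rule bcontfun_of_continuous[OF comp, of "\<lambda>x. \<phi> (\<alpha> x)"])
           (use continuous_on_compose2[OF continuous_on_apply_bcontfun \<alpha>, of UNIV] in auto)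
      have Kb: "K \<in> sets borel"
        using K(1) by (simp add: compact_imp_closed)
      have ind: "integrable m (indicator B :: 'a \<Rightarrow> real)" if "B \<in> sets borel" for B
        using that by (intro integrable_real_indicator) (auto simp: emeasure_eq_measure)
      have "measure m K = (\<integral>x. indicator K x \<partial>m)"
        by simp
      also have "\<dots> \<le> (\<integral>x. \<psi> x \<partial>m)"
        using \<phi>
        by (intro integral_mono integ ind Kb) (auto simp: \<psi> indicator_def of_bool_def)
      also have "\<dots> = (\<integral>x. \<phi> x \<partial>m)"
        using inv[of \<psi> \<phi>] int by (simp add: \<psi> is_integration_def)
      also have "\<dots> \<le> (\<integral>x. indicator U x \<partial>m)"
        using \<phi> U by (intro integral_mono integ ind) (auto simp: indicator_def of_bool_def)
      also have "\<dots> = measure m U" by simp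
      finally show ?thesis by (simp add: emeasure_eq_measure)
    qed
    moreover have "emeasure m (\<alpha> -` U) = (SUP K \<in> {K. compact K \<and> K \<subseteq> \<alpha> -` U}. emeasure m K)"
      using U by (intro inner_reg vim) simp
    ultimately show ?thesis
      by (auto intro!: SUP_least)
  qed
  have le: "emeasure m (\<alpha> -` B) \<le> emeasure m B" if B: "B \<in> sets borel" for B
  proof -
    have "emeasure m (\<alpha> -` B) \<le> emeasure m U" if "open U" "B \<subseteq> U" for U
      using that vim[of U] by (intro order_trans[OF emeasure_mono opens]) auto
    moreover have "emeasure m B = (INF U \<in> {U. open U \<and> B \<subseteq> U}. emeasure m U)"
      by (rule outer_reg[OF B])
    ultimately show ?thesis by (auto intro!: INF_greatest)
  qed
  have "emeasure m (\<alpha> -` B) = emeasure m B" if B: "B \<in> sets borel" for B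
  proof -
    have "measure m (\<alpha> -` B) \<le> measure m B" "measure m (\<alpha> -` (- B)) \<le> measure m (- B)"
      using le[OF B] le[of "- B"] B by (auto simp: emeasure_eq_measure)
    then show ?thesis
      using finite_measure_compl[of B] finite_measure_compl[of "\<alpha> -` B"] B vim[OF B]
      by (simp add: emeasure_eq_measure vimage_Compl Compl_eq_Diff_UNIV[symmetric])
  qed
  then show ?thesis
    by (intro measure_eqI) (auto simp: emeasure_distr)
qed

section \<open>Entropy and mean of probability sequences\<close>

text \<open>The form in which linearity is used throughout: a linear quantity that stays bounded above along
  a ray cannot be positive.\<close>

lemma nonpos_of_multiples_bounded:
  fixes a C :: real
  assumes "\<And>k. k > 0 \<Longrightarrow> k * a \<le> C"
  shows "a \<le> 0"
proof (rule ccontr)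
  assume "\<not> a \<le> 0"
  then have a: "a > 0" by simp
  have "(\<bar>C\<bar> + 1) / a * a \<le> C"
    using a by (intro assms) (simp add: add_nonneg_pos)
  with a show False by (simp add: abs_if split: if_splits)
qed

text \<open>The graph of the convex function \<open>x ln x\<close> lies above its tangent at \<open>y\<close>. The convexity inequality,
  the lower bound by affine functions and the Gibbs inequality all follow from this.\<close>

lemma entropy_tangent:
  fixes u y :: real
  assumes "0 \<le> u" "0 < y"
  shows "u * ln y + u - y \<le> u * ln u"
proof (cases "u = 0")
  case False
  then have u: "u > 0" using assms by simp
  have "ln (y / u) \<le> y / u - 1"
    using u assms by (intro ln_le_minus_one) simp
  then have "ln y - ln u \<le> y / u - 1"
    using u assms by (simp add: ln_div)
  then have "u * (ln y - ln u) \<le> u * (y / u - 1)"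
    using u by (intro mult_left_mono) auto
  then show ?thesis using u by (simp add: algebra_simps)
qed (use assms in simp)

lemma entropy_convex:
  fixes x e \<epsilon> :: real
  assumes "0 \<le> x" "0 \<le> e" "0 \<le> \<epsilon>" "\<epsilon> \<le> 1"
  defines "y \<equiv> (1 - \<epsilon>) * x + \<epsilon> * e"
  shows "y * ln y \<le> (1 - \<epsilon>) * (x * ln x) + \<epsilon> * (e * ln e)"
proof (cases "y = 0")
  case True
  have "0 \<le> (1 - \<epsilon>) * x" "0 \<le> \<epsilon> * e" using assms by auto
  with True have "(1 - \<epsilon>) * x = 0" "\<epsilon> * e = 0" unfolding y_def by linarith+
  then show ?thesis using True by auto
next
  case False
  have "0 \<le> (1 - \<epsilon>) * x" "0 \<le> \<epsilon> * e" using assms by auto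
  with False have y: "y > 0" unfolding y_def by linarith
  have "(1 - \<epsilon>) * (x * ln y + x - y) + \<epsilon> * (e * ln y + e - y)
      \<le> (1 - \<epsilon>) * (x * ln x) + \<epsilon> * (e * ln e)"
    using entropy_tangent[OF assms(1) y] entropy_tangent[OF assms(2) y] assms(3,4)
    by (intro add_mono mult_left_mono) auto
  moreover have "(1 - \<epsilon>) * (x * ln y + x - y) + \<epsilon> * (e * ln y + e - y) = y * ln y"
    unfolding y_def by (simp add: algebra_simps)
  ultimately show ?thesis by simp
qed

lemma entropy_lower:
  fixes u b :: real
  assumes "0 \<le> u"
  shows "- (b * u + exp (- b)) \<le> u * ln u"
  using entropy_tangent[OF assms, of "exp (- b)"] assms by (simp add: mult.commute)

lemma entropy_nonpos: "0 \<le> u \<Longrightarrow> u \<le> 1 \<Longrightarrow> u * ln u \<le> (0 :: real)"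
  by (cases "u = 0") (auto simp: mult_nonneg_nonpos)

lemma summable_exp_minus: "s > 0 \<Longrightarrow> summable (\<lambda>n. exp (- (real n * s)))"
  using summable_geometric[of "exp (- s)"] by (simp add: exp_of_nat_mult[symmetric])

lemma probability_le_1:
  fixes t :: "nat \<Rightarrow> real"
  assumes "\<And>n. 0 \<le> t n" "t sums 1"
  shows "t n \<le> 1"
  using sum_le_suminf[of t "{n}"] assms by (auto simp: sums_iff)

text \<open>The tangent of \<open>x ln x\<close> at \<open>exp (-n)\<close> gives \<open>- t\<^sub>n ln t\<^sub>n \<le> n t\<^sub>n + exp (-n)\<close>, and both terms on
  the right are summable.\<close>

lemma summable_entropy:
  assumes "t \<in> S_tilde"
  shows "summable (\<lambda>n. t n * ln (t n))"
proof (rule summable_comparison_test')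
  have t: "\<And>n. 0 \<le> t n" "t sums 1" "summable (\<lambda>n. real n * t n)"
    using assms by (auto simp: S_tilde_def)
  show "summable (\<lambda>n. real n * t n + exp (- (real n * 1)))"
    by (intro summable_add t summable_exp_minus) simp
  fix n :: nat assume "n \<ge> 0"
  have "t n * ln (t n) \<le> 0"
    using t probability_le_1[OF t(1,2)] by (intro entropy_nonpos) auto
  then show "norm (t n * ln (t n)) \<le> real n * t n + exp (- (real n * 1))"
    using entropy_lower[OF t(1)[of n], of "real n"] by simp
qed

text \<open>Sum the tangent inequality at the normalized weights \<open>exp (a n) / Z\<close>; both sequences have sum
  1, so the correction terms cancel.\<close>

lemma Gibbs_inequality:
  fixes t a :: "nat \<Rightarrow> real"
  assumes t: "\<And>n. 0 \<le> t n" "t sums 1" and ent: "summable (\<lambda>n. t n * ln (t n))"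
    and ta: "summable (\<lambda>n. t n * a n)" and ea: "summable (\<lambda>n. exp (a n))"
  shows "(\<Sum>n. t n * a n) - ln (\<Sum>n. exp (a n)) \<le> (\<Sum>n. t n * ln (t n))"
proof -
  define Z where "Z = (\<Sum>n. exp (a n))"
  have Z: "Z > 0" unfolding Z_def by (intro suminf_pos ea) simp
  have st: "summable t" "(\<Sum>n. t n) = 1" using t(2) by (auto simp: sums_iff)
  have le: "t n * a n - ln Z * t n + t n - exp (a n) / Z \<le> t n * ln (t n)" for n
    using entropy_tangent[OF t(1)[of n], of "exp (a n) / Z"] Z
    by (simp add: ln_div algebra_simps)
  have "(\<Sum>n. t n * a n - ln Z * t n + t n - exp (a n) / Z) \<le> (\<Sum>n. t n * ln (t n))"
    by (intro suminf_le le ent summable_add summable_diff ta st summable_mult summable_divide ea)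
  moreover have "(\<Sum>n. t n * a n - ln Z * t n + t n - exp (a n) / Z)
      = (\<Sum>n. t n * a n) - ln Z * 1 + 1 - Z / Z"
  proof -
    have "(\<lambda>n. t n * a n - ln Z * t n + t n - exp (a n) / Z) sums ((\<Sum>n. t n * a n) - ln Z * 1 + 1 - Z / Z)"
      unfolding Z_def
      by (intro sums_add sums_diff sums_mult sums_divide t summable_sums ta ea)
    then show ?thesis by (simp add: sums_iff)
  qed
  ultimately show ?thesis using Z by (simp add: Z_def)
qed

definition shift_mass :: "real \<Rightarrow> nat \<Rightarrow> (nat \<Rightarrow> real) \<Rightarrow> nat \<Rightarrow> real" where
  "shift_mass \<epsilon> N t n = (1 - \<epsilon>) * t n + \<epsilon> * (if n = N then 1 else 0)"

text \<open>Moving mass \<open>\<epsilon>\<close> to the site \<open>N\<close> changes \<open>t\<close> by at most \<open>2 \<epsilon>\<close> in norm, but raises the mean by about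
  \<open>\<epsilon> N\<close>, which need not be small. A point mass has entropy term 0, so convexity of \<open>x ln x\<close>
  controls the entropy sum.\<close>

lemma shift_mass_approximation:
  assumes t: "t \<in> S_tilde" and \<epsilon>: "0 \<le> \<epsilon>" "\<epsilon> \<le> 1"
  shows "shift_mass \<epsilon> N t \<in> S_tilde"
    and "mean (shift_mass \<epsilon> N t) = (1 - \<epsilon>) * mean t + \<epsilon> * real N"
    and "(\<Sum>n. shift_mass \<epsilon> N t n * ln (shift_mass \<epsilon> N t n)) \<le> (1 - \<epsilon>) * (\<Sum>n. t n * ln (t n))"
    and "l1_dist (shift_mass \<epsilon> N t) t \<le> 2 * \<epsilon>"
proof -
  have t': "\<And>n. 0 \<le> t n" "t sums 1" "summable (\<lambda>n. real n * t n)"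
    using t by (auto simp: S_tilde_def)
  let ?e = "\<lambda>n. if n = N then 1 else 0 :: real"
  have e: "?e sums 1"
    using sums_single[of N "\<lambda>_. 1 :: real"] by simp
  have "(\<lambda>n. (1 - \<epsilon>) * t n + \<epsilon> * ?e n) sums ((1 - \<epsilon>) * 1 + \<epsilon> * 1)"
    by (intro sums_add sums_mult t' e)
  then have s1: "shift_mass \<epsilon> N t sums 1"
    by (simp add: shift_mass_def[abs_def])
  have en: "(\<lambda>n. real n * ?e n) sums real N"
    using sums_single[of N real] by (simp add: if_distrib[of "\<lambda>x. real _ * x"] cong: if_cong)
  have "(\<lambda>n. (1 - \<epsilon>) * (real n * t n) + \<epsilon> * (real n * ?e n)) sums ((1 - \<epsilon>) * mean t + \<epsilon> * real N)"
    unfolding mean_def by (intro sums_add sums_mult en summable_sums t')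
  then have m: "(\<lambda>n. real n * shift_mass \<epsilon> N t n) sums ((1 - \<epsilon>) * mean t + \<epsilon> * real N)"
    by (simp add: shift_mass_def[abs_def] distrib_left mult.left_commute)
  have nn: "0 \<le> shift_mass \<epsilon> N t n" for n
    using t'(1) \<epsilon> by (simp add: shift_mass_def)
  show S: "shift_mass \<epsilon> N t \<in> S_tilde"
    unfolding S_tilde_def using nn s1 sums_summable[OF m] by simp
  show "mean (shift_mass \<epsilon> N t) = (1 - \<epsilon>) * mean t + \<epsilon> * real N"
    unfolding mean_def[of "shift_mass \<epsilon> N t"] using m by (simp add: sums_iff)
  have "(\<Sum>n. shift_mass \<epsilon> N t n * ln (shift_mass \<epsilon> N t n)) \<le> (\<Sum>n. (1 - \<epsilon>) * (t n * ln (t n)))"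
  proof (intro suminf_le summable_entropy S summable_mult t)
    fix n
    show "shift_mass \<epsilon> N t n * ln (shift_mass \<epsilon> N t n) \<le> (1 - \<epsilon>) * (t n * ln (t n))"
      using entropy_convex[of "t n" 1 \<epsilon>] entropy_convex[of "t n" 0 \<epsilon>] t'(1) \<epsilon>
      by (cases "n = N") (simp_all add: shift_mass_def)
  qed
  then show "(\<Sum>n. shift_mass \<epsilon> N t n * ln (shift_mass \<epsilon> N t n)) \<le> (1 - \<epsilon>) * (\<Sum>n. t n * ln (t n))"
    using suminf_mult[OF summable_entropy[OF t]] by simp
  have hs: "((\<lambda>n. \<epsilon> * (?e n + t n)) has_sum (\<epsilon> * (1 + 1))) UNIV"
    using t'(1) \<epsilon> by (intro sums_nonneg_imp_has_sum sums_mult sums_add e t') auto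
  have le: "\<bar>shift_mass \<epsilon> N t n - t n\<bar> \<le> \<epsilon> * (?e n + t n)" for n
  proof -
    have "shift_mass \<epsilon> N t n - t n = \<epsilon> * (?e n - t n)"
      by (simp add: shift_mass_def algebra_simps)
    moreover have "\<bar>?e n - t n\<bar> \<le> ?e n + t n"
      using t'(1)[of n] by (auto simp: abs_if)
    ultimately show ?thesis
      using \<epsilon> by (simp only: abs_mult) (simp add: mult_left_mono)
  qed
  have su: "(\<lambda>n. \<bar>shift_mass \<epsilon> N t n - t n\<bar>) summable_on UNIV"
  proof (subst summable_on_UNIV_nonneg_real_iff)
    show "summable (\<lambda>n. \<bar>shift_mass \<epsilon> N t n - t n\<bar>)"
      using has_sum_imp_sums[OF hs] le by (intro summable_comparison_test'[OF sums_summable]) auto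
  qed simp
  have "l1_dist (shift_mass \<epsilon> N t) t \<le> \<epsilon> * (1 + 1)"
    unfolding l1_dist_def by (rule has_sum_mono[OF has_sum_infsum[OF su] hs]) (rule le)
  then show "l1_dist (shift_mass \<epsilon> N t) t \<le> 2 * \<epsilon>" by simp
qed

lemma S_tilde_subset_l1: "S_tilde \<subseteq> l1"
  by (auto simp: S_tilde_def l1_def sums_iff)

lemma e0_S_tilde: "e0 \<in> S_tilde" and mean_e0: "mean e0 = 0"
proof -
  have "e0 sums 1"
    using sums_single[of 0 "\<lambda>_. 1 :: real"] by (simp add: e0_def[abs_def] eq_commute)
  moreover have z: "(\<lambda>n. real n * e0 n) = (\<lambda>n. 0)"
    by (auto simp: e0_def)
  ultimately show "e0 \<in> S_tilde" "mean e0 = 0"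
    by (auto simp: S_tilde_def mean_def e0_def)
qed

lemma mean_pos:
  assumes t: "t \<in> S_tilde" and ne: "t \<noteq> e0"
  shows "mean t > 0"
proof -
  have t': "\<And>n. 0 \<le> t n" "t sums 1" "summable (\<lambda>n. real n * t n)"
    using t by (auto simp: S_tilde_def)
  have "\<exists>n>0. t n > 0"
  proof (rule ccontr)
    assume "\<not> (\<exists>n>0. t n > 0)"
    then have z: "t n = 0" if "n \<noteq> 0" for n
      using t'(1)[of n] that by (metis gr0I less_eq_real_def)
    then have "t sums t 0"
      using sums_finite[of "{0}" t] by auto
    then have "t 0 = 1" using t'(2) sums_unique2 by blast
    then have "t = e0" using z by (auto simp: e0_def)
    with ne show False by simp
  qed
  then obtain n where "n > 0" "t n > 0" by blast
  then show ?thesis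
    unfolding mean_def using t' by (intro suminf_pos2[of _ n]) auto
qed

lemma l_infty_bound:
  assumes "c \<in> l_infty"
  obtains C where "C > 0" "\<And>n. \<bar>c n\<bar> \<le> C"
  using assms unfolding l_infty_def bounded_pos by auto

lemma summable_l1_l_infty:
  assumes "c \<in> l_infty" "t \<in> l1"
  shows "summable (\<lambda>n. c n * t n)"
proof -
  obtain C where C: "C > 0" "\<And>n. \<bar>c n\<bar> \<le> C" by (rule l_infty_bound[OF assms(1)]) (rule that)
  show ?thesis
  proof (rule summable_comparison_test')
    show "summable (\<lambda>n. C * \<bar>t n\<bar>)"
      using assms(2) by (intro summable_mult) (simp add: l1_def)
    show "norm (c n * t n) \<le> C * \<bar>t n\<bar>" for n
      using C(2)[of n] by (simp add: abs_mult mult_right_mono)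
  qed
qed

lemma summable_exp_l_infty:
  assumes "c \<in> l_infty" "r < 0"
  shows "summable (\<lambda>n. exp (c n + real n * r))"
proof -
  obtain C where C: "C > 0" "\<And>n. \<bar>c n\<bar> \<le> C" by (rule l_infty_bound[OF assms(1)]) (rule that)
  show ?thesis
  proof (rule summable_comparison_test')
    show "summable (\<lambda>n. exp C * exp (- (real n * - r)))"
      using assms(2) by (intro summable_mult summable_exp_minus) simp
    show "norm (exp (c n + real n * r)) \<le> exp C * exp (- (real n * - r))" for n
      using C(2)[of n] by (simp add: exp_add abs_le_iff)
  qed
qed

lemma l_inftyI: "(\<And>n. \<bar>c n\<bar> \<le> C) \<Longrightarrow> c \<in> l_infty"
  unfolding l_infty_def mem_Collect_eq by (rule boundedI[of _ C]) auto

lemma l1_dist_sums: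
  assumes "s \<in> l1" "t \<in> l1"
  shows "(\<lambda>n. \<bar>s n - t n\<bar>) sums l1_dist s t"
proof -
  have "summable (\<lambda>n. \<bar>s n\<bar> + \<bar>t n\<bar>)"
    using assms by (auto simp: l1_def intro: summable_add)
  then have s: "summable (\<lambda>n. \<bar>s n - t n\<bar>)"
    by (rule summable_comparison_test') (auto intro: abs_triangle_ineq4)
  have "((\<lambda>n. \<bar>s n - t n\<bar>) has_sum (\<Sum>n. \<bar>s n - t n\<bar>)) UNIV"
    by (intro sums_nonneg_imp_has_sum summable_sums s) auto
  then have "l1_dist s t = (\<Sum>n. \<bar>s n - t n\<bar>)"
    unfolding l1_dist_def by (rule infsumI)
  then show ?thesis using summable_sums[OF s] by simp
qed

text \<open>The pairing with a bounded sequence is Lipschitz.\<close>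

lemma continuous_l1_pairing:
  assumes c: "c \<in> l_infty"
  shows "continuous_map (Metric_space.mtopology l1 l1_dist) euclideanreal (\<lambda>t. \<Sum>n. c n * t n)"
proof -
  interpret L: Metric_space l1 l1_dist by (rule Metric_space_l1)
  obtain C where C: "C > 0" "\<And>n. \<bar>c n\<bar> \<le> C" by (rule l_infty_bound[OF c]) (rule that)
  have lip: "\<bar>(\<Sum>n. c n * s n) - (\<Sum>n. c n * t n)\<bar> \<le> C * l1_dist s t" if "s \<in> l1" "t \<in> l1" for s t
  proof -
    note d = l1_dist_sums[OF that]
    have "(\<Sum>n. c n * s n) - (\<Sum>n. c n * t n) = (\<Sum>n. c n * s n - c n * t n)"
      by (intro suminf_diff summable_l1_l_infty c that)
    moreover have "norm (\<Sum>n. c n * s n - c n * t n) \<le> (\<Sum>n. C * \<bar>s n - t n\<bar>)"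
    proof (rule norm_suminf_le)
      show "norm (c n * s n - c n * t n) \<le> C * \<bar>s n - t n\<bar>" for n
        using C(2)[of n] by (simp add: right_diff_distrib[symmetric] abs_mult mult_right_mono)
      show "summable (\<lambda>n. C * \<bar>s n - t n\<bar>)"
        by (intro summable_mult sums_summable[OF d])
    qed
    moreover have "(\<Sum>n. C * \<bar>s n - t n\<bar>) = C * l1_dist s t"
      using sums_mult[OF d, of C] by (simp add: sums_iff)
    ultimately show ?thesis by simp
  qed
  have "continuous_map L.mtopology Met_TC.mtopology (\<lambda>t. \<Sum>n. c n * t n)"
  proof (subst L.metric_continuous_map[OF Met_TC.Metric_space_axioms], intro conjI ballI allI impI)
    fix s and e :: real assume s: "s \<in> l1" and e: "0 < e"
    show "\<exists>\<delta>>0. \<forall>x. x \<in> l1 \<and> l1_dist s x < \<delta> \<longrightarrow> dist (\<Sum>n. c n * s n) (\<Sum>n. c n * x n) < e"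
    proof (intro exI[of _ "e / C"] conjI allI impI)
      fix x assume x: "x \<in> l1 \<and> l1_dist s x < e / C"
      then have "C * l1_dist s x < e"
        using C(1) by (simp add: less_divide_eq mult.commute)
      then show "dist (\<Sum>n. c n * s n) (\<Sum>n. c n * x n) < e"
        using lip[OF s, of x] x by (simp add: dist_real_def)
    qed (use C e in simp)
  qed simp
  then show ?thesis by simp
qed

section \<open>Powers of weighted composition operators\<close>

definition birkhoff_sum :: "('a \<Rightarrow> 'a) \<Rightarrow> ('a \<Rightarrow> real) \<Rightarrow> nat \<Rightarrow> 'a \<Rightarrow> real" where
  "birkhoff_sum \<alpha> \<phi> n x = (\<Sum>k<n. \<phi> ((\<alpha> ^^ k) x))"

definition weighted_comp_power ::
    "('a \<Rightarrow> 'a) \<Rightarrow> ('a \<Rightarrow> real) \<Rightarrow> nat \<Rightarrow> ('a \<Rightarrow> complex) \<Rightarrow> 'a \<Rightarrow> complex" where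
  "weighted_comp_power \<alpha> \<phi> n g x = complex_of_real (exp (birkhoff_sum \<alpha> \<phi> n x)) * g ((\<alpha> ^^ n) x)"

lemma birkhoff_sum_add:
  "birkhoff_sum \<alpha> \<phi> (m + n) x = birkhoff_sum \<alpha> \<phi> m x + birkhoff_sum \<alpha> \<phi> n ((\<alpha> ^^ m) x)"
proof (induction n)
  case (Suc n)
  have "(\<alpha> ^^ (m + n)) x = (\<alpha> ^^ n) ((\<alpha> ^^ m) x)"
    by (subst add.commute) (simp add: funpow_add)
  then show ?case using Suc by (simp add: birkhoff_sum_def)
qed (simp add: birkhoff_sum_def)

lemma weighted_comp_power_add:
  "weighted_comp_power \<alpha> \<phi> m (weighted_comp_power \<alpha> \<phi> n g) x = weighted_comp_power \<alpha> \<phi> (m + n) g x"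
proof -
  have "(\<alpha> ^^ (m + n)) x = (\<alpha> ^^ n) ((\<alpha> ^^ m) x)"
    by (subst add.commute) (simp add: funpow_add)
  then show ?thesis
    by (simp add: weighted_comp_power_def birkhoff_sum_add exp_add)
qed

lemma weighted_comp_power_0 [simp]: "weighted_comp_power \<alpha> \<phi> 0 g x = g x"
  by (simp add: weighted_comp_power_def birkhoff_sum_def)

lemma weighted_comp_eq_power:
  "weighted_comp (\<lambda>x. exp (\<phi> x)) \<alpha> g x = weighted_comp_power \<alpha> \<phi> 1 g x"
  by (simp add: weighted_comp_def weighted_comp_power_def birkhoff_sum_def)

lemma weighted_comp_power_scale:
  "weighted_comp_power \<alpha> \<phi> n (\<lambda>x. c * g x) x = c * weighted_comp_power \<alpha> \<phi> n g x"
  by (simp add: weighted_comp_power_def)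

lemma weighted_comp_power_divide:
  "weighted_comp_power \<alpha> \<phi> n (\<lambda>x. g x / c) x = weighted_comp_power \<alpha> \<phi> n g x / c"
  by (simp add: weighted_comp_power_def)

lemma weighted_comp_power_diff:
  "weighted_comp_power \<alpha> \<phi> n (\<lambda>x. g x - h x) x
    = weighted_comp_power \<alpha> \<phi> n g x - weighted_comp_power \<alpha> \<phi> n h x"
  by (simp add: weighted_comp_power_def right_diff_distrib)

lemma weighted_comp_power_sum:
  "weighted_comp_power \<alpha> \<phi> n (\<lambda>x. \<Sum>i\<in>I. g i x) x = (\<Sum>i\<in>I. weighted_comp_power \<alpha> \<phi> n (g i) x)"
  by (simp add: weighted_comp_power_def sum_distrib_left)

lemma cmod_weighted_comp_power:
  "cmod (weighted_comp_power \<alpha> \<phi> n g x) = exp (birkhoff_sum \<alpha> \<phi> n x) * cmod (g ((\<alpha> ^^ n) x))"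
  by (simp add: weighted_comp_power_def norm_mult)

text \<open>The telescoping identity behind the Neumann series.\<close>

lemma neumann_identity:
  assumes z: "z \<noteq> 0" and g: "\<And>x. g x = z * f x - weighted_comp (\<lambda>x. exp (\<phi> x)) \<alpha> f x"
  shows "f x = (\<Sum>k<n. weighted_comp_power \<alpha> \<phi> k g x / z ^ Suc k) + weighted_comp_power \<alpha> \<phi> n f x / z ^ n"
proof (induction n)
  case (Suc n)
  have "g = (\<lambda>x. z * f x - weighted_comp_power \<alpha> \<phi> 1 f x)"
    using g by (auto simp: weighted_comp_eq_power)
  then have "weighted_comp_power \<alpha> \<phi> n g x
      = z * weighted_comp_power \<alpha> \<phi> n f x - weighted_comp_power \<alpha> \<phi> (Suc n) f x"
    by (simp only: weighted_comp_power_diff weighted_comp_power_scale weighted_comp_power_add) simp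
  then show ?case
    using Suc z by (simp add: field_simps)
qed simp

text \<open>The truncated Neumann series is a right inverse of \<open>z - A\<close> up to the error \<open>A\<^sup>n g / z\<^sup>n\<close>.\<close>

lemma neumann_partial_sum:
  fixes z :: complex
  assumes z: "z \<noteq> 0" and f_def: "f = (\<lambda>x. \<Sum>k<n. weighted_comp_power \<alpha> \<phi> k g x / z ^ Suc k)"
  shows "z * f x - weighted_comp (\<lambda>x. exp (\<phi> x)) \<alpha> f x = g x - weighted_comp_power \<alpha> \<phi> n g x / z ^ n"
proof -
  define u where "u k = weighted_comp_power \<alpha> \<phi> k g x / z ^ k" for k
  have 1: "z * f x = (\<Sum>k<n. u k)"
    using z unfolding f_def sum_distrib_left by (intro sum.cong) (auto simp: u_def field_simps)
  have 2: "weighted_comp (\<lambda>x. exp (\<phi> x)) \<alpha> f x = (\<Sum>k<n. u (Suc k))"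
    unfolding weighted_comp_eq_power f_def weighted_comp_power_sum weighted_comp_power_divide
      weighted_comp_power_add by (simp add: u_def)
  have "z * f x - weighted_comp (\<lambda>x. exp (\<phi> x)) \<alpha> f x = (\<Sum>k<n. u k - u (Suc k))"
    unfolding 1 2 by (simp add: sum_subtractf)
  also have "\<dots> = u 0 - u n"
    by (rule sum_lessThan_telescope')
  finally show ?thesis by (simp add: u_def)
qed

text \<open>The numbers \<open>s\<close> for which the norms of the powers are \<open>O(s\<^sup>n)\<close>; their infimum is the limit in
  Gelfand's formula.\<close>

definition growth_rates :: "real \<Rightarrow> 'a measure \<Rightarrow> ('a \<Rightarrow> 'a) \<Rightarrow> ('a \<Rightarrow> real) \<Rightarrow> real set" where
  "growth_rates p M \<alpha> \<phi> = {s. 0 < s \<and> (\<exists>K\<ge>0. \<forall>n. \<forall>g \<in> Lp p M.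
     Lp_norm p M (weighted_comp_power \<alpha> \<phi> n g) \<le> K * s ^ n * Lp_norm p M g)}"

locale measure_preserving_system =
  fixes \<mu> :: "'a::t2_space measure" and \<alpha> :: "'a \<Rightarrow> 'a" and p :: real
  assumes compact_UNIV: "compact (UNIV :: 'a set)"
    and sets_eq: "sets \<mu> = sets borel"
    and finite_positive_set: "\<exists>B \<in> sets \<mu>. 0 < emeasure \<mu> B \<and> emeasure \<mu> B < \<infinity>"
    and continuous: "continuous_on UNIV \<alpha>"
    and invariant: "distr \<mu> borel \<alpha> = \<mu>"
    and p_ge_1: "1 \<le> p"
begin

abbreviation "W \<equiv> weighted_comp_power \<alpha>"
abbreviation "G \<phi> \<equiv> growth_rates p \<mu> \<alpha> (apply_bcontfun \<phi>)"
abbreviation "N \<equiv> Lp_norm p \<mu>"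
abbreviation "A \<phi> \<equiv> weighted_comp (\<lambda>x. exp (apply_bcontfun \<phi> x)) \<alpha>"

lemma p_pos: "p > 0"
  using p_ge_1 by simp

lemma measurable_mu_iff: "measurable \<mu> M = measurable borel M"
  by (rule measurable_cong_sets) (auto simp: sets_eq)

lemma continuous_funpow: "continuous_on UNIV (\<alpha> ^^ n)"
  by (induction n) (auto intro: continuous_on_compose2[OF continuous] continuous_on_id simp: id_def o_def)

lemma measurable_funpow [measurable]: "(\<alpha> ^^ n) \<in> measurable \<mu> borel"
  unfolding measurable_mu_iff by (rule borel_measurable_continuous_onI[OF continuous_funpow])

lemma distr_funpow: "distr \<mu> borel (\<alpha> ^^ n) = \<mu>"
proof (induction n)
  case 0
  have "distr \<mu> borel id = \<mu>"
    using distr_id2[of borel \<mu>] sets_eq by (simp add: id_def)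
  then show ?case by (simp add: id_def)
next
  case (Suc n)
  have [measurable]: "\<alpha> \<in> borel_measurable borel"
    by (rule borel_measurable_continuous_onI[OF continuous])
  have "distr \<mu> borel (\<alpha> ^^ Suc n) = distr (distr \<mu> borel (\<alpha> ^^ n)) borel \<alpha>"
    by (subst distr_distr) auto
  then show ?case unfolding Suc invariant .
qed

lemma Lp_comp_funpow:
  assumes g: "g \<in> Lp p \<mu>"
  shows "(\<lambda>x. g ((\<alpha> ^^ n) x)) \<in> Lp p \<mu>" and "N (\<lambda>x. g ((\<alpha> ^^ n) x)) = N g"
proof -
  have gb [measurable]: "g \<in> borel_measurable borel"
    using g by (simp add: Lp_def measurable_mu_iff)
  have [measurable]: "(\<alpha> ^^ n) \<in> borel_measurable borel"
    by (rule borel_measurable_continuous_onI[OF continuous_funpow])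
  have i: "integrable (distr \<mu> borel (\<alpha> ^^ n)) (\<lambda>x. cmod (g x) powr p)"
    using g by (simp add: distr_funpow Lp_def)
  have "integrable \<mu> (\<lambda>x. cmod (g ((\<alpha> ^^ n) x)) powr p)"
    by (rule integrable_distr[OF measurable_funpow i])
  moreover have "(\<lambda>x. g ((\<alpha> ^^ n) x)) \<in> borel_measurable \<mu>"
    unfolding measurable_mu_iff by measurable
  ultimately show "(\<lambda>x. g ((\<alpha> ^^ n) x)) \<in> Lp p \<mu>"
    by (simp add: Lp_def)
  have "(\<integral>x. cmod (g ((\<alpha> ^^ n) x)) powr p \<partial>\<mu>) = (\<integral>x. cmod (g x) powr p \<partial>distr \<mu> borel (\<alpha> ^^ n))"
    by (rule integral_distr[symmetric]) measurable
  then show "N (\<lambda>x. g ((\<alpha> ^^ n) x)) = N g"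
    by (simp add: distr_funpow Lp_norm_def)
qed

lemma borel_measurable_birkhoff_sum [measurable]:
  fixes \<phi> :: "'a \<Rightarrow>\<^sub>C real"
  shows "birkhoff_sum \<alpha> (apply_bcontfun \<phi>) n \<in> borel_measurable \<mu>"
proof -
  have "continuous_on UNIV (\<lambda>x. birkhoff_sum \<alpha> (apply_bcontfun \<phi>) n x)"
    unfolding birkhoff_sum_def
    by (intro continuous_on_sum continuous_on_compose2[OF _ continuous_funpow, of UNIV]) auto
  then show ?thesis
    unfolding measurable_mu_iff by (rule borel_measurable_continuous_onI)
qed

lemma birkhoff_sum_abs_le:
  fixes \<phi> :: "'a \<Rightarrow>\<^sub>C real"
  shows "\<bar>birkhoff_sum \<alpha> (apply_bcontfun \<phi>) n x\<bar> \<le> real n * norm \<phi>"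
proof -
  have "\<bar>birkhoff_sum \<alpha> (apply_bcontfun \<phi>) n x\<bar> \<le> (\<Sum>k<n. \<bar>\<phi> ((\<alpha> ^^ k) x)\<bar>)"
    unfolding birkhoff_sum_def by (rule sum_abs)
  also have "\<dots> \<le> (\<Sum>k<n. norm \<phi>)"
    using norm_bounded[of \<phi>] by (intro sum_mono) auto
  finally show ?thesis by simp
qed

lemma weighted_comp_power_measurable:
  fixes \<phi> :: "'a \<Rightarrow>\<^sub>C real"
  assumes g: "g \<in> Lp p \<mu>"
  shows "W \<phi> n g \<in> borel_measurable \<mu>"
proof -
  have [measurable]: "(\<lambda>x. g ((\<alpha> ^^ n) x)) \<in> borel_measurable \<mu>"
    using Lp_comp_funpow(1)[OF g] by (simp add: Lp_def)
  show ?thesis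
    unfolding weighted_comp_power_def by measurable
qed

lemma Lp_weighted_comp_power:
  fixes \<phi> :: "'a \<Rightarrow>\<^sub>C real"
  assumes g: "g \<in> Lp p \<mu>"
  shows "W \<phi> n g \<in> Lp p \<mu>" and "N (W \<phi> n g) \<le> exp (norm \<phi>) ^ n * N g"
proof -
  have "cmod (W \<phi> n g x) \<le> exp (norm \<phi>) ^ n * cmod (g ((\<alpha> ^^ n) x))" for x
    using birkhoff_sum_abs_le[of \<phi> n x]
    by (auto simp: cmod_weighted_comp_power exp_of_nat_mult[symmetric] intro!: mult_right_mono)
  then have "AE x in \<mu>. cmod (W \<phi> n g x) \<le> exp (norm \<phi>) ^ n * cmod (g ((\<alpha> ^^ n) x))"
    by simp
  from Lp_dominated[OF p_pos _ weighted_comp_power_measurable[OF g] Lp_comp_funpow(1)[OF g] this]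
  show "W \<phi> n g \<in> Lp p \<mu>" and "N (W \<phi> n g) \<le> exp (norm \<phi>) ^ n * N g"
    by (auto simp: Lp_comp_funpow[OF g])
qed

lemma exp_norm_in_growth_rates: "exp (norm \<phi>) \<in> G \<phi>"
  unfolding growth_rates_def using Lp_weighted_comp_power(2)[of _ \<phi>]
  by (auto intro!: exI[of _ 1])

text \<open>A pointwise comparison of the weights of the powers compares their norms. This is the source of
  all properties of the spectral exponent: monotonicity, the behaviour under constants and the
  invariance under coboundaries only differ in the comparison of Birkhoff sums.\<close>

lemma growth_rates_transfer:
  fixes \<phi> \<psi> :: "'a \<Rightarrow>\<^sub>C real"
  assumes le: "\<And>n x. birkhoff_sum \<alpha> \<phi> n x \<le> birkhoff_sum \<alpha> \<psi> n x + real n * c + d"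
    and s: "s \<in> G \<psi>"
  shows "exp c * s \<in> G \<phi>"
proof -
  obtain K where K: "K \<ge> 0" "\<And>n g. g \<in> Lp p \<mu> \<Longrightarrow> N (W \<psi> n g) \<le> K * s ^ n * N g"
    using s by (auto simp: growth_rates_def)
  have s0: "s > 0" using s by (simp add: growth_rates_def)
  have "N (W \<phi> n g) \<le> (exp d * K) * (exp c * s) ^ n * N g" if g: "g \<in> Lp p \<mu>" for n g
  proof -
    have "cmod (W \<phi> n g x) \<le> exp (real n * c + d) * cmod (W \<psi> n g x)" for x
    proof -
      have "exp (birkhoff_sum \<alpha> \<phi> n x) \<le> exp (real n * c + d) * exp (birkhoff_sum \<alpha> \<psi> n x)"
        using le[of n x] by (simp add: exp_add[symmetric] add_ac)
      then show ?thesis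
        unfolding cmod_weighted_comp_power mult.assoc[symmetric] by (rule mult_right_mono) simp
    qed
    then have "N (W \<phi> n g) \<le> exp (real n * c + d) * N (W \<psi> n g)"
      by (intro Lp_dominated(2)[OF p_pos]) (auto intro: weighted_comp_power_measurable Lp_weighted_comp_power g)
    also have "\<dots> \<le> exp (real n * c + d) * (K * s ^ n * N g)"
      using K(2)[OF g] by (intro mult_left_mono) auto
    also have "\<dots> = (exp d * K) * (exp c * s) ^ n * N g"
      by (simp add: exp_add power_mult_distrib exp_of_nat_mult)
    finally show ?thesis .
  qed
  then show ?thesis
    using K(1) s0 unfolding growth_rates_def by (auto intro!: exI[of _ "exp d * K"])
qed

text \<open>A contraction estimate for a single power determines the growth: write \<open>n = q m + r\<close> and absorb
  the finitely many remainders \<open>r \<le> m\<close> into the constant.\<close>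

lemma growth_rates_of_power:
  fixes \<phi> :: "'a \<Rightarrow>\<^sub>C real"
  assumes s: "s > 0" and m: "m > 0"
    and bound: "\<And>g. g \<in> Lp p \<mu> \<Longrightarrow> N (W \<phi> m g) \<le> s ^ m * N g"
  shows "s \<in> G \<phi>"
proof -
  define c where "c = max 1 (exp (norm \<phi>) / s)"
  have c: "1 \<le> c" "exp (norm \<phi>) \<le> c * s"
    using s by (auto simp: c_def max_def field_simps)
  have mult: "N (W \<phi> (q * m) g) \<le> s ^ (q * m) * N g" if g: "g \<in> Lp p \<mu>" for q g
  proof (induction q)
    case (Suc q)
    have "W \<phi> (Suc q * m) g = W \<phi> m (W \<phi> (q * m) g)"
      by (rule ext) (simp add: weighted_comp_power_add)
    then have "N (W \<phi> (Suc q * m) g) \<le> s ^ m * N (W \<phi> (q * m) g)"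
      using bound[OF Lp_weighted_comp_power(1)[OF g]] by simp
    also have "\<dots> \<le> s ^ m * (s ^ (q * m) * N g)"
      using Suc s by (intro mult_left_mono) auto
    finally show ?case by (simp add: power_add)
  qed simp
  have "N (W \<phi> n g) \<le> c ^ m * s ^ n * N g" if g: "g \<in> Lp p \<mu>" for n g
  proof -
    define q r where "q = n div m" and "r = n mod m"
    have n: "n = q * m + r" and r: "r \<le> m"
      using m by (auto simp: q_def r_def less_imp_le)
    have "W \<phi> n g = W \<phi> (q * m) (W \<phi> r g)"
      by (rule ext) (simp add: weighted_comp_power_add n)
    then have "N (W \<phi> n g) \<le> s ^ (q * m) * N (W \<phi> r g)"
      using mult[OF Lp_weighted_comp_power(1)[OF g]] by simp
    also have "\<dots> \<le> s ^ (q * m) * (exp (norm \<phi>) ^ r * N g)"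
      using s Lp_weighted_comp_power(2)[OF g] by (intro mult_left_mono) auto
    also have "\<dots> \<le> s ^ (q * m) * ((c ^ m * s ^ r) * N g)"
    proof (intro mult_left_mono mult_right_mono)
      have "exp (norm \<phi>) ^ r \<le> (c * s) ^ r"
        using c by (intro power_mono) auto
      also have "\<dots> \<le> c ^ m * s ^ r"
        using c s r by (auto simp: power_mult_distrib intro!: mult_right_mono power_increasing)
      finally show "exp (norm \<phi>) ^ r \<le> c ^ m * s ^ r" .
    qed (use s in auto)
    finally show ?thesis by (simp add: n power_add mult_ac)
  qed
  moreover have "0 \<le> c ^ m" using c by simp
  ultimately show ?thesis
    using s unfolding growth_rates_def by blast
qed

lemma Lp_weighted_comp:
  fixes \<phi> :: "'a \<Rightarrow>\<^sub>C real"
  assumes "f \<in> Lp p \<mu>"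
  shows "A \<phi> f \<in> Lp p \<mu>"
proof -
  have "A \<phi> f = W \<phi> 1 f"
    by (rule ext) (rule weighted_comp_eq_power)
  then show ?thesis using Lp_weighted_comp_power(1)[OF assms] by simp
qed

lemma neumann_sum_bound:
  fixes \<phi> :: "'a \<Rightarrow>\<^sub>C real"
  assumes K0: "K \<ge> 0" and K: "\<forall>n. \<forall>g\<in>Lp p \<mu>. N (W \<phi> n g) \<le> K * s ^ n * N g"
    and s: "0 < s" "s < cmod z" and g: "g \<in> Lp p \<mu>"
  shows "W \<phi> k g \<in> Lp p \<mu>"
    and "(\<lambda>x. W \<phi> k g x / z ^ Suc k) \<in> Lp p \<mu>"
    and "(\<Sum>k<n. N (\<lambda>x. W \<phi> k g x / z ^ Suc k)) \<le> K / (cmod z - s) * N g"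
proof -
  show Wg: "W \<phi> k g \<in> Lp p \<mu>" for k
    by (rule Lp_weighted_comp_power(1)[OF g])
  have eq: "(\<lambda>x. W \<phi> k g x / z ^ Suc k) = (\<lambda>x. inverse (z ^ Suc k) * W \<phi> k g x)" for k
    by (simp add: field_simps)
  show "(\<lambda>x. W \<phi> k g x / z ^ Suc k) \<in> Lp p \<mu>" for k
    unfolding eq by (rule Lp_cmult(1)[OF p_pos Wg])
  define r where "r = cmod z"
  have r: "r > 0" "s < r" using s unfolding r_def by linarith+
  then have q: "s / r < 1" "0 \<le> s / r" using s by simp_all
  have bd: "N (\<lambda>x. W \<phi> k g x / z ^ Suc k) \<le> K * N g / r * (s / r) ^ k" for k
  proof -
    have "N (\<lambda>x. W \<phi> k g x / z ^ Suc k) \<le> cmod (inverse (z ^ Suc k)) * N (W \<phi> k g)"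
      unfolding eq by (rule Lp_cmult(2)[OF p_pos Wg])
    also have "\<dots> = N (W \<phi> k g) / r ^ Suc k"
      by (simp only: r_def norm_inverse norm_power divide_inverse mult.commute)
    also have "\<dots> \<le> (K * s ^ k * N g) / r ^ Suc k"
      using r K g by (intro divide_right_mono) auto
    finally show ?thesis by (simp add: power_divide mult_ac)
  qed
  have "(\<Sum>k<n. N (\<lambda>x. W \<phi> k g x / z ^ Suc k)) \<le> (\<Sum>k<n. K * N g / r * (s / r) ^ k)"
    by (intro sum_mono bd)
  also have "\<dots> = K * N g / r * (\<Sum>k<n. (s / r) ^ k)"
    by (simp add: sum_distrib_left)
  also have "\<dots> \<le> K * N g / r * (1 / (1 - s / r))"
  proof (intro mult_left_mono)
    have "(\<Sum>k<n. (s / r) ^ k) \<le> (\<Sum>k. (s / r) ^ k)"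
      using q by (intro sum_le_suminf summable_geometric) auto
    then show "(\<Sum>k<n. (s / r) ^ k) \<le> 1 / (1 - s / r)"
      using q by (simp add: suminf_geometric)
  qed (use K0 r in auto)
  also have "\<dots> = K / (r - s) * N g"
    using r s by (simp add: field_simps)
  finally show "(\<Sum>k<n. N (\<lambda>x. W \<phi> k g x / z ^ Suc k)) \<le> K / (cmod z - s) * N g"
    by (simp add: r_def)
qed

text \<open>The Neumann series converges in norm. Surjectivity of \<open>z - A\<close> needs its sum as a function, which
  exists almost everywhere; the lower bound follows from a truncation whose remainder has
  norm at most one half.\<close>

lemma resolvent_outside_growth_rate:
  fixes \<phi> :: "'a \<Rightarrow>\<^sub>C real"
  assumes s: "s \<in> G \<phi>" "s < cmod z"
  shows "z \<in> Lp_resolvent_set p \<mu> (A \<phi>)"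
proof -
  obtain K where K: "K \<ge> 0" "\<forall>n. \<forall>g\<in>Lp p \<mu>. N (W \<phi> n g) \<le> K * s ^ n * N g"
    using s by (auto simp: growth_rates_def)
  have s0: "s > 0" using s by (simp add: growth_rates_def)
  have z: "z \<noteq> 0" using s0 s(2) by auto
  note nsb = neumann_sum_bound[OF K s0 s(2)]
  have "\<exists>f \<in> Lp p \<mu>. AE x in \<mu>. z * f x - A \<phi> f x = g x" if g: "g \<in> Lp p \<mu>" for g
  proof -
    define u where "u k x = W \<phi> k g x / z ^ Suc k" for k x
    have u: "u k \<in> Lp p \<mu>" for k
      unfolding u_def by (rule nsb(2)[OF g])
    have D: "(\<Sum>k<n. N (u k)) \<le> K / (cmod z - s) * N g" for n
      unfolding u_def by (rule nsb(3)[OF g])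
    define f where "f x = (\<Sum>k. u k x)" for x
    have "z * f x - A \<phi> f x = g x" if "summable (\<lambda>k. cmod (u k x))" for x
    proof -
      have su: "summable (\<lambda>k. u k x)"
        using that by (rule summable_norm_cancel)
      have su': "summable (\<lambda>k. u (Suc k) x)"
        by (rule summable_Suc_iff[THEN iffD2, OF su])
      have step: "complex_of_real (exp (\<phi> x)) * u k (\<alpha> x) = z * u (Suc k) x" for k
      proof -
        have "W \<phi> (Suc k) g x = complex_of_real (exp (\<phi> x)) * W \<phi> k g (\<alpha> x)"
          using weighted_comp_power_add[of \<alpha> \<phi> 1 k g x]
          by (simp add: weighted_comp_power_def[of _ _ "Suc 0"] birkhoff_sum_def)
        then show ?thesis using z by (simp add: u_def field_simps)
      qed
      have s': "summable (\<lambda>k. z * u (Suc k) x)"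
        by (intro summable_mult su')
      have "summable (\<lambda>k. inverse (complex_of_real (exp (\<phi> x))) * (z * u (Suc k) x))"
        using s' by (rule summable_mult)
      moreover have "inverse (complex_of_real (exp (\<phi> x))) * (z * u (Suc k) x) = u k (\<alpha> x)" for k
        unfolding step[symmetric] by simp
      ultimately have su2: "summable (\<lambda>k. u k (\<alpha> x))"
        by simp
      have "A \<phi> f x = complex_of_real (exp (\<phi> x)) * (\<Sum>k. u k (\<alpha> x))"
        by (simp add: weighted_comp_def f_def)
      also have "\<dots> = (\<Sum>k. z * u (Suc k) x)"
        unfolding step[symmetric] by (rule suminf_mult[symmetric, OF su2])
      also have "\<dots> = z * (\<Sum>k. u (Suc k) x)"
        by (rule suminf_mult[OF su'])
      also have "(\<Sum>k. u (Suc k) x) = f x - u 0 x"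
        using suminf_split_head[OF su] by (simp add: f_def)
      finally show ?thesis
        using z by (simp add: u_def algebra_simps)
    qed
    with Lp_series(1)[OF p_ge_1 u D] have "AE x in \<mu>. z * f x - A \<phi> f x = g x"
      by auto
    moreover have "f \<in> Lp p \<mu>"
      unfolding f_def by (rule Lp_series(2)[OF p_ge_1 u D])
    ultimately show ?thesis by blast
  qed
  moreover have "N f \<le> 2 * (K / (cmod z - s)) * N (\<lambda>x. z * f x - A \<phi> f x)" if f: "f \<in> Lp p \<mu>" for f
  proof -
    define g where "g x = z * f x - A \<phi> f x" for x
    have g: "g \<in> Lp p \<mu>"
      unfolding g_def by (intro Lp_diff(1) p_ge_1 Lp_cmult(1)[OF p_pos] f Lp_weighted_comp)
    have "(\<lambda>n. K * (s / cmod z) ^ n) \<longlonglongrightarrow> K * 0"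
      using s0 s(2) z by (intro tendsto_intros LIMSEQ_power_zero) (simp add: divide_less_eq)
    then have "\<forall>\<^sub>F n in sequentially. K * (s / cmod z) ^ n < 1 / 2"
      by (rule order_tendstoD(2)) auto
    then obtain n where n: "K * (s / cmod z) ^ n < 1 / 2"
      using eventually_happens[of _ sequentially] by auto
    have eq: "f = (\<lambda>x. (\<Sum>k<n. W \<phi> k g x / z ^ Suc k) + inverse (z ^ n) * W \<phi> n f x)"
    proof
      fix x
      have "W \<phi> n f x / z ^ n = inverse (z ^ n) * W \<phi> n f x"
        by (simp only: divide_inverse mult.commute)
      then show "f x = (\<Sum>k<n. W \<phi> k g x / z ^ Suc k) + inverse (z ^ n) * W \<phi> n f x"
        using neumann_identity[OF z g_def, of x n] by (rule subst)
    qed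
    have 1: "(\<lambda>x. \<Sum>k<n. W \<phi> k g x / z ^ Suc k) \<in> Lp p \<mu>"
      "N (\<lambda>x. \<Sum>k<n. W \<phi> k g x / z ^ Suc k) \<le> K / (cmod z - s) * N g"
      using Lp_sum[OF p_ge_1, of "{..<n}" "\<lambda>k x. W \<phi> k g x / z ^ Suc k" \<mu>]
        nsb(2)[OF g] nsb(3)[OF g, of n] by auto
    have "N (\<lambda>x. inverse (z ^ n) * W \<phi> n f x) \<le> cmod (inverse (z ^ n)) * N (W \<phi> n f)"
      by (intro Lp_cmult(2)[OF p_pos] nsb(1)[OF f])
    also have "\<dots> \<le> cmod (inverse (z ^ n)) * (K * s ^ n * N f)"
      using K(2) f by (intro mult_left_mono) auto
    also have "\<dots> = K * (s / cmod z) ^ n * N f"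
      by (simp add: norm_inverse norm_power power_divide divide_inverse mult_ac
          power_mult_distrib power_inverse)
    also have "\<dots> \<le> 1 / 2 * N f"
      using n by (intro mult_right_mono) auto
    finally have 2: "N (\<lambda>x. inverse (z ^ n) * W \<phi> n f x) \<le> 1 / 2 * N f" .
    have "N f = N (\<lambda>x. (\<Sum>k<n. W \<phi> k g x / z ^ Suc k) + inverse (z ^ n) * W \<phi> n f x)"
      by (rule arg_cong[OF eq])
    also have "\<dots> \<le> N (\<lambda>x. \<Sum>k<n. W \<phi> k g x / z ^ Suc k) + N (\<lambda>x. inverse (z ^ n) * W \<phi> n f x)"
      by (intro Lp_minkowski(2)[OF p_ge_1 1(1)] Lp_cmult(1)[OF p_pos] nsb(1)[OF f])
    finally have "N f \<le> 2 * (K / (cmod z - s) * N g)"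
      using 1(2) 2 by linarith
    moreover have "g = (\<lambda>x. z * f x - A \<phi> f x)"
      by (rule ext) (rule g_def)
    ultimately show ?thesis
      by (simp add: mult.assoc)
  qed
  ultimately show ?thesis
    unfolding Lp_resolvent_set_def by blast
qed

subsection \<open>The spectral radius\<close>

text \<open>This replaces the analytic argument in Gelfand's formula by positivity. Suppose \<open>\<rho> - A\<close> is bounded
  below. For \<open>g \<ge> 0\<close> and \<open>z\<close> slightly above \<open>\<rho>\<close>, the truncated Neumann series at \<open>z\<close> is almost mapped
  to \<open>g\<close> by \<open>\<rho> - A\<close>, hence bounded by a constant multiple of the norm of \<open>g\<close>, uniformly in
  the truncation; for \<open>z\<close> close enough to \<open>\<rho>\<close> this carries over to \<open>\<rho>\<close>. Applying the truncated series
  twice produces the term \<open>A\<^sup>n\<^sup>-\<^sup>1 g / \<rho>\<^sup>n\<^sup>+\<^sup>1\<close> in \<open>n\<close> ways, so \<open>n\<close> times its norm stays bounded. Then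
  some power of \<open>A\<close> has norm at most \<open>\<rho>\<^sup>m / 2\<close>, and \<open>\<rho>\<close> is not the infimum of the growth rates.\<close>

lemma growth_rate_in_spectrum:
  fixes \<phi> :: "'a \<Rightarrow>\<^sub>C real"
  assumes \<rho>_def: "\<rho> = Inf (G \<phi>)" and \<rho>: "\<rho> > 0"
  shows "complex_of_real \<rho> \<in> Lp_spectrum p \<mu> (A \<phi>)"
proof (rule ccontr)
  assume "complex_of_real \<rho> \<notin> Lp_spectrum p \<mu> (A \<phi>)"
  then obtain C0 where C0: "\<forall>f \<in> Lp p \<mu>. N f \<le> C0 * N (\<lambda>x. complex_of_real \<rho> * f x - A \<phi> f x)"
    by (auto simp: Lp_spectrum_def Lp_resolvent_set_def)
  define C where "C = max C0 1"
  have C: "C > 0" "\<And>f. f \<in> Lp p \<mu> \<Longrightarrow> N f \<le> C * N (\<lambda>x. complex_of_real \<rho> * f x - A \<phi> f x)"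
    using C0 by (auto simp: C_def intro!: order_trans[OF bspec[OF C0] mult_right_mono])
  define P where "P n z g x = (\<Sum>k<n. W \<phi> k g x / complex_of_real z ^ Suc k)" for n z g x
  have P_Lp: "P n z g \<in> Lp p \<mu>" if "g \<in> Lp p \<mu>" for n z g
  proof -
    have "(\<lambda>x. \<Sum>k<n. inverse (complex_of_real z ^ Suc k) * W \<phi> k g x) \<in> Lp p \<mu>"
      using that by (intro Lp_sum[OF p_ge_1, THEN conjunct1] Lp_cmult(1)[OF p_pos] Lp_weighted_comp_power) auto
    then show ?thesis
      by (simp add: P_def[abs_def] divide_inverse mult.commute)
  qed
  define nonneg :: "('a \<Rightarrow> complex) \<Rightarrow> bool" where "nonneg g \<longleftrightarrow> (\<forall>x. g x = complex_of_real (cmod (g x)))" for g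
  have W_nonneg: "W \<phi> k g x = complex_of_real (cmod (W \<phi> k g x))" if "nonneg g" for k g x
  proof -
    have "g ((\<alpha> ^^ k) x) = complex_of_real (cmod (g ((\<alpha> ^^ k) x)))"
      using that unfolding nonneg_def by blast
    then show ?thesis
      unfolding cmod_weighted_comp_power by (simp add: weighted_comp_power_def)
  qed
  have P_of_real: "P n z g x = complex_of_real (\<Sum>k<n. cmod (W \<phi> k g x) / z ^ Suc k)" if "nonneg g" for n z g x
    unfolding P_def of_real_sum of_real_divide of_real_power using W_nonneg[OF that] by simp
  have P_cmod: "cmod (P n z g x) = (\<Sum>k<n. cmod (W \<phi> k g x) / z ^ Suc k)" if "nonneg g" "z > 0" for n z g x
  proof -
    have "0 \<le> (\<Sum>k<n. cmod (W \<phi> k g x) / z ^ Suc k)"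
      using that(2) by (intro sum_nonneg) auto
    then show ?thesis unfolding P_of_real[OF that(1)] norm_of_real by simp
  qed
  have P_nonneg: "nonneg (P n z g)" if "nonneg g" "z > 0" for n z g
    unfolding nonneg_def P_cmod[OF that] using P_of_real[OF that(1)] by simp
  have growth: "\<exists>s\<in>G \<phi>. s < z" if "z > \<rho>" for z
  proof (rule ccontr)
    assume "\<not> (\<exists>s\<in>G \<phi>. s < z)"
    then have "z \<le> \<rho>"
      unfolding \<rho>_def using exp_norm_in_growth_rates[of \<phi>] by (intro cInf_greatest) auto
    with that show False by simp
  qed
  \<comment> \<open>The lower bound at \<open>\<rho>\<close> controls the truncated Neumann series at points slightly above \<open>\<rho>\<close>.\<close>
  have above: "N (P n z g) \<le> 4 * C * N g"
    if g: "g \<in> Lp p \<mu>" "nonneg g" and z: "\<rho> < z" "z \<le> \<rho> + 1 / (2 * C)" for n z g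
  proof -
    have z0: "z > 0" using z \<rho> by simp
    obtain s where s: "s \<in> G \<phi>" "s < z" using growth[OF z(1)] by blast
    then obtain K where K: "K \<ge> 0" "\<forall>n. \<forall>g\<in>Lp p \<mu>. N (W \<phi> n g) \<le> K * s ^ n * N g"
      by (auto simp: growth_rates_def)
    have s0: "s > 0" using s by (simp add: growth_rates_def)
    have "(\<lambda>m. K * (s / z) ^ m) \<longlonglongrightarrow> K * 0"
      using s0 s(2) z0 by (intro tendsto_intros LIMSEQ_power_zero) (simp add: divide_less_eq)
    then have "\<forall>\<^sub>F m in sequentially. K * (s / z) ^ m < 1"
      by (rule order_tendstoD(2)) auto
    then have "\<forall>\<^sub>F m in sequentially. K * (s / z) ^ m < 1 \<and> n \<le> m"
      using eventually_ge_at_top[of n] by eventually_elim auto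
    then obtain m where m: "K * (s / z) ^ m < 1" "n \<le> m"
      using eventually_happens[of _ sequentially] by auto
    define f where "f = P m z g"
    have f: "f \<in> Lp p \<mu>" unfolding f_def by (rule P_Lp[OF g(1)])
    define r where "r x = inverse (complex_of_real z ^ m) * W \<phi> m g x" for x
    have r: "r \<in> Lp p \<mu>" "N r \<le> N g"
    proof -
      show "r \<in> Lp p \<mu>"
        unfolding r_def by (intro Lp_cmult(1)[OF p_pos] Lp_weighted_comp_power g)
      have "N r \<le> cmod (inverse (complex_of_real z ^ m)) * N (W \<phi> m g)"
        unfolding r_def by (intro Lp_cmult(2)[OF p_pos] Lp_weighted_comp_power g)
      also have "\<dots> \<le> cmod (inverse (complex_of_real z ^ m)) * (K * s ^ m * N g)"
        using K(2) g by (intro mult_left_mono) auto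
      also have "\<dots> = K * (s / z) ^ m * N g"
        using z0 by (simp add: norm_inverse norm_power power_divide divide_inverse mult_ac
            power_mult_distrib power_inverse)
      also have "\<dots> \<le> 1 * N g"
        using m by (intro mult_right_mono) auto
      finally show "N r \<le> N g" by simp
    qed
    have "complex_of_real z * f x - A \<phi> f x = g x - r x" for x
      using neumann_partial_sum[where z="complex_of_real z" and f=f and n=m and \<alpha>=\<alpha>
          and \<phi>="apply_bcontfun \<phi>" and g=g and x=x] z0
      by (simp add: f_def P_def[abs_def] r_def divide_inverse mult.commute)
    then have eq: "complex_of_real \<rho> * f x - A \<phi> f x = (g x - r x) - complex_of_real (z - \<rho>) * f x" for x
      by (simp add: algebra_simps)
    have "N f \<le> C * N (\<lambda>x. complex_of_real \<rho> * f x - A \<phi> f x)"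
      by (rule C(2)[OF f])
    also have "\<dots> \<le> C * ((N g + N r) + cmod (complex_of_real (z - \<rho>)) * N f)"
    proof (intro mult_left_mono)
      have "N (\<lambda>x. (g x - r x) - complex_of_real (z - \<rho>) * f x)
          \<le> N (\<lambda>x. g x - r x) + N (\<lambda>x. complex_of_real (z - \<rho>) * f x)"
        by (intro Lp_diff(2)[OF p_ge_1] Lp_diff(1)[OF p_ge_1] g r Lp_cmult(1)[OF p_pos] f)
      also have "\<dots> \<le> (N g + N r) + cmod (complex_of_real (z - \<rho>)) * N f"
        by (intro add_mono Lp_diff(2)[OF p_ge_1] Lp_cmult(2)[OF p_pos] g r f)
      finally show "N (\<lambda>x. complex_of_real \<rho> * f x - A \<phi> f x)
          \<le> (N g + N r) + cmod (complex_of_real (z - \<rho>)) * N f"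
        unfolding eq .
    qed (use C in auto)
    also have "\<dots> \<le> C * (2 * N g + 1 / (2 * C) * N f)"
    proof -
      have "cmod (complex_of_real (z - \<rho>)) \<le> 1 / (2 * C)"
        unfolding norm_of_real using z by simp
      then have "cmod (complex_of_real (z - \<rho>)) * N f \<le> 1 / (2 * C) * N f"
        by (rule mult_right_mono) simp
      then show ?thesis
        using r(2) C(1) by (intro mult_left_mono) auto
    qed
    also have "\<dots> = 2 * C * N g + N f / 2"
      using C by (simp add: field_simps)
    finally have Nf: "N f \<le> 4 * C * N g"
      by simp
    have "cmod (P n z g x) \<le> 1 * cmod (f x)" for x
      unfolding f_def P_cmod[OF g(2) z0] mult_1 using m(2) z0 by (intro sum_mono2) auto
    moreover have "P n z g \<in> borel_measurable \<mu>"
      using P_Lp[OF g(1)] by (simp add: Lp_def)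
    ultimately have "N (P n z g) \<le> 1 * N f"
      using f by (intro Lp_dominated(2)[OF p_pos]) auto
    with Nf show ?thesis by simp
  qed
  define D where "D = 8 * C"
  have at_rho: "N (P n \<rho> g) \<le> D * N g" if g: "g \<in> Lp p \<mu>" "nonneg g" for n g
  proof -
    define \<delta> where "\<delta> = min (ln 2 / (real n + 1)) (1 / (2 * C * \<rho>))"
    have \<delta>: "\<delta> > 0" "\<delta> \<le> ln 2 / (real n + 1)" "\<delta> \<le> 1 / (2 * C * \<rho>)"
      using C(1) \<rho> by (auto simp: \<delta>_def)
    \<comment> \<open>Close enough to \<open>\<rho>\<close> for the previous bound, and so close that the first \<open>n\<close> coefficients
      change by a factor of at most 2.\<close>
    define z where "z = \<rho> * (1 + \<delta>)"
    have z: "\<rho> < z" "z \<le> \<rho> + 1 / (2 * C)"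
      using \<rho> \<delta> C(1) by (auto simp: z_def field_simps)
    have "(z / \<rho>) ^ n \<le> exp \<delta> ^ n"
      using \<rho> \<delta>(1) exp_ge_add_one_self[of \<delta>] by (intro power_mono) (auto simp: z_def)
    also have "\<dots> = exp (real n * \<delta>)"
      by (simp add: exp_of_nat_mult)
    also have "real n * \<delta> \<le> (real n + 1) * \<delta>"
      using \<delta>(1) by simp
    also have "\<dots> \<le> ln 2"
      using \<delta>(2) by (simp add: field_simps)
    finally have ratio: "(z / \<rho>) ^ n \<le> 2"
      by simp
    have "cmod (P n \<rho> g x) \<le> 2 * cmod (P n z g x)" for x
    proof -
      have "cmod (W \<phi> k g x) / \<rho> ^ Suc k \<le> 2 * (cmod (W \<phi> k g x) / z ^ Suc k)" if "k < n" for k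
      proof -
        have "(z / \<rho>) ^ Suc k \<le> (z / \<rho>) ^ n"
          using that z \<rho> by (intro power_increasing) auto
        then have "(z / \<rho>) ^ Suc k \<le> 2" using ratio by linarith
        then have "z ^ Suc k \<le> 2 * \<rho> ^ Suc k"
          using \<rho> unfolding power_divide by (subst (asm) pos_divide_le_eq) auto
        then have "cmod (W \<phi> k g x) * z ^ Suc k \<le> cmod (W \<phi> k g x) * (2 * \<rho> ^ Suc k)"
          by (rule mult_left_mono) simp
        moreover have "0 < z ^ Suc k" "0 < \<rho> ^ Suc k"
          using z \<rho> by simp_all
        ultimately show ?thesis
          by (simp add: field_simps del: power_Suc)
      qed
      moreover have "z > 0" using z \<rho> by simp
      ultimately show ?thesis
        unfolding P_cmod[OF g(2) \<rho>] by (subst P_cmod[OF g(2)]) (auto simp: sum_distrib_left intro!: sum_mono)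
    qed
    moreover have "P n \<rho> g \<in> borel_measurable \<mu>"
      using P_Lp[OF g(1)] by (simp add: Lp_def)
    ultimately have "N (P n \<rho> g) \<le> 2 * N (P n z g)"
      using P_Lp[OF g(1)] by (intro Lp_dominated(2)[OF p_pos]) auto
    also have "\<dots> \<le> D * N g"
      using above[OF g z, of n] by (simp add: D_def mult.assoc)
    finally show ?thesis .
  qed
  \<comment> \<open>By positivity the square of the truncated series dominates \<open>n\<close> times a single power.\<close>
  have square: "real n * N (W \<phi> (n - 1) g) \<le> D\<^sup>2 * \<rho> ^ Suc n * N g"
    if g: "g \<in> Lp p \<mu>" "nonneg g" and n: "n > 0" for n g
  proof -
    define f where "f = P n \<rho> g"
    have f: "f \<in> Lp p \<mu>" "nonneg f"
      unfolding f_def using P_Lp[OF g(1)] P_nonneg[OF g(2) \<rho>] by auto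
    have "cmod (W \<phi> (n - 1) g x) \<le> \<rho> ^ Suc n / real n * cmod (P n \<rho> f x)" for x
    proof -
      have "real n * (cmod (W \<phi> (n - 1) g x) / \<rho> ^ Suc n)
          = (\<Sum>k<n. cmod (W \<phi> (n - 1) g x) / \<rho> ^ Suc n)"
        by simp
      also have "\<dots> \<le> (\<Sum>k<n. cmod (W \<phi> k f x) / \<rho> ^ Suc k)"
      proof (intro sum_mono)
        fix k assume "k \<in> {..<n}"
        then have k: "k < n" by simp
        have "cmod (W \<phi> (n - 1) g x) / \<rho> ^ (n - k)
            = exp (birkhoff_sum \<alpha> \<phi> k x) * (cmod (W \<phi> (n - 1 - k) g ((\<alpha> ^^ k) x)) / \<rho> ^ Suc (n - 1 - k))"
        proof -
          have "W \<phi> (n - 1) g x = W \<phi> k (W \<phi> (n - 1 - k) g) x"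
            using k by (simp add: weighted_comp_power_add)
          moreover have "Suc (n - 1 - k) = n - k" using k by simp
          ultimately show ?thesis
            by (simp add: cmod_weighted_comp_power[of _ _ k])
        qed
        also have "\<dots> \<le> exp (birkhoff_sum \<alpha> \<phi> k x) * cmod (f ((\<alpha> ^^ k) x))"
          unfolding f_def P_cmod[OF g(2) \<rho>] using k \<rho>
          by (intro mult_left_mono member_le_sum) auto
        also have "\<dots> = cmod (W \<phi> k f x)"
          by (simp add: cmod_weighted_comp_power)
        finally have "cmod (W \<phi> (n - 1) g x) / \<rho> ^ (n - k) / \<rho> ^ Suc k \<le> cmod (W \<phi> k f x) / \<rho> ^ Suc k"
          using \<rho> by (intro divide_right_mono) auto
        moreover have "\<rho> ^ (n - k) * \<rho> ^ Suc k = \<rho> ^ Suc n"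
          using k by (simp add: power_add[symmetric])
        ultimately show "cmod (W \<phi> (n - 1) g x) / \<rho> ^ Suc n \<le> cmod (W \<phi> k f x) / \<rho> ^ Suc k"
          by (simp only: divide_divide_eq_left)
      qed
      also have "\<dots> = cmod (P n \<rho> f x)"
        by (simp only: P_cmod[OF f(2) \<rho>])
      finally have le: "real n * (cmod (W \<phi> (n - 1) g x) / \<rho> ^ Suc n) \<le> cmod (P n \<rho> f x)" .
      have pos: "0 < real n" "0 < \<rho> ^ Suc n" using n \<rho> by simp_all
      show ?thesis
        using mult_left_mono[OF le, of "\<rho> ^ Suc n / real n"] pos \<rho> by (simp del: power_Suc)
    qed
    then have "N (W \<phi> (n - 1) g) \<le> \<rho> ^ Suc n / real n * N (P n \<rho> f)"
      using P_Lp[OF f(1)] weighted_comp_power_measurable[OF g(1)] \<rho>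
      by (intro Lp_dominated(2)[OF p_pos]) auto
    also have "\<dots> \<le> \<rho> ^ Suc n / real n * (D * (D * N g))"
    proof (intro mult_left_mono)
      have "N (P n \<rho> f) \<le> D * N f" by (rule at_rho[OF f])
      also have "\<dots> \<le> D * (D * N g)"
        unfolding f_def using at_rho[OF g] C(1) by (intro mult_left_mono) (auto simp: D_def)
      finally show "N (P n \<rho> f) \<le> D * (D * N g)" .
    qed (use \<rho> in auto)
    finally have le: "N (W \<phi> (n - 1) g) \<le> \<rho> ^ Suc n / real n * (D * (D * N g))" .
    show ?thesis
      using mult_left_mono[OF le, of "real n"] n by (simp add: power2_eq_square mult_ac)
  qed
  \<comment> \<open>Large enough for the factor \<open>D\<^sup>2 \<rho>\<^sup>2 / (m + 1)\<close> of \<open>\<rho>\<^sup>m\<close> to be at most one half.\<close>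
  obtain m :: nat where m: "m > 0" "2 * D\<^sup>2 * \<rho>\<^sup>2 \<le> real m"
  proof -
    obtain k :: nat where "2 * D\<^sup>2 * \<rho>\<^sup>2 \<le> real k"
      using real_arch_simple by blast
    then show ?thesis using that[of "Suc k"] by simp
  qed
  define s where "s = \<rho> * root m (1/2)"
  have s: "s > 0" "s < \<rho>" "s ^ m = \<rho> ^ m / 2"
    using \<rho> m by (auto simp: s_def power_mult_distrib real_root_lt_1_iff)
  have "N (W \<phi> m g) \<le> s ^ m * N g" if g: "g \<in> Lp p \<mu>" for g
  proof -
    define g' where "g' x = complex_of_real (cmod (g x))" for x
    have g': "g' \<in> Lp p \<mu>" "nonneg g'" "N g' = N g"
      using g by (auto simp: Lp_def Lp_norm_def g'_def[abs_def] nonneg_def)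
    have "N (W \<phi> m g) = N (W \<phi> m g')"
      unfolding Lp_norm_def by (simp add: cmod_weighted_comp_power g'_def)
    moreover have "real (Suc m) * N (W \<phi> m g') \<le> D\<^sup>2 * \<rho> ^ Suc (Suc m) * N g'"
      using square[OF g'(1,2), of "Suc m"] by simp
    ultimately have 1: "real (Suc m) * N (W \<phi> m g) \<le> (D\<^sup>2 * \<rho>\<^sup>2) * (\<rho> ^ m * N g)"
      using g'(3) by (simp add: power2_eq_square mult_ac)
    also have "\<dots> \<le> real m / 2 * (\<rho> ^ m * N g)"
      using m(2) \<rho> by (intro mult_right_mono) auto
    also have "\<dots> \<le> real (Suc m) / 2 * (\<rho> ^ m * N g)"
      using \<rho> by (intro mult_right_mono) auto
    finally have "real (Suc m) * N (W \<phi> m g) \<le> real (Suc m) * (\<rho> ^ m / 2 * N g)"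
      by simp
    then show ?thesis
      unfolding s(3) by (subst (asm) mult_le_cancel_left_pos) auto
  qed
  then have "s \<in> G \<phi>"
    by (rule growth_rates_of_power[OF s(1) m(1)])
  then have "\<rho> \<le> s"
    unfolding \<rho>_def by (intro cInf_lower bdd_belowI[of _ 0]) (auto simp: growth_rates_def)
  with s(2) show False by simp
qed

lemma spectral_radius_eq_growth_rate:
  fixes \<phi> :: "'a \<Rightarrow>\<^sub>C real"
  assumes pos: "Inf (G \<phi>) > 0"
  shows "Lp_spectral_radius p \<mu> (A \<phi>) = Inf (G \<phi>)"
proof -
  have "cmod z \<le> Inf (G \<phi>)" if "z \<in> Lp_spectrum p \<mu> (A \<phi>)" for z
  proof (rule ccontr)
    assume "\<not> cmod z \<le> Inf (G \<phi>)"
    then obtain s where "s \<in> G \<phi>" "s < cmod z"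
      using cInf_lessD[of "G \<phi>" "cmod z"] exp_norm_in_growth_rates[of \<phi>] by auto
    then have "z \<in> Lp_resolvent_set p \<mu> (A \<phi>)"
      by (rule resolvent_outside_growth_rate)
    with that show False by (simp add: Lp_spectrum_def)
  qed
  moreover have "Inf (G \<phi>) \<in> cmod ` Lp_spectrum p \<mu> (A \<phi>)"
    using growth_rate_in_spectrum[OF refl pos] pos by (intro image_eqI) auto
  ultimately show ?thesis
    unfolding Lp_spectral_radius_def by (intro cSup_eq_maximum) auto
qed

subsection \<open>Properties of the spectral exponent\<close>

text \<open>Let \<open>B\<close> have positive finite measure. The set \<open>\<alpha>\<^sup>-\<^sup>n(B)\<close> has the same measure, and the \<open>n\<close>-th power
  of the operator, applied to the indicator of \<open>B\<close>, is \<open>exp(S\<^sub>n\<phi>)\<close> there. By Jensen's inequality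
  the logarithm of its norm is at least the average of \<open>S\<^sub>n\<phi>\<close> over \<open>\<alpha>\<^sup>-\<^sup>n(B)\<close>, up to a constant that
  does not depend on \<open>n\<close>. Divided by \<open>n\<close>, these averages are linear in \<open>\<phi>\<close> and bounded by the norm
  of \<open>\<phi>\<close>, so they have a cluster point.\<close>

lemma functional_of_averages:
  obtains \<nu>\<^sub>0 :: "('a \<Rightarrow>\<^sub>C real) \<Rightarrow>\<^sub>L real" where "\<And>\<phi> s. s \<in> G \<phi> \<Longrightarrow> \<nu>\<^sub>0 \<phi> \<le> ln s"
proof -
  obtain B where B: "B \<in> sets \<mu>" "0 < emeasure \<mu> B" "emeasure \<mu> B < \<infinity>"
    using finite_positive_set by blast
  define b where "b = measure \<mu> B"
  have b1: "emeasure \<mu> B = ennreal b"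
    unfolding b_def using B(3) by (intro emeasure_eq_ennreal_measure) simp
  have "b > 0"
    using B(2) unfolding b1 by simp
  note b = b1 this
  have [simp]: "space \<mu> = UNIV"
    using sets_eq_imp_space_eq[OF sets_eq] by simp
  define C where "C n = (\<alpha> ^^ n) -` B" for n
  have C_sets [measurable]: "C n \<in> sets \<mu>" for n
    using measurable_sets[OF measurable_funpow, of B n] B sets_eq by (simp add: C_def)
  have C_emeasure: "emeasure \<mu> (C n) = ennreal b" for n
  proof -
    have "emeasure \<mu> B = emeasure (distr \<mu> borel (\<alpha> ^^ n)) B"
      by (simp add: distr_funpow)
    also have "\<dots> = emeasure \<mu> (C n)"
      using B sets_eq by (subst emeasure_distr) (auto simp: C_def)
    finally show ?thesis using b by simp
  qed
  have C_int: "integrable \<mu> (indicator (C n) :: 'a \<Rightarrow> real)" for n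
    using C_emeasure[of n] by (intro integrable_real_indicator) auto
  have C_measure: "measure \<mu> (C n) = b" for n
    using C_emeasure[of n] b by (simp add: measure_def)
  let ?S = "\<lambda>\<phi> n x. birkhoff_sum \<alpha> (apply_bcontfun \<phi>) n x"
  have S_int: "integrable \<mu> (\<lambda>x. indicator (C n) x * ?S \<phi> n x)" for n \<phi>
  proof (rule Bochner_Integration.integrable_bound[where f="\<lambda>x. real n * norm \<phi> * indicator (C n) x"])
    show "integrable \<mu> (\<lambda>x. real n * norm \<phi> * indicator (C n) x)"
      using C_int by simp
    show "AE x in \<mu>. norm (indicator (C n) x * ?S \<phi> n x) \<le> norm (real n * norm \<phi> * indicator (C n) x)"
      using birkhoff_sum_abs_le[of \<phi> n] by (auto simp: indicator_def)
  qed measurable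
  define a where "a n \<phi> = (\<integral>x. indicator (C n) x * ?S \<phi> n x \<partial>\<mu>) / b" for n and \<phi> :: "'a \<Rightarrow>\<^sub>C real"
  have a_add: "a n (\<phi> + \<psi>) = a n \<phi> + a n \<psi>" for n \<phi> \<psi>
  proof -
    have "indicator (C n) x * ?S (\<phi> + \<psi>) n x = indicator (C n) x * ?S \<phi> n x + indicator (C n) x * ?S \<psi> n x" for x
      by (simp add: birkhoff_sum_def sum.distrib distrib_left)
    then show ?thesis
      using S_int by (simp add: a_def add_divide_distrib)
  qed
  have a_scale: "a n (r *\<^sub>R \<phi>) = r * a n \<phi>" for n r \<phi>
  proof -
    have "?S (r *\<^sub>R \<phi>) n x = r * ?S \<phi> n x" for x
      by (simp add: birkhoff_sum_def sum_distrib_left)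
    then have eq: "(\<lambda>x. indicator (C n) x * ?S (r *\<^sub>R \<phi>) n x) = (\<lambda>x. r * (indicator (C n) x * ?S \<phi> n x))"
      by (simp only: mult.left_commute)
    show ?thesis unfolding a_def eq by simp
  qed
  have a_bound: "\<bar>a n \<phi>\<bar> \<le> real n * norm \<phi>" for n \<phi>
  proof -
    have "\<bar>\<integral>x. indicator (C n) x * ?S \<phi> n x \<partial>\<mu>\<bar> \<le> (\<integral>x. \<bar>indicator (C n) x * ?S \<phi> n x\<bar> \<partial>\<mu>)"
      by (rule integral_abs_bound)
    also have "\<dots> \<le> (\<integral>x. real n * norm \<phi> * indicator (C n) x \<partial>\<mu>)"
    proof (rule integral_mono)
      show "integrable \<mu> (\<lambda>x. \<bar>indicator (C n) x * ?S \<phi> n x\<bar>)"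
        by (intro integrable_abs S_int)
      show "integrable \<mu> (\<lambda>x. real n * norm \<phi> * indicator (C n) x)"
        using C_int by simp
      show "\<bar>indicator (C n) x * ?S \<phi> n x\<bar> \<le> real n * norm \<phi> * indicator (C n) x" for x
        using birkhoff_sum_abs_le[of \<phi> n x] by (auto simp: indicator_def)
    qed
    also have "\<dots> = real n * norm \<phi> * b"
      by (simp add: C_measure)
    finally show ?thesis
      using b by (simp add: a_def abs_divide divide_le_eq)
  qed
  have a_growth: "a n \<phi> \<le> ln (K + 1) + real n * ln s"
    if s: "s > 0" and K: "K \<ge> 0" "\<forall>n. \<forall>g\<in>Lp p \<mu>. N (W \<phi> n g) \<le> K * s ^ n * N g"
    for n s K and \<phi> :: "'a \<Rightarrow>\<^sub>C real"
  proof -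
    define g :: "'a \<Rightarrow> complex" where "g = (\<lambda>x. of_bool (x \<in> B))"
    have cg: "cmod (g x) powr p = indicator B x" for x
      by (simp add: g_def)
    have iB: "integrable \<mu> (indicator B :: 'a \<Rightarrow> real)"
      using B by (intro integrable_real_indicator) auto
    have g: "g \<in> Lp p \<mu>"
    proof -
      have "Measurable.pred \<mu> (\<lambda>x. x \<in> B)" using B(1) by simp
      then have "g \<in> borel_measurable \<mu>" unfolding g_def by measurable
      then show ?thesis using iB by (simp add: Lp_def cg)
    qed
    have Ng: "N g powr p = b"
      using p_pos B(1) by (simp add: Lp_norm_powr cg b_def)
    define c where "c = a n \<phi>"
    have W: "cmod (W \<phi> n g x) powr p = indicator (C n) x * exp (p * ?S \<phi> n x)" for x
      by (simp add: cmod_weighted_comp_power g_def C_def indicator_def powr_def)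
    have iW: "integrable \<mu> (\<lambda>x. indicator (C n) x * exp (p * ?S \<phi> n x))"
      using Lp_weighted_comp_power(1)[OF g, of \<phi> n] by (simp add: Lp_def W)
    \<comment> \<open>Jensen's inequality for the exponential, as the tangent at the average \<open>c\<close>.\<close>
    let ?tangent = "\<lambda>x. exp (p * c) * ((1 - p * c) * indicator (C n) x + p * (indicator (C n) x * ?S \<phi> n x))"
    have "exp (p * c) * b = exp (p * c) * ((1 - p * c) * b + p * (c * b))"
      by (simp add: algebra_simps)
    also have "\<dots> = (\<integral>x. ?tangent x \<partial>\<mu>)"
      using S_int[of n \<phi>] C_int[of n] b by (simp add: C_measure c_def a_def)
    also have "\<dots> \<le> (\<integral>x. indicator (C n) x * exp (p * ?S \<phi> n x) \<partial>\<mu>)"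
    proof (rule integral_mono[OF _ iW])
      show "integrable \<mu> ?tangent"
        using S_int[of n \<phi>] C_int[of n] by simp
      fix x
      have "1 + (p * ?S \<phi> n x - p * c) \<le> exp (p * ?S \<phi> n x - p * c)"
        by (rule exp_ge_add_one_self)
      then have "exp (p * c) * (1 + (p * ?S \<phi> n x - p * c)) \<le> exp (p * c) * exp (p * ?S \<phi> n x - p * c)"
        by (rule mult_left_mono) simp
      then have "exp (p * c) * (1 - p * c + p * ?S \<phi> n x) \<le> exp (p * ?S \<phi> n x)"
        by (simp add: exp_diff algebra_simps)
      then show "?tangent x \<le> indicator (C n) x * exp (p * ?S \<phi> n x)"
        by (simp add: indicator_def)
    qed
    also have "\<dots> = N (W \<phi> n g) powr p"
      using p_pos by (simp add: Lp_norm_powr W)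
    also have "\<dots> \<le> (K * s ^ n * N g) powr p"
      using K(2) g p_pos by (intro powr_mono2) auto
    also have "\<dots> \<le> ((K + 1) * s ^ n * N g) powr p"
      using K(1) s p_pos by (intro powr_mono2 mult_right_mono) auto
    also have "\<dots> = ((K + 1) * s ^ n) powr p * b"
      by (simp add: powr_mult Ng)
    finally have le: "exp (p * c) \<le> ((K + 1) * s ^ n) powr p"
      using b by simp
    have pos: "(K + 1) * s ^ n > 0" using K(1) s by simp
    have "p * c \<le> p * ln ((K + 1) * s ^ n)"
      using le K(1) s unfolding powr_def by (simp split: if_splits)
    then have "c \<le> ln ((K + 1) * s ^ n)"
      using p_pos by simp
    also have "\<dots> = ln (K + 1) + real n * ln s"
      using K(1) s by (simp add: ln_mult ln_realpow)
    finally show ?thesis by (simp add: c_def)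
  qed
  \<comment> \<open>By Tychonoff's theorem the averages have a cluster point for pointwise convergence.\<close>
  define v where "v n \<phi> = a (Suc n) \<phi> / real (Suc n)" for n and \<phi> :: "'a \<Rightarrow>\<^sub>C real"

  let ?X = "PiE UNIV (\<lambda>\<phi> :: 'a \<Rightarrow>\<^sub>C real. {- norm \<phi>..norm \<phi>})"
  have "compactin (product_topology (\<lambda>_. euclidean) UNIV) ?X"
    by (subst compactin_PiE) auto
  then have comp: "compact ?X"
    by (simp add: euclidean_product_topology)
  have v_in: "v n \<in> ?X" for n
  proof (rule PiE_I)
    fix \<phi> :: "'a \<Rightarrow>\<^sub>C real"
    have "\<bar>v n \<phi>\<bar> \<le> norm \<phi>"
      using a_bound[of "Suc n" \<phi>] by (simp add: v_def abs_divide divide_le_eq mult.commute del: of_nat_Suc)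
    then show "v n \<phi> \<in> {- norm \<phi>..norm \<phi>}" by auto
  qed simp
  obtain L where L: "L \<in> ?X" "inf (nhds L) (filtermap v sequentially) \<noteq> bot"
    using comp[unfolded compact_filter, rule_format, of "filtermap v sequentially"] v_in
    by (auto simp: eventually_filtermap filtermap_bot_iff)
  define F where "F = inf (nhds L) (filtermap v sequentially)"
  have F: "F \<noteq> bot" using L by (simp add: F_def)
  have lim: "((\<lambda>f. f \<phi>) \<longlongrightarrow> L \<phi>) F" for \<phi>
  proof -
    have "((\<lambda>f. f \<phi>) \<longlongrightarrow> L \<phi>) (nhds L)"
    proof (rule topological_tendstoI)
      fix U :: "real set" assume U: "open U" "L \<phi> \<in> U"
      have "open ((\<lambda>f. f \<phi>) -` U)"
        by (rule open_vimage[OF U(1) continuous_on_product_coordinates])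
      then show "\<forall>\<^sub>F f in nhds L. f \<phi> \<in> U"
        unfolding eventually_nhds using U(2) by blast
    qed
    then show ?thesis
      by (rule tendsto_mono[rotated]) (simp add: F_def)
  qed
  have evF: "eventually P F" if "\<forall>\<^sub>F n in sequentially. P (v n)" for P
    using that unfolding F_def by (intro filter_leD[OF inf_le2]) (simp add: eventually_filtermap)
  have L_add: "L (\<phi> + \<psi>) = L \<phi> + L \<psi>" for \<phi> \<psi>
  proof (rule tendsto_unique[OF F])
    show "((\<lambda>f. f \<phi> + f \<psi>) \<longlongrightarrow> L \<phi> + L \<psi>) F"
      by (intro tendsto_add lim)
    show "((\<lambda>f. f \<phi> + f \<psi>) \<longlongrightarrow> L (\<phi> + \<psi>)) F"
      by (rule Lim_transform_eventually[OF lim[of "\<phi> + \<psi>"]], rule evF)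
         (simp add: v_def a_add add_divide_distrib)
  qed
  have L_scale: "L (r *\<^sub>R \<phi>) = r * L \<phi>" for r \<phi>
  proof (rule tendsto_unique[OF F])
    show "((\<lambda>f. r * f \<phi>) \<longlongrightarrow> r * L \<phi>) F"
      by (intro tendsto_mult_left lim)
    show "((\<lambda>f. r * f \<phi>) \<longlongrightarrow> L (r *\<^sub>R \<phi>)) F"
      by (rule Lim_transform_eventually[OF lim[of "r *\<^sub>R \<phi>"]], rule evF)
         (simp add: v_def a_scale)
  qed
  have L_bound: "\<bar>L \<phi>\<bar> \<le> norm \<phi>" for \<phi>
    using L(1) by (auto simp: PiE_iff abs_le_iff) (metis minus_le_iff)
  have bl: "bounded_linear L"
    by (rule bounded_linear_intro[where K=1]) (auto simp: L_add L_scale L_bound)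
  have L_growth: "L \<phi> \<le> ln s" if s: "s \<in> G \<phi>" for \<phi> s
  proof -
    obtain K where K: "K \<ge> 0" "\<forall>n. \<forall>g\<in>Lp p \<mu>. N (W \<phi> n g) \<le> K * s ^ n * N g" and s0: "s > 0"
      using s by (auto simp: growth_rates_def)
    show ?thesis
    proof (rule field_le_epsilon)
      fix e :: real assume e: "e > 0"
      have "(\<lambda>n. ln (K + 1) * inverse (real (Suc n))) \<longlonglongrightarrow> ln (K + 1) * 0"
        by (intro tendsto_mult_left LIMSEQ_inverse_real_of_nat)
      then have "\<forall>\<^sub>F n in sequentially. ln (K + 1) * inverse (real (Suc n)) < e"
        by (rule order_tendstoD(2)) (use e in simp)
      then have "\<forall>\<^sub>F n in sequentially. v n \<phi> \<le> ln s + e"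
      proof eventually_elim
        case (elim n)
        have "v n \<phi> \<le> (ln (K + 1) + real (Suc n) * ln s) / real (Suc n)"
          unfolding v_def by (intro divide_right_mono a_growth[OF s0 K]) simp
        also have "\<dots> = ln (K + 1) * inverse (real (Suc n)) + ln s"
          by (simp add: field_simps del: of_nat_Suc)
        finally show ?case using elim by simp
      qed
      then have "\<forall>\<^sub>F f in F. f \<phi> \<le> ln s + e"
        by (rule evF)
      then show "L \<phi> \<le> ln s + e"
        by (rule tendsto_upperbound[OF lim _ F])
    qed
  qed
  show ?thesis
    by (rule that[of "Blinfun L"]) (simp add: bounded_linear_Blinfun_apply[OF bl] L_growth)
qed

abbreviation "lam \<equiv> spectral_exponent p \<mu> \<alpha>"

lemma exp_functional_le_growth_rate:
  obtains \<nu>\<^sub>0 :: "('a \<Rightarrow>\<^sub>C real) \<Rightarrow>\<^sub>L real" where "\<And>\<phi>. exp (\<nu>\<^sub>0 \<phi>) \<le> Inf (G \<phi>)"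
proof -
  obtain \<nu>\<^sub>0 :: "('a \<Rightarrow>\<^sub>C real) \<Rightarrow>\<^sub>L real" where \<nu>\<^sub>0: "\<And>\<phi> s. s \<in> G \<phi> \<Longrightarrow> \<nu>\<^sub>0 \<phi> \<le> ln s"
    by (rule functional_of_averages) (rule that)
  have "exp (\<nu>\<^sub>0 \<phi>) \<le> Inf (G \<phi>)" for \<phi>
  proof (rule cInf_greatest)
    show "G \<phi> \<noteq> {}" using exp_norm_in_growth_rates by blast
    fix s assume s: "s \<in> G \<phi>"
    then have "s > 0" by (simp add: growth_rates_def)
    then show "exp (\<nu>\<^sub>0 \<phi>) \<le> s"
      using \<nu>\<^sub>0[OF s] by (simp add: ln_ge_iff)
  qed
  then show ?thesis by (rule that)
qed

lemma growth_rate_pos: "Inf (G \<phi>) > 0"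
  by (rule exp_functional_le_growth_rate) (rule less_le_trans[OF exp_gt_zero])

lemma lam_eq: "lam \<phi> = ln (Inf (G \<phi>))"
  unfolding spectral_exponent_def spectral_radius_eq_growth_rate[OF growth_rate_pos] by (rule refl)

lemma functional_below_lam:
  obtains \<nu>\<^sub>0 :: "('a \<Rightarrow>\<^sub>C real) \<Rightarrow>\<^sub>L real" where "\<And>\<phi>. \<nu>\<^sub>0 \<phi> \<le> lam \<phi>"
proof -
  obtain \<nu>\<^sub>0 :: "('a \<Rightarrow>\<^sub>C real) \<Rightarrow>\<^sub>L real" where \<nu>\<^sub>0: "\<And>\<phi>. exp (\<nu>\<^sub>0 \<phi>) \<le> Inf (G \<phi>)"
    by (rule exp_functional_le_growth_rate) (rule that)
  have "\<nu>\<^sub>0 \<phi> \<le> lam \<phi>" for \<phi>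
    unfolding lam_eq using \<nu>\<^sub>0[of \<phi>] growth_rate_pos[of \<phi>] by (simp add: ln_ge_iff)
  then show ?thesis by (rule that)
qed

lemma lam_transfer:
  fixes \<phi> \<psi> :: "'a \<Rightarrow>\<^sub>C real"
  assumes le: "\<And>n x. birkhoff_sum \<alpha> \<phi> n x \<le> birkhoff_sum \<alpha> \<psi> n x + real n * c + d"
  shows "lam \<phi> \<le> lam \<psi> + c"
proof -
  have "Inf (G \<phi>) / exp c \<le> Inf (G \<psi>)"
  proof (rule cInf_greatest)
    show "G \<psi> \<noteq> {}" using exp_norm_in_growth_rates by blast
    fix s assume "s \<in> G \<psi>"
    then have "exp c * s \<in> G \<phi>"
      by (rule growth_rates_transfer[OF le])
    then have "Inf (G \<phi>) \<le> exp c * s"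
      by (intro cInf_lower bdd_belowI[of _ 0]) (auto simp: growth_rates_def)
    then show "Inf (G \<phi>) / exp c \<le> s"
      by (simp add: divide_le_eq mult.commute)
  qed
  then have "ln (Inf (G \<phi>) / exp c) \<le> ln (Inf (G \<psi>))"
    using growth_rate_pos by (subst ln_le_cancel_iff) auto
  then show ?thesis
    using growth_rate_pos[of \<phi>] by (simp add: lam_eq ln_div)
qed

lemma lam_mono: "(\<And>x. apply_bcontfun \<phi> x \<le> apply_bcontfun \<psi> x) \<Longrightarrow> lam \<phi> \<le> lam \<psi>"
  using lam_transfer[of \<phi> \<psi> 0 0] by (simp add: birkhoff_sum_def sum_mono)

lemma lam_add_const: "lam (\<phi> + const_bcontfun c) = lam \<phi> + c"
proof (rule antisym)
  show "lam (\<phi> + const_bcontfun c) \<le> lam \<phi> + c"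
    by (rule lam_transfer[where d=0]) (simp add: birkhoff_sum_def sum.distrib)
  show "lam \<phi> + c \<le> lam (\<phi> + const_bcontfun c)"
    using lam_transfer[of \<phi> "\<phi> + const_bcontfun c" "- c" 0] by (simp add: birkhoff_sum_def sum.distrib)
qed

text \<open>The Birkhoff sums of a coboundary telescope and stay bounded.\<close>

lemma lam_coboundary_le:
  assumes "\<And>x. apply_bcontfun \<eta> x = apply_bcontfun \<psi> (\<alpha> x) - apply_bcontfun \<psi> x"
  shows "lam \<eta> \<le> lam 0"
proof -
  have "birkhoff_sum \<alpha> \<eta> n x = \<psi> ((\<alpha> ^^ n) x) - \<psi> x" for n x
    by (induction n) (auto simp: birkhoff_sum_def assms)
  moreover have "\<psi> y - \<psi> x \<le> 2 * norm \<psi>" for x y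
    using norm_bounded[of \<psi> x] norm_bounded[of \<psi> y] by auto
  ultimately show ?thesis
    using lam_transfer[of \<eta> 0 0 "2 * norm \<psi>"] by (simp add: birkhoff_sum_def)
qed

subsection \<open>The conjugate functional and its regularity\<close>

text \<open>The spectral exponent is at most \<open>\<lambda>(0)\<close> along the rays through negative functions and through
  coboundaries, so \<open>\<nu>\<close> is nonpositive on the former and vanishes on the latter.\<close>

lemma invariant_measures_if_bounded:
  fixes \<nu> :: "('a \<Rightarrow>\<^sub>C real) \<Rightarrow>\<^sub>L real"
  assumes w: "0 \<le> w" and bound: "\<And>\<phi>. \<nu> \<phi> - w * lam \<phi> \<le> L"
  shows "\<nu> \<in> invariant_measures \<alpha>"
proof -
  have upper: "\<nu> \<phi> \<le> 0" if scaled: "\<And>k. k > 0 \<Longrightarrow> lam (k *\<^sub>R \<phi>) \<le> lam 0" for \<phi>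
  proof (rule nonpos_of_multiples_bounded)
    fix k :: real assume k: "k > 0"
    have "k * \<nu> \<phi> - w * lam (k *\<^sub>R \<phi>) \<le> L"
      using bound[of "k *\<^sub>R \<phi>"] by (simp add: blinfun.scaleR_right)
    moreover have "w * lam (k *\<^sub>R \<phi>) \<le> w * lam 0"
      using scaled[OF k] w by (rule mult_left_mono)
    ultimately show "k * \<nu> \<phi> \<le> L + w * lam 0" by linarith
  qed
  interpret positive_functional \<nu>
  proof
    show "compact (UNIV :: 'a set)" by (rule compact_UNIV)
    fix \<phi> :: "'a \<Rightarrow>\<^sub>C real" assume \<phi>: "\<And>x. 0 \<le> apply_bcontfun \<phi> x"
    have "\<nu> (- \<phi>) \<le> 0"
      by (intro upper lam_mono) (simp add: \<phi>)
    then show "0 \<le> \<nu> \<phi>" by (simp add: blinfun.minus_right)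
  qed
  have inv: "\<nu> \<psi> = \<nu> \<phi>" if eq: "\<And>x. apply_bcontfun \<psi> x = apply_bcontfun \<phi> (\<alpha> x)" for \<phi> \<psi>
  proof (rule antisym)
    have "\<nu> (\<psi> - \<phi>) \<le> 0"
      by (intro upper lam_coboundary_le[where \<psi>="_ *\<^sub>R \<phi>"]) (simp add: eq right_diff_distrib)
    then show "\<nu> \<psi> \<le> \<nu> \<phi>" by (simp add: blinfun.diff_right)
    have "\<nu> (\<phi> - \<psi>) \<le> 0"
      by (intro upper lam_coboundary_le[where \<psi>="- (_ *\<^sub>R \<phi>)"]) (simp add: eq right_diff_distrib)
    then show "\<nu> \<phi> \<le> \<nu> \<psi>" by (simp add: blinfun.diff_right)
  qed
  have "distr representing_measure borel \<alpha> = representing_measure"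
    by (rule distr_eq_of_invariant_functional[OF compact_UNIV finite_representing_measure
          regular_representing_measure is_integration_representing_measure continuous inv])
  then show ?thesis
    unfolding invariant_measures_def
    using finite_representing_measure regular_representing_measure is_integration_representing_measure
    by blast
qed

text \<open>Dividing the hypothesis by the mean bounds the conjugate of \<open>\<lambda>\<close> at the normalized functional, which
  is therefore an invariant probability measure.\<close>

lemma F_functional_le:
  fixes \<nu> :: "('a \<Rightarrow>\<^sub>C real) \<Rightarrow>\<^sub>L real"
  assumes t: "t \<in> S_tilde" and m: "mean t > 0" "total_mass \<nu> = mean t"
    and bound: "\<And>\<phi>. \<nu> \<phi> - mean t * lam \<phi> \<le> L"
  shows "F_functional p \<mu> \<alpha> (t, \<nu>) \<le> ereal (L + (\<Sum>n. t n * ln (t n)))"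
proof -
  define \<nu>1 where "\<nu>1 = (1 / mean t) *\<^sub>R \<nu>"
  have b1: "\<nu>1 \<phi> - lam \<phi> \<le> L / mean t" for \<phi>
    using divide_right_mono[OF bound[of \<phi>], of "mean t"] m(1)
    by (simp add: \<nu>1_def blinfun.scaleR_left diff_divide_distrib)
  have "\<nu>1 \<in> invariant_measures \<alpha>"
    using b1 by (intro invariant_measures_if_bounded[of 1]) auto
  moreover have "total_mass \<nu>1 = 1"
    using m by (simp add: \<nu>1_def total_mass_def blinfun.scaleR_left)
  ultimately have T: "T_entropy p \<mu> \<alpha> \<nu>1 = ereal p * conjugate lam \<nu>1"
    by (simp add: T_entropy_def invariant_prob_measures_def)
  have up: "conjugate lam \<nu>1 \<le> ereal (L / mean t)"
    unfolding conjugate_def using b1 by (intro SUP_least) simp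
  have lo: "ereal (\<nu>1 0 - lam 0) \<le> conjugate lam \<nu>1"
    unfolding conjugate_def by (rule SUP_upper) simp
  obtain c where c: "conjugate lam \<nu>1 = ereal c"
    using up lo by (cases "conjugate lam \<nu>1") auto
  have "c \<le> L / mean t" using up c by simp
  then have "mean t * c \<le> L"
    using m(1) by (simp add: field_simps)
  moreover have "ereal (1 / p) * ereal (mean t) * (ereal p * ereal c) = ereal (mean t * c)"
    using p_pos by simp
  moreover have "\<nu> \<in> invariant_measures \<alpha>"
    using bound m(1) by (intro invariant_measures_if_bounded[of "mean t"]) auto
  moreover have "t \<noteq> e0" using m(1) mean_e0 by auto
  ultimately show ?thesis
    using t m(2) T c by (simp add: F_functional_def \<nu>1_def)
qed

text \<open>For fixed \<open>c\<close> and \<open>\<phi>\<close>, the Gibbs inequality with exponents \<open>c\<^sub>n + n \<lambda>(\<phi>)\<close> separates the contribution of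
  \<open>t\<close> from \<open>\<nu>(\<phi>) - m \<lambda>(\<phi>)\<close>, and the latter is bounded by \<open>m\<close> times the conjugate of \<open>\<lambda>\<close>.\<close>

lemma lambda_hat_conjugate_le_F:
  fixes \<nu> :: "('a \<Rightarrow>\<^sub>C real) \<Rightarrow>\<^sub>L real"
  shows "lambda_hat_conjugate p \<mu> \<alpha> (t, \<nu>) \<le> F_functional p \<mu> \<alpha> (t, \<nu>)"
proof (cases "t \<in> S_tilde - {e0} \<and> \<nu> \<in> invariant_measures \<alpha> \<and> total_mass \<nu> = mean t")
  case False
  then show ?thesis by (auto simp: F_functional_def)
next
  case True
  then have t: "t \<in> S_tilde" and m: "mean t > 0" using mean_pos by auto
  have t': "\<And>n. 0 \<le> t n" "t sums 1" "summable (\<lambda>n. real n * t n)"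
    using t by (auto simp: S_tilde_def)
  have tl1: "t \<in> l1" using t S_tilde_subset_l1 by auto
  define \<nu>1 where "\<nu>1 = (1 / mean t) *\<^sub>R \<nu>"
  define h where "h = (\<Sum>n. t n * ln (t n))"
  have F: "F_functional p \<mu> \<alpha> (t, \<nu>) = ereal (1 / p) * ereal (mean t) * T_entropy p \<mu> \<alpha> \<nu>1 + ereal h"
    using True by (simp add: F_functional_def \<nu>1_def h_def)
  show ?thesis
  proof (cases "\<nu>1 \<in> invariant_prob_measures \<alpha> \<and> conjugate lam \<nu>1 \<noteq> \<infinity>")
    case False
    then have "T_entropy p \<mu> \<alpha> \<nu>1 = \<infinity>"
      using p_pos by (auto simp: T_entropy_def)
    then have "F_functional p \<mu> \<alpha> (t, \<nu>) = \<infinity>"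
      unfolding F using m p_pos by simp
    then show ?thesis by simp
  next
    case True
    have lo: "ereal (\<nu>1 \<phi> - lam \<phi>) \<le> conjugate lam \<nu>1" for \<phi>
      unfolding conjugate_def by (rule SUP_upper) simp
    obtain c where c: "conjugate lam \<nu>1 = ereal c"
      using True lo[of 0] by (cases "conjugate lam \<nu>1") auto
    have F2: "F_functional p \<mu> \<alpha> (t, \<nu>) = ereal (mean t * c + h)"
      unfolding F T_entropy_def using True c p_pos by simp
    have each: "ereal ((\<Sum>n. d n * t n) + \<nu> \<phi>) - lambda_hat p \<mu> \<alpha> d \<phi> \<le> ereal (mean t * c + h)"
      if d: "d \<in> l_infty" for d \<phi>
    proof (cases "lam \<phi> < 0")
      case False
      then show ?thesis by (simp add: lambda_hat_def)
    next
      case neg: True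
      let ?a = "\<lambda>n. d n + real n * lam \<phi>"
      have s: "summable (\<lambda>n. d n * t n)" by (rule summable_l1_l_infty[OF d tl1])
      have ta: "(\<lambda>n. t n * ?a n) sums ((\<Sum>n. d n * t n) + lam \<phi> * mean t)"
      proof -
        have "(\<lambda>n. d n * t n + lam \<phi> * (real n * t n)) sums ((\<Sum>n. d n * t n) + lam \<phi> * mean t)"
          unfolding mean_def by (intro sums_add sums_mult summable_sums s t')
        then show ?thesis by (simp add: algebra_simps)
      qed
      have "(\<Sum>n. t n * ?a n) - ln (\<Sum>n. exp (?a n)) \<le> h"
        unfolding h_def
        by (intro Gibbs_inequality t' summable_entropy t sums_summable[OF ta] summable_exp_l_infty d neg)
      then have "(\<Sum>n. d n * t n) + lam \<phi> * mean t - ln (\<Sum>n. exp (?a n)) \<le> h"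
        using ta by (simp add: sums_iff)
      moreover have "\<nu> \<phi> - mean t * lam \<phi> \<le> mean t * c"
      proof -
        have "\<nu>1 \<phi> - lam \<phi> \<le> c" using lo[of \<phi>] c by simp
        then have "mean t * (\<nu>1 \<phi> - lam \<phi>) \<le> mean t * c"
          using m by (intro mult_left_mono) auto
        then show ?thesis
          using m by (simp add: \<nu>1_def blinfun.scaleR_left right_diff_distrib)
      qed
      ultimately have "(\<Sum>n. d n * t n) + \<nu> \<phi> - ln (\<Sum>n. exp (?a n)) \<le> mean t * c + h"
        by (simp add: mult.commute)
      then show ?thesis
        using neg d by (simp add: lambda_hat_def)
    qed
    show ?thesis
      unfolding F2 lambda_hat_conjugate_def by (auto intro!: SUP_least each)
  qed
qed

lemma lambda_hat_conjugate_bound: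
  assumes le: "lambda_hat_conjugate p \<mu> \<alpha> (t, \<nu>) \<le> ereal L"
    and "c \<in> l_infty" "lam \<phi> < 0"
  shows "(\<Sum>n. c n * t n) + \<nu> \<phi> - ln (\<Sum>n. exp (c n + real n * lam \<phi>)) \<le> L"
proof -
  have "ereal ((\<Sum>n. c n * t n) + \<nu> \<phi>) - lambda_hat p \<mu> \<alpha> c \<phi> \<le> lambda_hat_conjugate p \<mu> \<alpha> (t, \<nu>)"
    unfolding lambda_hat_conjugate_def prod.case
    by (rule SUP_upper2[of "(c, \<phi>)"]) (use assms in auto)
  also note le
  finally show ?thesis
    using assms by (simp add: lambda_hat_def)
qed

text \<open>Each conclusion comes from one family of test pairs \<open>(c, \<phi>)\<close>. A single very negative entry of \<open>c\<close>
  excludes negative \<open>t\<^sub>k\<close>, constant \<open>c\<close> forces the sum 1, and truncations of the optimal \<open>c\<close> bound the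
  mean and give the inequality for \<open>\<lambda>(\<phi>) < 0\<close>. Subtracting large constants from \<open>\<phi>\<close> then compares
  the mean with the total mass, and shifting an arbitrary \<open>\<phi>\<close> to \<open>\<lambda>(\<phi>) = -\<epsilon>\<close> with \<open>\<epsilon>\<close> tending to 0
  gives the last inequality.\<close>

lemma lambda_hat_conjugate_finite:
  fixes \<nu> :: "('a \<Rightarrow>\<^sub>C real) \<Rightarrow>\<^sub>L real"
  assumes tl1: "t \<in> l1" and le: "lambda_hat_conjugate p \<mu> \<alpha> (t, \<nu>) \<le> ereal L"
  shows "t \<in> S_tilde"
    and "\<And>\<phi>. lam \<phi> < 0 \<Longrightarrow> (\<Sum>n. t n * ln (t n)) + \<nu> \<phi> - mean t * lam \<phi> \<le> L"
    and "mean t \<le> total_mass \<nu>"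
    and "\<And>\<phi>. \<nu> \<phi> - total_mass \<nu> * lam \<phi> \<le> L - (\<Sum>n. t n * ln (t n))"
proof -
  note bound = lambda_hat_conjugate_bound[OF le]
  have st: "summable t"
    using tl1 unfolding l1_def by (auto intro: summable_rabs_cancel)
  define Q where "Q r = (\<Sum>n. exp (real n * r))" for r :: real
  have sQ: "summable (\<lambda>n. exp (real n * r))" if "r < 0" for r
    using summable_exp_minus[of "- r"] that by simp
  have Q: "Q r > 0" if "r < 0" for r
    unfolding Q_def by (intro suminf_pos sQ that) simp
  \<comment> \<open>A test function in the effective domain, with \<open>\<lambda>(\<phi>1) = -1\<close>.\<close>
  define \<phi>1 :: "'a \<Rightarrow>\<^sub>C real" where "\<phi>1 = const_bcontfun (- 1 - lam 0)"
  have \<phi>1: "lam \<phi>1 = - 1"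
    using lam_add_const[of 0 "- 1 - lam 0"] by (simp add: \<phi>1_def)
  have nn: "0 \<le> t k" for k
  proof -
    have "- t k \<le> 0"
    proof (rule nonpos_of_multiples_bounded)
      fix R :: real assume R: "R > 0"
      define c where "c n = (if n = k then - R else 0)" for n
      have c: "c \<in> l_infty" using R by (intro l_inftyI[of _ R]) (auto simp: c_def)
      have "(\<lambda>n. c n * t n) = (\<lambda>n. if n = k then - R * t n else 0)"
        by (auto simp: c_def)
      then have 1: "(\<Sum>n. c n * t n) = - R * t k"
        using sums_single[of k "\<lambda>n. - R * t n"] by (simp add: sums_iff)
      have pos: "0 < (\<Sum>n. exp (c n + real n * lam \<phi>1))"
        by (intro suminf_pos summable_exp_l_infty c) (simp_all add: \<phi>1)
      have "(\<Sum>n. exp (c n + real n * lam \<phi>1)) \<le> Q (lam \<phi>1)"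
        unfolding Q_def
        by (intro suminf_le summable_exp_l_infty c sQ) (use R in \<open>auto simp: \<phi>1 c_def\<close>)
      then have "ln (\<Sum>n. exp (c n + real n * lam \<phi>1)) \<le> ln (Q (lam \<phi>1))"
        using pos by simp
      then show "R * (- t k) \<le> L - \<nu> \<phi>1 + ln (Q (lam \<phi>1))"
        using bound[OF c, of \<phi>1] 1 \<phi>1 by simp
    qed
    then show ?thesis by simp
  qed
  have one: "(\<Sum>n. t n) = 1"
  proof -
    have B: "R * ((\<Sum>n. t n) - 1) \<le> L - \<nu> \<phi>1 + ln (Q (lam \<phi>1))" for R
    proof -
      have c: "(\<lambda>n. R) \<in> l_infty" by (rule l_inftyI[of _ "\<bar>R\<bar>"]) simp
      have "(\<Sum>n. exp (R + real n * lam \<phi>1)) = exp R * Q (lam \<phi>1)"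
        unfolding Q_def exp_add by (intro suminf_mult sQ) (simp add: \<phi>1)
      then have "ln (\<Sum>n. exp (R + real n * lam \<phi>1)) = R + ln (Q (lam \<phi>1))"
        using Q[of "lam \<phi>1"] \<phi>1 by (simp add: ln_mult)
      moreover have "(\<Sum>n. R * t n) = R * (\<Sum>n. t n)"
        by (rule suminf_mult[OF st])
      ultimately show ?thesis
        using bound[OF c, of \<phi>1] \<phi>1 by (simp add: right_diff_distrib)
    qed
    have "(\<Sum>n. t n) - 1 \<le> 0"
      by (rule nonpos_of_multiples_bounded) (rule B)
    moreover have "1 - (\<Sum>n. t n) \<le> 0"
    proof (rule nonpos_of_multiples_bounded)
      fix k :: real assume "k > 0"
      show "k * (1 - (\<Sum>n. t n)) \<le> L - \<nu> \<phi>1 + ln (Q (lam \<phi>1))"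
        using B[of "- k"] by (simp add: algebra_simps)
    qed
    ultimately show ?thesis by simp
  qed
  have ts: "t sums 1" using st one by (simp add: sums_iff)
  \<comment> \<open>The optimal \<open>c\<close> would be \<open>ln t n - n * lam \<phi>\<close>; it is truncated to a bounded sequence.\<close>
  have main: "(\<Sum>n<M. t n * ln (t n) + - lam \<phi> * (real n * t n)) - R * (1 - (\<Sum>n<M. t n)) + \<nu> \<phi>
      - ln (1 + exp (- R) * Q (lam \<phi>)) \<le> L" if neg: "lam \<phi> < 0" for M R \<phi>
  proof -
    define c where "c n = (if n < M \<and> t n > 0 then ln (t n) - real n * lam \<phi> else - R)" for n
    have c: "c \<in> l_infty"
    proof -
      have "finite (c ` {..<M} \<union> {- R})" by simp
      moreover have "range c \<subseteq> c ` {..<M} \<union> {- R}"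
        by (auto simp: c_def)
      ultimately show ?thesis
        unfolding l_infty_def mem_Collect_eq by (rule bounded_subset[OF finite_imp_bounded])
    qed
    have "(\<Sum>n. c n * t n) = (\<Sum>n. c (n + M) * t (n + M)) + (\<Sum>n<M. c n * t n)"
      by (rule suminf_split_initial_segment[OF summable_l1_l_infty[OF c tl1]])
    also have "(\<Sum>n. c (n + M) * t (n + M)) = - R * (\<Sum>n. t (n + M))"
    proof -
      have "(\<lambda>n. c (n + M) * t (n + M)) = (\<lambda>n. - R * t (n + M))"
        by (simp add: c_def)
      then show ?thesis
        by (simp only: suminf_mult[OF summable_ignore_initial_segment[OF st, of M]])
    qed
    also have "(\<Sum>n. t (n + M)) = 1 - (\<Sum>n<M. t n)"
      using suminf_split_initial_segment[OF st, of M] one by simp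
    also have "(\<Sum>n<M. c n * t n) = (\<Sum>n<M. t n * ln (t n) + - lam \<phi> * (real n * t n))"
      using nn by (intro sum.cong) (auto simp: c_def algebra_simps less_le)
    finally have 1: "(\<Sum>n. c n * t n) = - R * (1 - (\<Sum>n<M. t n))
        + (\<Sum>n<M. t n * ln (t n) + - lam \<phi> * (real n * t n))" .
    have pos: "0 < (\<Sum>n. exp (c n + real n * lam \<phi>))"
      by (intro suminf_pos summable_exp_l_infty c neg) simp
    have "(\<Sum>n. exp (c n + real n * lam \<phi>)) \<le> (\<Sum>n. t n + exp (- R) * exp (real n * lam \<phi>))"
    proof (intro suminf_le summable_exp_l_infty c neg summable_add st summable_mult sQ)
      show "exp (c n + real n * lam \<phi>) \<le> t n + exp (- R) * exp (real n * lam \<phi>)" for n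
      proof (cases "n < M \<and> t n > 0")
        case True
        then have "exp (c n + real n * lam \<phi>) = t n" by (simp add: c_def)
        then show ?thesis by simp
      next
        case False
        then have "c n = - R" unfolding c_def by (rule if_not_P)
        then show ?thesis using nn[of n] by (simp only: exp_add)
      qed
    qed
    also have "\<dots> = 1 + exp (- R) * Q (lam \<phi>)"
    proof -
      have "(\<lambda>n. t n + exp (- R) * exp (real n * lam \<phi>)) sums (1 + exp (- R) * Q (lam \<phi>))"
        unfolding Q_def by (intro sums_add sums_mult summable_sums sQ neg ts)
      then show ?thesis by (simp add: sums_iff)
    qed
    finally have "ln (\<Sum>n. exp (c n + real n * lam \<phi>)) \<le> ln (1 + exp (- R) * Q (lam \<phi>))"
      using pos by simp
    then show ?thesis
      using bound[OF c neg] 1 by simp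
  qed
  have sm: "summable (\<lambda>n. real n * t n)"
  proof -
    have C: "(\<Sum>n<M. t n * ln (t n) + real n * t n) \<le> L - \<nu> \<phi>1 + ln (1 + Q (- 1))" for M
      using main[of \<phi>1 M 0] by (simp add: \<phi>1)
    have "(\<Sum>n<M. real n * t n / 2) \<le> L - \<nu> \<phi>1 + ln (1 + Q (- 1)) + (\<Sum>n. exp (- (real n * (1 / 2))))" for M
    proof -
      have "(\<Sum>n<M. real n * t n / 2) \<le> (\<Sum>n<M. (t n * ln (t n) + real n * t n) + exp (- (real n * (1 / 2))))"
      proof (rule sum_mono)
        show "real n * t n / 2 \<le> (t n * ln (t n) + real n * t n) + exp (- (real n * (1 / 2)))" for n
          using entropy_lower[OF nn[of n], of "real n * (1 / 2)"] by simp
      qed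
      also have "\<dots> = (\<Sum>n<M. t n * ln (t n) + real n * t n) + (\<Sum>n<M. exp (- (real n * (1 / 2))))"
        by (rule sum.distrib)
      also have "\<dots> \<le> (L - \<nu> \<phi>1 + ln (1 + Q (- 1))) + (\<Sum>n. exp (- (real n * (1 / 2))))"
        by (intro add_mono C sum_le_suminf summable_exp_minus) auto
      finally show ?thesis .
    qed
    then have "summable (\<lambda>n. real n * t n / 2)"
      using nn by (intro summableI_nonneg_bounded) auto
    then have "summable (\<lambda>n. 2 * (real n * t n / 2))" by (rule summable_mult)
    then show ?thesis by simp
  qed
  show S: "t \<in> S_tilde"
    using nn ts sm by (simp add: S_tilde_def)
  define h where "h = (\<Sum>n. t n * ln (t n))"
  define m where "m = mean t"
  have limit: "h + \<nu> \<phi> - m * lam \<phi> \<le> L" if neg: "lam \<phi> < 0" for \<phi>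
  proof -
    have R: "h + - lam \<phi> * m + \<nu> \<phi> - ln (1 + exp (- R) * Q (lam \<phi>)) \<le> L" for R
    proof (rule LIMSEQ_le_const2)
      have "(\<lambda>n. t n * ln (t n) + - lam \<phi> * (real n * t n)) sums (h + - lam \<phi> * m)"
        unfolding h_def m_def mean_def
        by (intro sums_add sums_mult summable_sums summable_entropy S sm)
      then have "(\<lambda>M. (\<Sum>n<M. t n * ln (t n) + - lam \<phi> * (real n * t n)) - R * (1 - (\<Sum>n<M. t n)) + \<nu> \<phi>
          - ln (1 + exp (- R) * Q (lam \<phi>)))
          \<longlonglongrightarrow> (h + - lam \<phi> * m) - R * (1 - 1) + \<nu> \<phi> - ln (1 + exp (- R) * Q (lam \<phi>))"
        using ts unfolding sums_def by (intro tendsto_intros)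
      then show "(\<lambda>M. (\<Sum>n<M. t n * ln (t n) + - lam \<phi> * (real n * t n)) - R * (1 - (\<Sum>n<M. t n)) + \<nu> \<phi>
          - ln (1 + exp (- R) * Q (lam \<phi>)))
          \<longlonglongrightarrow> h + - lam \<phi> * m + \<nu> \<phi> - ln (1 + exp (- R) * Q (lam \<phi>))" by simp
      show "\<exists>N. \<forall>M\<ge>N. (\<Sum>n<M. t n * ln (t n) + - lam \<phi> * (real n * t n)) - R * (1 - (\<Sum>n<M. t n)) + \<nu> \<phi>
          - ln (1 + exp (- R) * Q (lam \<phi>)) \<le> L"
        using main[OF neg] by blast
    qed
    show ?thesis
    proof (rule field_le_epsilon)
      fix e :: real assume e: "e > 0"
      have "exp (- R) * Q (lam \<phi>) = e" if "R = - ln (e / Q (lam \<phi>))" for R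
        using e Q[OF neg] that by simp
      then obtain R where "exp (- R) * Q (lam \<phi>) = e" by blast
      then have "ln (1 + exp (- R) * Q (lam \<phi>)) \<le> e"
        using e ln_add_one_self_le_self[of e] by simp
      then show "h + \<nu> \<phi> - m * lam \<phi> \<le> L + e"
        using R[of R] by (simp add: mult.commute)
    qed
  qed
  show "(\<Sum>n. t n * ln (t n)) + \<nu> \<phi> - mean t * lam \<phi> \<le> L" if "lam \<phi> < 0" for \<phi>
    using limit[OF that] by (simp add: h_def m_def)
  define w where "w = total_mass \<nu>"
  have \<nu>_const: "\<nu> (const_bcontfun k) = k * w" for k
  proof -
    have "const_bcontfun k = k *\<^sub>R (const_bcontfun 1 :: 'a \<Rightarrow>\<^sub>C real)"
      by (rule bcontfun_eqI) simp
    then show ?thesis by (simp add: w_def total_mass_def blinfun.scaleR_right)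
  qed
  have "m - w \<le> 0"
  proof (rule nonpos_of_multiples_bounded)
    fix k :: real assume k: "k > 0"
    have eq: "lam (\<phi>1 + const_bcontfun (- k)) = - 1 - k"
      by (simp add: lam_add_const \<phi>1)
    have "h + (\<nu> \<phi>1 + - k * w) - m * (- 1 - k) \<le> L"
      using limit[of "\<phi>1 + const_bcontfun (- k)"] k
      unfolding eq by (simp add: blinfun.add_right \<nu>_const)
    then show "k * (m - w) \<le> L - h - \<nu> \<phi>1 - m"
      by (simp add: algebra_simps)
  qed
  then have mw: "m \<le> w" by simp
  then show "mean t \<le> total_mass \<nu>" by (simp add: m_def w_def)
  show "\<nu> \<phi> - total_mass \<nu> * lam \<phi> \<le> L - (\<Sum>n. t n * ln (t n))" for \<phi>
    unfolding h_def[symmetric] w_def[symmetric]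
  proof (rule field_le_epsilon)
    fix e :: real assume e: "e > 0"
    define \<epsilon> where "\<epsilon> = e / (w - m + 1)"
    have \<epsilon>: "\<epsilon> > 0" "\<epsilon> * (w - m) \<le> e"
      using e mw by (auto simp: \<epsilon>_def field_simps)
    have "lam (\<phi> + const_bcontfun (- lam \<phi> - \<epsilon>)) = - \<epsilon>"
      by (simp add: lam_add_const)
    then have "h + \<nu> (\<phi> + const_bcontfun (- lam \<phi> - \<epsilon>)) - m * (- \<epsilon>) \<le> L"
      using limit[of "\<phi> + const_bcontfun (- lam \<phi> - \<epsilon>)"] \<epsilon>(1) by simp
    then have "h + \<nu> \<phi> - w * lam \<phi> - \<epsilon> * (w - m) \<le> L"
      by (simp add: blinfun.add_right \<nu>_const algebra_simps)
    then show "\<nu> \<phi> - w * lam \<phi> \<le> L - h + e"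
      using \<epsilon>(2) by linarith
  qed
qed

lemma lsc_lambda_hat_conjugate: "lsc_on l1_dual_topology (lambda_hat_conjugate p \<mu> \<alpha>)"
  unfolding lsc_on_def
proof
  fix a :: ereal
  let ?T = "l1_dual_topology :: ((nat \<Rightarrow> real) \<times> (('a \<Rightarrow>\<^sub>C real) \<Rightarrow>\<^sub>L real)) topology"
  let ?g = "\<lambda>c \<phi> x. (\<Sum>n. c n * fst x n) + blinfun_apply (snd x) \<phi>"
  have top: "openin ?T {x \<in> topspace ?T. a < ereal (?g c \<phi> x) - lambda_hat p \<mu> \<alpha> c \<phi>}"
    if c: "c \<in> l_infty" for c \<phi>
  proof (cases "lam \<phi> < 0")
    case False
    then have eq: "{x \<in> topspace ?T. a < ereal (?g c \<phi> x) - lambda_hat p \<mu> \<alpha> c \<phi>} = {}"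
      by (simp add: lambda_hat_def)
    show ?thesis unfolding eq by (rule openin_empty)
  next
    case True
    define r where "r = ln (\<Sum>n. exp (c n + real n * lam \<phi>))"
    have "continuous_map ?T euclideanreal (\<lambda>x. (\<Sum>n. c n * fst x n) + blinfun_apply (snd x) \<phi>)"
      unfolding l1_dual_topology_def
      by (intro continuous_map_add
          continuous_map_compose[OF continuous_map_fst continuous_l1_pairing[OF c], unfolded comp_def]
          continuous_map_compose[OF continuous_map_snd strong_operator_topology_continuous_evaluation, unfolded comp_def])
    moreover have "open {y :: real. a < ereal (y - r)}"
    proof (cases a)
      case (real b)
      then have "{y :: real. a < ereal (y - r)} = {b + r<..}" by auto
      then show ?thesis by simp
    qed auto
    ultimately have "openin ?T {x \<in> topspace ?T. ?g c \<phi> x \<in> {y. a < ereal (y - r)}}"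
      by (intro openin_continuous_map_preimage[where Y=euclideanreal]) auto
    then show ?thesis
      using True c by (simp add: lambda_hat_def r_def)
  qed
  have "{x \<in> topspace ?T. a < lambda_hat_conjugate p \<mu> \<alpha> x}
      = (\<Union>(c, \<phi>) \<in> l_infty \<times> UNIV. {x \<in> topspace ?T. a < ereal (?g c \<phi> x) - lambda_hat p \<mu> \<alpha> c \<phi>})"
    by (auto simp: lambda_hat_conjugate_def less_SUP_iff split: prod.splits) blast
  then show "openin ?T {x \<in> topspace ?T. a < lambda_hat_conjugate p \<mu> \<alpha> x}"
    using top by (auto intro!: openin_Union)
qed

lemma topspace_l1_dual_topology: "topspace l1_dual_topology = l1 \<times> UNIV"
  unfolding l1_dual_topology_def
  by (simp add: Metric_space.topspace_mtopology[OF Metric_space_l1] strong_operator_topology_topspace)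

text \<open>The mean of \<open>t\<close> may fall short of the total mass of \<open>\<nu>\<close>, where \<open>F\<close> is infinite. The approximants repair
  this by moving a little mass of \<open>t\<close> far away. Adding \<open>\<delta> \<nu>\<^sub>0\<close> to \<open>\<nu>\<close> makes the common value of mean and
  mass positive also when \<open>\<nu> = 0\<close> and \<open>t = e\<^sub>0\<close>, and it preserves the bound on
  \<open>\<nu>(\<phi>) - \<nu>(1) \<lambda>(\<phi>)\<close> because \<open>\<nu>\<^sub>0 \<le> \<lambda>\<close>.\<close>

lemma lsc_minorant_le_lambda_hat_conjugate:
  fixes \<nu> :: "('a \<Rightarrow>\<^sub>C real) \<Rightarrow>\<^sub>L real"
  assumes lsc: "lsc_on l1_dual_topology H"
    and minor: "\<forall>x \<in> topspace l1_dual_topology. H x \<le> F_functional p \<mu> \<alpha> x"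
    and tl1: "t \<in> l1"
  shows "H (t, \<nu>) \<le> lambda_hat_conjugate p \<mu> \<alpha> (t, \<nu>)"
proof (rule ccontr)
  assume "\<not> H (t, \<nu>) \<le> lambda_hat_conjugate p \<mu> \<alpha> (t, \<nu>)"
  then obtain L2 where L2: "lambda_hat_conjugate p \<mu> \<alpha> (t, \<nu>) < ereal L2" "ereal L2 < H (t, \<nu>)"
    using ereal_dense2 by (metis linorder_not_le)
  then obtain L where L: "lambda_hat_conjugate p \<mu> \<alpha> (t, \<nu>) < ereal L" "ereal L < ereal L2"
    using ereal_dense2 by blast
  note fin = lambda_hat_conjugate_finite[OF tl1 less_imp_le[OF L(1)]]
  have LL: "L < L2" using L(2) by simp
  define h where "h = (\<Sum>n. t n * ln (t n))"
  define m where "m = mean t"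
  define w where "w = total_mass \<nu>"
  have t': "\<And>n. 0 \<le> t n" "summable (\<lambda>n. real n * t n)"
    using fin(1) by (auto simp: S_tilde_def)
  have m0: "0 \<le> m" unfolding m_def mean_def using t' by (intro suminf_nonneg) auto
  have mw: "m \<le> w" using fin(3) by (simp add: m_def w_def)
  obtain \<nu>\<^sub>0 :: "('a \<Rightarrow>\<^sub>C real) \<Rightarrow>\<^sub>L real" where \<nu>\<^sub>0: "\<And>\<phi>. \<nu>\<^sub>0 \<phi> \<le> lam \<phi>"
    by (rule functional_below_lam) (rule that)
  have mass0: "total_mass \<nu>\<^sub>0 = 1"
  proof -
    have B: "k * (total_mass \<nu>\<^sub>0 - 1) \<le> lam 0" for k
    proof -
      have "const_bcontfun k = k *\<^sub>R (const_bcontfun 1 :: 'a \<Rightarrow>\<^sub>C real)"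
        by (rule bcontfun_eqI) simp
      then show ?thesis
        using \<nu>\<^sub>0[of "const_bcontfun k"] lam_add_const[of 0 k]
        by (simp add: total_mass_def blinfun.scaleR_right right_diff_distrib)
    qed
    have "total_mass \<nu>\<^sub>0 - 1 \<le> 0"
      by (rule nonpos_of_multiples_bounded) (rule B)
    moreover have "1 - total_mass \<nu>\<^sub>0 \<le> 0"
    proof (rule nonpos_of_multiples_bounded)
      fix k :: real assume "k > 0"
      show "k * (1 - total_mass \<nu>\<^sub>0) \<le> lam 0"
        using B[of "- k"] by (simp add: algebra_simps)
    qed
    ultimately show ?thesis by simp
  qed
  \<comment> \<open>Approximants whose mean and total mass agree and are positive.\<close>
  define \<delta> where "\<delta> k = inverse (real (Suc k))" for k
  \<comment> \<open>The site is so far away that the mass \<open>\<epsilon>\<close> needed for the correct mean is at most \<open>\<delta>\<close>.\<close>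
  define site where "site k = nat \<lceil>m + (w + 1) * real (Suc k)\<rceil>" for k
  define \<epsilon> where "\<epsilon> k = (w + \<delta> k - m) / (real (site k) - m)" for k
  define T where "T k = shift_mass (\<epsilon> k) (site k) t" for k
  define V where "V k = \<nu> + \<delta> k *\<^sub>R \<nu>\<^sub>0" for k
  have \<delta>: "0 < \<delta> k" "\<delta> k \<le> 1" for k
    by (auto simp: \<delta>_def inverse_le_1_iff)
  have site: "(w + 1) * real (Suc k) \<le> real (site k) - m" for k
  proof -
    have "m + (w + 1) * real (Suc k) \<le> real (site k)"
      unfolding site_def by (rule real_nat_ceiling_ge)
    then show ?thesis by simp
  qed
  have w1: "w + 1 > 0" using mw m0 by simp
  have site_pos: "real (site k) - m > 0" for k
    using site[of k] w1 by (intro less_le_trans[OF _ site]) (simp add: mult_pos_pos)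
  have \<epsilon>: "0 \<le> \<epsilon> k" "\<epsilon> k \<le> \<delta> k" for k
  proof -
    show "0 \<le> \<epsilon> k" unfolding \<epsilon>_def using mw \<delta>(1)[of k] site_pos[of k] by simp
    have "w + \<delta> k - m \<le> w + 1" using m0 \<delta>(2)[of k] by simp
    also have "\<dots> = \<delta> k * ((w + 1) * real (Suc k))"
      by (simp add: \<delta>_def)
    also have "\<dots> \<le> \<delta> k * (real (site k) - m)"
      using site[of k] \<delta>(1)[of k] by (intro mult_left_mono) auto
    finally show "\<epsilon> k \<le> \<delta> k"
      unfolding \<epsilon>_def using site_pos[of k] by (simp add: divide_le_eq)
  qed
  have \<epsilon>1: "\<epsilon> k \<le> 1" for k using \<epsilon>(2)[of k] \<delta>(2)[of k] by simp
  note sh = shift_mass_approximation[OF fin(1) \<epsilon>(1) \<epsilon>1]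
  have meanT: "mean (T k) = w + \<delta> k" for k
  proof -
    have "\<epsilon> k * (real (site k) - m) = w + \<delta> k - m"
      using site_pos[of k] by (simp add: \<epsilon>_def)
    then show ?thesis
      using sh(2)[of k "site k"] by (simp add: T_def m_def[symmetric] algebra_simps)
  qed
  have massV: "total_mass (V k) = w + \<delta> k" for k
    using mass0 by (simp add: V_def total_mass_def blinfun.add_left blinfun.scaleR_left w_def)
  have F: "F_functional p \<mu> \<alpha> (T k, V k) \<le> ereal (L - \<epsilon> k * h)" for k
  proof -
    have "F_functional p \<mu> \<alpha> (T k, V k) \<le> ereal ((L - h) + (\<Sum>n. T k n * ln (T k n)))"
    proof (rule F_functional_le)
      show "T k \<in> S_tilde" unfolding T_def by (rule sh(1))
      show "mean (T k) > 0" unfolding meanT using mw m0 \<delta>(1)[of k] by simp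
      show "total_mass (V k) = mean (T k)" by (simp add: massV meanT)
      fix \<phi>
      have "\<nu> \<phi> - w * lam \<phi> \<le> L - h"
        using fin(4)[of \<phi>] by (simp add: w_def h_def)
      moreover have "\<delta> k * \<nu>\<^sub>0 \<phi> \<le> \<delta> k * lam \<phi>"
        using \<nu>\<^sub>0[of \<phi>] \<delta>(1)[of k] by (intro mult_left_mono) auto
      ultimately show "V k \<phi> - mean (T k) * lam \<phi> \<le> L - h"
        unfolding meanT by (simp add: V_def blinfun.add_left blinfun.scaleR_left distrib_right)
    qed
    also have "\<dots> \<le> ereal (L - \<epsilon> k * h)"
      using sh(3)[of k "site k"] by (simp add: T_def h_def[symmetric] algebra_simps)
    finally show ?thesis .
  qed
  have \<delta>0: "\<delta> \<longlonglongrightarrow> 0"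
    unfolding \<delta>_def[abs_def] by (rule LIMSEQ_inverse_real_of_nat)
  have \<epsilon>0: "\<epsilon> \<longlonglongrightarrow> 0"
    by (rule tendsto_sandwich[OF _ _ tendsto_const \<delta>0]) (use \<epsilon> in auto)
  have limT: "limitin (Metric_space.mtopology l1 l1_dist) T t sequentially"
    unfolding Metric_space.limit_metric_sequentially[OF Metric_space_l1]
  proof (intro conjI allI impI tl1)
    fix e :: real assume e: "e > 0"
    have "(\<lambda>k. 2 * \<epsilon> k) \<longlonglongrightarrow> 2 * 0" by (intro tendsto_mult_left \<epsilon>0)
    then have "\<forall>\<^sub>F k in sequentially. 2 * \<epsilon> k < e"
      by (rule order_tendstoD(2)) (use e in simp)
    then obtain K where K: "\<And>k. k \<ge> K \<Longrightarrow> 2 * \<epsilon> k < e"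
      unfolding eventually_sequentially by blast
    show "\<exists>K. \<forall>k\<ge>K. T k \<in> l1 \<and> l1_dist (T k) t < e"
    proof (intro exI[of _ K] allI impI conjI)
      fix k assume "K \<le> k"
      show "T k \<in> l1" using sh(1)[of k "site k"] S_tilde_subset_l1 by (auto simp: T_def)
      show "l1_dist (T k) t < e"
        using sh(4)[of k "site k"] K[OF \<open>K \<le> k\<close>] by (simp add: T_def)
    qed
  qed
  have "V \<longlonglongrightarrow> \<nu> + 0 *\<^sub>R \<nu>\<^sub>0"
    unfolding V_def[abs_def] by (intro tendsto_intros \<delta>0)
  then have "limitin euclidean V \<nu> sequentially" by simp
  from continuous_map_limit[OF strong_operator_topology_weaker_than_euclidean this]
  have limV: "limitin strong_operator_topology V \<nu> sequentially"
    by (simp add: comp_def)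
  have lim: "limitin l1_dual_topology (\<lambda>k. (T k, V k)) (t, \<nu>) sequentially"
    unfolding l1_dual_topology_def limitin_pairwise using limT limV by (simp add: comp_def)
  define Y where "Y = {x \<in> topspace l1_dual_topology. ereal L2 < H x}"
  have "openin l1_dual_topology Y"
    using lsc unfolding lsc_on_def Y_def by blast
  moreover have "(t, \<nu>) \<in> Y"
    using tl1 L2(2) by (simp add: Y_def topspace_l1_dual_topology)
  ultimately have ev: "\<forall>\<^sub>F k in sequentially. (T k, V k) \<in> Y"
    using lim by (simp add: limitin_def)
  have "(\<lambda>k. L - \<epsilon> k * h) \<longlonglongrightarrow> L - 0 * h"
    by (intro tendsto_intros \<epsilon>0)
  then have "\<forall>\<^sub>F k in sequentially. L - \<epsilon> k * h < L2"
    by (rule order_tendstoD(2)) (use LL in simp)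
  with ev have "\<forall>\<^sub>F k in sequentially. False"
  proof eventually_elim
    case (elim k)
    then have "ereal L2 < H (T k, V k)" "H (T k, V k) \<le> F_functional p \<mu> \<alpha> (T k, V k)"
      using minor by (auto simp: Y_def)
    then have "ereal L2 < ereal (L - \<epsilon> k * h)"
      using F[of k] by (meson less_le_trans)
    with elim show False by simp
  qed
  then show False by simp
qed

lemma lambda_hat_conjugate_e0: "lambda_hat_conjugate p \<mu> \<alpha> (e0, 0) = 0"
proof (rule antisym)
  have "ereal ((\<Sum>n. c n * e0 n) + blinfun_apply 0 \<phi>) - lambda_hat p \<mu> \<alpha> c \<phi> \<le> 0"
    if c: "c \<in> l_infty" for c and \<phi> :: "'a \<Rightarrow>\<^sub>C real"
  proof (cases "lam \<phi> < 0")
    case True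
    have "(\<lambda>n. c n * e0 n) = (\<lambda>n. if n = 0 then c n else 0)"
      by (auto simp: e0_def)
    then have 1: "(\<Sum>n. c n * e0 n) = c 0"
      using sums_single[of 0 c] by (simp add: sums_iff)
    have s: "summable (\<lambda>n. exp (c n + real n * lam \<phi>))"
      by (rule summable_exp_l_infty[OF c True])
    have "exp (c 0) \<le> (\<Sum>n. exp (c n + real n * lam \<phi>))"
      using sum_le_suminf[OF s, of "{0}"] by simp
    then have "c 0 \<le> ln (\<Sum>n. exp (c n + real n * lam \<phi>))"
      by (subst ln_ge_iff) (auto intro: less_le_trans[OF exp_gt_zero])
    then show ?thesis
      using True c 1 by (simp add: lambda_hat_def)
  qed (simp add: lambda_hat_def)
  then show "lambda_hat_conjugate p \<mu> \<alpha> (e0, 0) \<le> 0"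
    unfolding lambda_hat_conjugate_def by (auto intro!: SUP_least)
  show "0 \<le> lambda_hat_conjugate p \<mu> \<alpha> (e0, 0)"
  proof (rule ccontr)
    assume "\<not> 0 \<le> lambda_hat_conjugate p \<mu> \<alpha> (e0, 0)"
    then obtain L where L: "lambda_hat_conjugate p \<mu> \<alpha> (e0, 0) < ereal L" "ereal L < 0"
      using ereal_dense2 by (metis linorder_not_le)
    have "e0 \<in> l1" using e0_S_tilde S_tilde_subset_l1 by auto
    note fin = lambda_hat_conjugate_finite(4)[OF this less_imp_le[OF L(1)], of 0]
    have "(\<lambda>n. e0 n * ln (e0 n)) = (\<lambda>n. 0)"
      by (auto simp: e0_def)
    with fin L(2) show False
      by (simp add: total_mass_def)
  qed
qed

end

theorem theorem2p9:
  fixes \<mu> :: "'a::t2_space measure" and \<alpha> :: "'a \<Rightarrow> 'a" and p :: real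
  assumes "compact (UNIV :: 'a set)"
    and "sets \<mu> = sets borel"
    and "\<exists>B \<in> sets \<mu>. 0 < emeasure \<mu> B \<and> emeasure \<mu> B < \<infinity>"
    and "continuous_on UNIV \<alpha>"
    and "distr \<mu> borel \<alpha> = \<mu>"
    and "1 \<le> p"
  shows "is_lsc_regularization l1_dual_topology
           (F_functional p \<mu> \<alpha>) (lambda_hat_conjugate p \<mu> \<alpha>) \<and>
         lambda_hat_conjugate p \<mu> \<alpha> (e0, 0) = 0"
proof -
  interpret measure_preserving_system \<mu> \<alpha> p
    using assms by unfold_locales
  show ?thesis
    unfolding is_lsc_regularization_def
    using lsc_lambda_hat_conjugate lambda_hat_conjugate_le_F lambda_hat_conjugate_e0
      lsc_minorant_le_lambda_hat_conjugate
    by (auto simp: topspace_l1_dual_topology)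
qed

end
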